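(* Let $T$ be a simple complete first-order theory, working in a sufficiently saturated model, and let $G$ be a type-definable group. Then the Fitting subgroup $F(G)$ of $G$ (the subgroup generated by all normal nilpotent subgroups of $G$) is nilpotent.
   Context: A type-definable group is a group whose underlying set is an intersection of (boundedly many) definable sets, with the graph of the group operation definable (relative to $G^3$). The ambient model is assumed more saturated than the size of all type-definitions used. *)

theory Defs
  imports "HOL-Algebra.Generated_Groups"
begin

unbundle cardinal_syntax

section \<open>First-order logic\<close>

text \<open>A language is given by sets of function and relation symbols (constants are nullary function
  symbols), so that a language may lack symbols of either sort. Equality is a logical symbol.\<close>

record ('f, 'r) fo_language =
  funs :: "'f set"
  rels :: "'r set"
  fun_arity :: "'f \<Rightarrow> nat"
  rel_arity :: "'r \<Rightarrow> nat"

datatype 'f tm = Var nat | App 'f "'f tm list"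

datatype ('f, 'r) fm =
    Eq "'f tm" "'f tm"
  | Rel 'r "'f tm list"
  | Neg "('f, 'r) fm"
  | Conj "('f, 'r) fm" "('f, 'r) fm"
  | Ex nat "('f, 'r) fm"

fun wf_tm :: "('f, 'r) fo_language \<Rightarrow> 'f tm \<Rightarrow> bool" where
  "wf_tm L (Var i) \<longleftrightarrow> True"
| "wf_tm L (App f ts) \<longleftrightarrow>
     f \<in> funs L \<and> length ts = fun_arity L f \<and> (\<forall>t\<in>set ts. wf_tm L t)"

fun wf_fm :: "('f, 'r) fo_language \<Rightarrow> ('f, 'r) fm \<Rightarrow> bool" where
  "wf_fm L (Eq s t) \<longleftrightarrow> wf_tm L s \<and> wf_tm L t"
| "wf_fm L (Rel R ts) \<longleftrightarrow>
     R \<in> rels L \<and> length ts = rel_arity L R \<and> (\<forall>t\<in>set ts. wf_tm L t)"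
| "wf_fm L (Neg \<phi>) \<longleftrightarrow> wf_fm L \<phi>"
| "wf_fm L (Conj \<phi> \<psi>) \<longleftrightarrow> wf_fm L \<phi> \<and> wf_fm L \<psi>"
| "wf_fm L (Ex i \<phi>) \<longleftrightarrow> wf_fm L \<phi>"

fun fv_tm :: "'f tm \<Rightarrow> nat set" where
  "fv_tm (Var i) = {i}"
| "fv_tm (App f ts) = (\<Union>t\<in>set ts. fv_tm t)"

fun fv :: "('f, 'r) fm \<Rightarrow> nat set" where
  "fv (Eq s t) = fv_tm s \<union> fv_tm t"
| "fv (Rel R ts) = (\<Union>t\<in>set ts. fv_tm t)"
| "fv (Neg \<phi>) = fv \<phi>"
| "fv (Conj \<phi> \<psi>) = fv \<phi> \<union> fv \<psi>"
| "fv (Ex i \<phi>) = fv \<phi> - {i}"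

definition formulas :: "('f, 'r) fo_language \<Rightarrow> ('f, 'r) fm set" where
  "formulas L = {\<phi>. wf_fm L \<phi>}"

definition formulas_in :: "('f, 'r) fo_language \<Rightarrow> nat \<Rightarrow> ('f, 'r) fm set" where
  "formulas_in L n = {\<phi> \<in> formulas L. fv \<phi> \<subseteq> {..<n}}"

abbreviation sentences :: "('f, 'r) fo_language \<Rightarrow> ('f, 'r) fm set" where
  "sentences L \<equiv> formulas_in L 0"

record ('f, 'r, 'a) fo_structure =
  universe :: "'a set"
  fun_int :: "'f \<Rightarrow> 'a list \<Rightarrow> 'a"
  rel_int :: "'r \<Rightarrow> 'a list \<Rightarrow> bool"

definition tuples :: "('f, 'r, 'a) fo_structure \<Rightarrow> nat \<Rightarrow> 'a list set" where
  "tuples M n = {xs. length xs = n \<and> set xs \<subseteq> universe M}"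

definition is_structure :: "('f, 'r) fo_language \<Rightarrow> ('f, 'r, 'a) fo_structure \<Rightarrow> bool" where
  "is_structure L M \<longleftrightarrow> universe M \<noteq> {} \<and>
     (\<forall>f\<in>funs L. \<forall>xs\<in>tuples M (fun_arity L f). fun_int M f xs \<in> universe M)"

fun tm_val :: "('f, 'r, 'a) fo_structure \<Rightarrow> (nat \<Rightarrow> 'a) \<Rightarrow> 'f tm \<Rightarrow> 'a" where
  "tm_val M e (Var i) = e i"
| "tm_val M e (App f ts) = fun_int M f (map (tm_val M e) ts)"

fun sat :: "('f, 'r, 'a) fo_structure \<Rightarrow> (nat \<Rightarrow> 'a) \<Rightarrow> ('f, 'r) fm \<Rightarrow> bool" where
  "sat M e (Eq s t) \<longleftrightarrow> tm_val M e s = tm_val M e t"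
| "sat M e (Rel R ts) \<longleftrightarrow> rel_int M R (map (tm_val M e) ts)"
| "sat M e (Neg \<phi>) \<longleftrightarrow> \<not> sat M e \<phi>"
| "sat M e (Conj \<phi> \<psi>) \<longleftrightarrow> sat M e \<phi> \<and> sat M e \<psi>"
| "sat M e (Ex i \<phi>) \<longleftrightarrow> (\<exists>a\<in>universe M. sat M (e(i := a)) \<phi>)"

text \<open>Only used for \<open>\<phi> \<in> formulas_in L (length xs)\<close>; the value of \<open>xs ! i\<close> for \<open>i \<ge> length xs\<close> is
  then irrelevant.\<close>

definition holds :: "('f, 'r, 'a) fo_structure \<Rightarrow> ('f, 'r) fm \<Rightarrow> 'a list \<Rightarrow> bool" where
  "holds M \<phi> xs \<longleftrightarrow> sat M (\<lambda>i. xs ! i) \<phi>"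

definition is_model ::
  "('f, 'r) fo_language \<Rightarrow> ('f, 'r, 'a) fo_structure \<Rightarrow> ('f, 'r) fm set \<Rightarrow> bool" where
  "is_model L M T \<longleftrightarrow> is_structure L M \<and> (\<forall>\<phi>\<in>T. holds M \<phi> [])"

text \<open>Complete theories are taken to be closed under consequence. Consistency is not part of the
  definition; it follows as soon as \<open>T\<close> has a model.\<close>

definition complete_theory :: "('f, 'r) fo_language \<Rightarrow> ('f, 'r) fm set \<Rightarrow> bool" where
  "complete_theory L T \<longleftrightarrow> T \<subseteq> sentences L \<and> (\<forall>\<phi>\<in>sentences L. \<phi> \<in> T \<or> Neg \<phi> \<in> T)"


section \<open>Simplicity\<close>

text \<open>The formula \<open>\<phi>(x; y)\<close>, with \<open>x\<close> the variables \<open>0, \<dots>, m - 1\<close> and \<open>y\<close> the variables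
  \<open>m, \<dots>, m + n - 1\<close>, has the \<open>k\<close>-tree property in \<open>M\<close>: there are parameters \<open>a s\<close>, indexed by the
  finite sequences \<open>s\<close> of natural numbers, such that the formulas \<open>\<phi>(x; a (s @ [i]))\<close> over the
  children of any node are \<open>k\<close>-inconsistent, while the formulas along any infinite branch are
  consistent, i.e. finitely satisfiable.\<close>

definition has_tree_property ::
  "('f, 'r, 'a) fo_structure \<Rightarrow> ('f, 'r) fm \<Rightarrow> nat \<Rightarrow> nat \<Rightarrow> nat \<Rightarrow> bool" where
  "has_tree_property M \<phi> m n k \<longleftrightarrow>
     (\<exists>a :: nat list \<Rightarrow> 'a list.
        (\<forall>s. a s \<in> tuples M n) \<and>
        (\<forall>s K. finite K \<and> card K = k \<longrightarrow>
           \<not> (\<exists>b\<in>tuples M m. \<forall>i\<in>K. holds M \<phi> (b @ a (s @ [i])))) \<and>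
        (\<forall>\<sigma> :: nat \<Rightarrow> nat. \<forall>J. finite J \<and> J \<subseteq> {0<..} \<longrightarrow>
           (\<exists>b\<in>tuples M m. \<forall>j\<in>J. holds M \<phi> (b @ a (map \<sigma> [0..<j])))))"

text \<open>Models are those with universe a subset of the type \<open>'a\<close>. If \<open>'a\<close> carries an
  \<open>\<aleph>\<^sub>1\<close>-saturated model of the complete theory \<open>T\<close>, a tree occurring in any model of \<open>T\<close> whatsoever
  also occurs in that one, so that the restriction is harmless.\<close>

definition simple_theory ::
  "'a itself \<Rightarrow> ('f, 'r) fo_language \<Rightarrow> ('f, 'r) fm set \<Rightarrow> bool" where
  "simple_theory _ L T \<longleftrightarrow>
     \<not> (\<exists>(M :: ('f, 'r, 'a) fo_structure) m n k.
          is_model L M T \<and> k \<ge> 2 \<and>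
          (\<exists>\<phi>\<in>formulas_in L (m + n). has_tree_property M \<phi> m n k))"


section \<open>Parameters, saturation, type-definable groups\<close>

text \<open>The language \<open>L(A)\<close>, with a new constant for each element of \<open>A\<close>, and the natural expansion of
  a structure in which each such constant names itself.\<close>

definition with_params :: "('f, 'r) fo_language \<Rightarrow> 'a set \<Rightarrow> ('f + 'a, 'r) fo_language" where
  "with_params L A =
     \<lparr>funs = Inl ` funs L \<union> Inr ` A, rels = rels L,
      fun_arity = case_sum (fun_arity L) (\<lambda>_. 0), rel_arity = rel_arity L\<rparr>"

definition expand :: "('f, 'r, 'a) fo_structure \<Rightarrow> ('f + 'a, 'r, 'a) fo_structure" where
  "expand M =
     \<lparr>universe = universe M, fun_int = case_sum (fun_int M) (\<lambda>a _. a), rel_int = rel_int M\<rparr>"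

text \<open>\<open>\<kappa>\<close>-saturation: every finitely satisfiable set of formulas in one variable over fewer than \<open>\<kappa>\<close>
  parameters is realised.\<close>

definition saturated ::
  "'k rel \<Rightarrow> ('f, 'r) fo_language \<Rightarrow> ('f, 'r, 'a) fo_structure \<Rightarrow> bool" where
  "saturated \<kappa> L M \<longleftrightarrow>
     (\<forall>A p. A \<subseteq> universe M \<and> |A| <o \<kappa> \<and> p \<subseteq> formulas_in (with_params L A) 1 \<and>
        (\<forall>q. finite q \<and> q \<subseteq> p \<longrightarrow> (\<exists>b\<in>universe M. \<forall>\<phi>\<in>q. holds (expand M) \<phi> [b])) \<longrightarrow>
        (\<exists>b\<in>universe M. \<forall>\<phi>\<in>p. holds (expand M) \<phi> [b]))"

text \<open>Definable with parameters, as a subset of \<open>M\<^sup>n\<close>.\<close>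

definition definable ::
  "('f, 'r) fo_language \<Rightarrow> ('f, 'r, 'a) fo_structure \<Rightarrow> nat \<Rightarrow> 'a list set \<Rightarrow> bool" where
  "definable L M n S \<longleftrightarrow>
     (\<exists>\<phi>\<in>formulas_in (with_params L (universe M)) n. S = {b \<in> tuples M n. holds (expand M) \<phi> b})"

text \<open>The empty intersection is \<open>M\<^sup>n\<close>.\<close>

definition type_definable ::
  "'k rel \<Rightarrow> ('f, 'r) fo_language \<Rightarrow> ('f, 'r, 'a) fo_structure \<Rightarrow> nat \<Rightarrow> 'a list set \<Rightarrow> bool" where
  "type_definable \<kappa> L M n X \<longleftrightarrow>
     (\<exists>\<D>. |\<D>| <o \<kappa> \<and> (\<forall>D\<in>\<D>. definable L M n D) \<and> X = tuples M n \<inter> \<Inter>\<D>)"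

definition type_definable_group ::
  "'k rel \<Rightarrow> ('f, 'r) fo_language \<Rightarrow> ('f, 'r, 'a) fo_structure \<Rightarrow> nat \<Rightarrow>
     ('a list, 'b) monoid_scheme \<Rightarrow> bool" where
  "type_definable_group \<kappa> L M n G \<longleftrightarrow>
     group G \<and> type_definable \<kappa> L M n (carrier G) \<and>
     (\<exists>D. definable L M (3 * n) D \<and>
        (\<forall>a\<in>carrier G. \<forall>b\<in>carrier G. \<forall>c\<in>carrier G.
           a \<otimes>\<^bsub>G\<^esub> b = c \<longleftrightarrow> a @ b @ c \<in> D))"


section \<open>Nilpotency and the Fitting subgroup\<close>

definition commutator_subgroup :: "('a, 'b) monoid_scheme \<Rightarrow> 'a set \<Rightarrow> 'a set \<Rightarrow> 'a set" where
  "commutator_subgroup G H K =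
     generate G (\<Union>h\<in>H. \<Union>k\<in>K. {h \<otimes>\<^bsub>G\<^esub> k \<otimes>\<^bsub>G\<^esub> inv\<^bsub>G\<^esub> h \<otimes>\<^bsub>G\<^esub> inv\<^bsub>G\<^esub> k})"

fun lower_central :: "('a, 'b) monoid_scheme \<Rightarrow> nat \<Rightarrow> 'a set" where
  "lower_central G 0 = carrier G"
| "lower_central G (Suc i) = commutator_subgroup G (lower_central G i) (carrier G)"

definition nilpotent_group :: "('a, 'b) monoid_scheme \<Rightarrow> bool" where
  "nilpotent_group G \<longleftrightarrow> group G \<and> (\<exists>c. lower_central G c = {\<one>\<^bsub>G\<^esub>})"

definition fitting_subgroup :: "('a, 'b) monoid_scheme \<Rightarrow> 'a set" where
  "fitting_subgroup G =
     generate G (\<Union>{N. N \<lhd> G \<and> nilpotent_group (G\<lparr>carrier := N\<rparr>)})"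

end

theory Submission
  imports Defs "HOL-Library.FuncSet" "HOL-Library.Countable"
begin

text \<open>Simplicity and saturation bound, for every tuple of group words \<open>t(x; y)\<close>, the branching trees of
  values of \<open>t\<close> in \<open>G\<close>: an unbounded family of such trees would yield an infinite one and hence the
  tree property. For \<open>t = x y x\<^sup>-\<^sup>1\<close> this says that chains of centralisers, each of large index in its
  predecessor, have bounded length. The bound for all words passes to subgroups and to the quotient by
  the FC-centre, which is commensurable with the centraliser of a finite set.

  The Fitting subgroup \<open>F\<close> is a union of normal subgroups that act nilpotently on it, so \<open>F\<close> acts
  nilpotently on each of its finite sections. Arguments of B. H. Neumann then show that the FC-centre of
  \<open>F\<close> lies in a finite term of the upper central series \<open>Z\<^sub>n\<close>, so that one may factor out every
  \<open>Z\<^sub>n\<close>. Up to finite index, the centraliser \<open>S\<close> of a suitable \<open>Z\<^sub>m\<close> centralises the union \<open>Z\<^sub>\<omega>\<close> of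
  all \<open>Z\<^sub>n\<close> modulo some \<open>Z\<^sub>n\<close>, and \<open>F/S\<close> is nilpotent. Modulo that \<open>Z\<^sub>n\<close>, \<open>V = Z\<^sub>\<omega> \<inter> S\<close> is an abelian
  group on which the nilpotent group \<open>F/S\<close> acts by unipotent elements; induction on the length of
  centraliser chains gives \<open>V \<subseteq> Z\<^sub>k\<close> for some \<open>k\<close>. After factoring out \<open>Z\<^sub>k\<close>, the image of \<open>S\<close> meets
  the FC-centre trivially, which forces it to be trivial. Hence \<open>S\<close> lies in some \<open>Z\<^sub>j\<close>, and \<open>F\<close> is
  nilpotent.\<close>


subsection \<open>Subgroups\<close>

text \<open>Quotients of \<open>G\<close> are in general not type-definable, so simplicity cannot be
  applied to them again; what is carried along has to be a property of abstract groups. A bound for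
  trees of conjugates alone need not survive: equality modulo the FC-centre is not an equation
  between group words. Up to a bounded factor, however, it amounts to equality of the conjugates of
  finitely many fixed elements, that is, to equations between longer words. Hence the bound for all
  tuples of words at once. Dividing by a term of the upper central series is in fact done by
  dividing out the FC-centre repeatedly; the kernel contains that term and lies in a later one. The
  parameters of a tree depend on the level only, never on the node. Translating a tree from a
  centraliser to one of its cosets therefore keeps the parameters. Saturation speaks of single
  elements, while a tree needs countably many n-tuples; blocks of n variables and a passage from one
  to countably many variables bridge this.\<close>

text \<open>Groups are subsets of a type of class \<^class>\<open>group_add\<close>, which is written additively but need not be
  commutative; identities between group words then hold without membership conditions and are decided
  by rewriting.\<close>

definition conjg :: "'g::group_add \<Rightarrow> 'g \<Rightarrow> 'g" where
  "conjg x y = x + y - x"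

definition comm :: "'g::group_add \<Rightarrow> 'g \<Rightarrow> 'g" where
  "comm x y = x + y - x - y"

lemmas free_group_simps = conjg_def comm_def add.assoc diff_conv_add_uminus minus_add minus_minus
  add_minus_cancel minus_add_cancel add_0_left add_0_right left_minus right_minus minus_zero

definition sub_grp :: "'g::group_add set \<Rightarrow> bool" where
  "sub_grp H \<longleftrightarrow> 0 \<in> H \<and> (\<forall>x\<in>H. \<forall>y\<in>H. x + y \<in> H) \<and> (\<forall>x\<in>H. - x \<in> H)"

definition normal_in :: "'g::group_add set \<Rightarrow> 'g set \<Rightarrow> bool" where
  "normal_in F N \<longleftrightarrow> sub_grp F \<and> sub_grp N \<and> N \<subseteq> F \<and> (\<forall>f\<in>F. \<forall>x\<in>N. conjg f x \<in> N)"

lemma sub_grpD: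
  assumes "sub_grp H"
  shows sub_grp_0: "0 \<in> H" and sub_grp_add: "\<And>x y. x \<in> H \<Longrightarrow> y \<in> H \<Longrightarrow> x + y \<in> H"
    and sub_grp_minus: "\<And>x. x \<in> H \<Longrightarrow> - x \<in> H"
    and sub_grp_diff: "\<And>x y. x \<in> H \<Longrightarrow> y \<in> H \<Longrightarrow> x - y \<in> H"
    and sub_grp_conjg: "\<And>x y. x \<in> H \<Longrightarrow> y \<in> H \<Longrightarrow> conjg x y \<in> H"
    and sub_grp_comm: "\<And>x y. x \<in> H \<Longrightarrow> y \<in> H \<Longrightarrow> comm x y \<in> H"
  using assms unfolding sub_grp_def by (simp_all only: free_group_simps)

lemma normal_inD:
  assumes "normal_in F N"
  shows "sub_grp F" "sub_grp N" "N \<subseteq> F" "\<And>f x. f \<in> F \<Longrightarrow> x \<in> N \<Longrightarrow> conjg f x \<in> N"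
  using assms unfolding normal_in_def by auto

lemma normal_in_comm:
  assumes "normal_in F N" "x \<in> N" "f \<in> F"
  shows "comm x f \<in> N" "comm f x \<in> N"
proof -
  have "conjg f (- x) \<in> N" "conjg f x \<in> N"
    using assms normal_inD sub_grp_minus by metis+
  moreover have "comm x f = x + conjg f (- x)" "comm f x = conjg f x - x"
    by (simp_all only: free_group_simps)
  ultimately show "comm x f \<in> N" "comm f x \<in> N"
    using assms normal_inD(2) sub_grp_add sub_grp_diff by metis+
qed

lemma normal_in_self: "sub_grp F \<Longrightarrow> normal_in F F"
  unfolding normal_in_def by (auto intro: sub_grp_conjg)

lemma normal_in_zero: "sub_grp F \<Longrightarrow> normal_in F {0}"
  unfolding normal_in_def sub_grp_def conjg_def by auto

lemma normal_in_Int: "normal_in F N \<Longrightarrow> normal_in F M \<Longrightarrow> normal_in F (N \<inter> M)"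
  unfolding normal_in_def sub_grp_def by auto

lemma comm_0_iff: "comm x y = 0 \<longleftrightarrow> conjg x y = y"
  by (metis comm_def conjg_def eq_iff_diff_eq_0)

lemma comm_sym: "comm y x = - comm x y"
  by (simp only: free_group_simps)

lemma comm_0_sym: "comm x y = 0 \<longleftrightarrow> comm y x = 0"
  by (metis comm_sym neg_equal_0_iff_equal)


subsection \<open>Central series relative to a normal subgroup\<close>

definition cent_mod :: "'g::group_add set \<Rightarrow> 'g set \<Rightarrow> 'g set \<Rightarrow> 'g set" where
  "cent_mod F N B = {x \<in> F. \<forall>f\<in>N. comm x f \<in> B}"

text \<open>A relative upper central series: \<open>ucs F F {0}\<close> is the usual one,
  \<open>ucs F F B\<close> is the preimage of that of F/B for normal \<open>B\<close>, and
  \<open>F\<close> being contained in \<open>ucs F N {0} c\<close> says that all left-normed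
  commutators [f, x1, ..., xc] with f in \<open>F\<close> and the xi in \<open>N\<close>
  vanish.\<close>

definition ucs :: "'g::group_add set \<Rightarrow> 'g set \<Rightarrow> 'g set \<Rightarrow> nat \<Rightarrow> 'g set" where
  "ucs F N B n = (cent_mod F N ^^ n) B"

lemma ucs_0 [simp]: "ucs F N B 0 = B"
  and ucs_Suc: "ucs F N B (Suc n) = cent_mod F N (ucs F N B n)"
  and ucs_Suc': "ucs F N B (Suc n) = ucs F N (cent_mod F N B) n"
  by (auto simp: ucs_def funpow_swap1)

lemma normal_in_cent_mod:
  assumes "normal_in F B" "normal_in F N"
  shows "normal_in F (cent_mod F N B)"
proof -
  note B = normal_inD[OF assms(1)] and N = normal_inD[OF assms(2)]
  have add: "comm (x + y) f \<in> B" if "x \<in> F" "comm x f \<in> B" "comm y f \<in> B" for x y f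
  proof -
    have "comm (x + y) f = conjg x (comm y f) + comm x f" by (simp only: free_group_simps)
    then show ?thesis using that B by (metis sub_grp_add)
  qed
  have neg: "comm (- x) f \<in> B" if "x \<in> F" "comm x f \<in> B" for x f
  proof -
    have "comm (- x) f = conjg (- x) (- comm x f)" by (simp only: free_group_simps)
    then show ?thesis using that B by (metis sub_grp_minus)
  qed
  have con: "comm (conjg g x) f \<in> B" if "g \<in> F" "\<forall>f\<in>N. comm x f \<in> B" "f \<in> N" for g x f
  proof -
    have "comm (conjg g x) f = conjg g (comm x (conjg (- g) f))" by (simp only: free_group_simps)
    then show ?thesis using that B N by (metis sub_grp_minus)
  qed
  have zero: "comm 0 f = 0" for f :: 'a by (simp only: free_group_simps)
  show ?thesis
    unfolding normal_in_def sub_grp_def cent_mod_def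
    using add neg con zero B N
    by (auto intro: sub_grp_0 sub_grp_add sub_grp_minus sub_grp_conjg)
qed

lemma normal_in_ucs:
  assumes "normal_in F B" "normal_in F N"
  shows "normal_in F (ucs F N B n)"
  by (induction n) (use assms in \<open>auto simp: ucs_Suc intro: normal_in_cent_mod\<close>)

lemma cent_mod_mono: "B \<subseteq> B' \<Longrightarrow> N' \<subseteq> N \<Longrightarrow> cent_mod F N B \<subseteq> cent_mod F N' B'"
  unfolding cent_mod_def by auto

lemma ucs_mono: "B \<subseteq> B' \<Longrightarrow> ucs F N B n \<subseteq> ucs F N B' n"
  by (induction n) (auto simp: ucs_Suc dest: cent_mod_mono)

lemma ucs_add: "ucs F N (ucs F N B m) n = ucs F N B (n + m)"
  by (simp add: ucs_def funpow_add)

lemma cent_mod_upper: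
  assumes "normal_in F B" "N \<subseteq> F"
  shows "B \<subseteq> cent_mod F N B"
  using normal_in_comm[OF assms(1)] normal_inD(3)[OF assms(1)] assms(2) unfolding cent_mod_def by auto

lemma ucs_increasing:
  assumes "normal_in F B" "normal_in F N" "m \<le> n"
  shows "ucs F N B m \<subseteq> ucs F N B n"
  using assms(3)
proof (induction rule: dec_induct)
  case (step i)
  then show ?case
    using cent_mod_upper[OF normal_in_ucs[OF assms(1,2)] normal_inD(3)[OF assms(2)], of i]
    by (auto simp: ucs_Suc)
qed simp

text \<open>Stands for A/B lying in a finite term of the upper central series of F/B, without
  forming a quotient. Being transitive, it is the form in which all later progress is recorded; the
  goal is \<open>nil_over F F {0}\<close>.\<close>

definition nil_over :: "'g::group_add set \<Rightarrow> 'g set \<Rightarrow> 'g set \<Rightarrow> bool" where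
  "nil_over F A B \<longleftrightarrow> (\<exists>n. A \<subseteq> ucs F F B n)"

lemma nil_over_trans:
  assumes "nil_over F A B" "nil_over F B C"
  shows "nil_over F A C"
proof -
  obtain n m where "A \<subseteq> ucs F F B n" "B \<subseteq> ucs F F C m"
    using assms unfolding nil_over_def by auto
  then have "A \<subseteq> ucs F F C (n + m)"
    using ucs_mono[of B "ucs F F C m" F F n] by (auto simp: ucs_add)
  then show ?thesis unfolding nil_over_def by auto
qed

lemma nil_over_subset: "A \<subseteq> B \<Longrightarrow> nil_over F A B"
  unfolding nil_over_def by (metis ucs_0)



subsection \<open>Normal subgroups acting nilpotently\<close>

definition set_sum :: "'g::group_add set \<Rightarrow> 'g set \<Rightarrow> 'g set" where
  "set_sum N M = {n + m | n m. n \<in> N \<and> m \<in> M}"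

lemma set_sumI: "n \<in> N \<Longrightarrow> m \<in> M \<Longrightarrow> n + m \<in> set_sum N M"
  unfolding set_sum_def by blast

lemma normal_in_set_sum:
  assumes "normal_in F N" "normal_in F M"
  shows "normal_in F (set_sum N M)" "N \<subseteq> set_sum N M" "M \<subseteq> set_sum N M"
proof -
  note N = normal_inD[OF assms(1)] and M = normal_inD[OF assms(2)]
  have 1: "(n + m) + (n' + m') \<in> set_sum N M" if "n \<in> N" "m \<in> M" "n' \<in> N" "m' \<in> M" for n m n' m'
  proof -
    have "(n + m) + (n' + m') = (n + conjg m n') + (m + m')" by (simp only: free_group_simps)
    moreover have "n + conjg m n' \<in> N" "m + m' \<in> M"
      using that N(4)[of m n'] M(3) sub_grp_add[OF N(2)] sub_grp_add[OF M(2)] by auto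
    ultimately show ?thesis using set_sumI by metis
  qed
  have 2: "- (n + m) \<in> set_sum N M" if "n \<in> N" "m \<in> M" for n m
  proof -
    have "- (n + m) = conjg (- m) (- n) + - m" by (simp only: free_group_simps)
    moreover have "- m \<in> M" using that(2) sub_grp_minus[OF M(2)] by auto
    moreover have "conjg (- m) (- n) \<in> N"
      using that(1) \<open>- m \<in> M\<close> M(3) sub_grp_minus[OF N(2)] N(4) by blast
    ultimately show ?thesis using set_sumI by metis
  qed
  have 3: "conjg f (n + m) \<in> set_sum N M" if "n \<in> N" "m \<in> M" "f \<in> F" for n m f
  proof -
    have "conjg f (n + m) = conjg f n + conjg f m" by (simp only: free_group_simps)
    then show ?thesis using N(4)[OF that(3,1)] M(4)[OF that(3,2)] set_sumI by metis
  qed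
  have 4: "N \<subseteq> set_sum N M" "M \<subseteq> set_sum N M"
    using set_sumI[OF _ sub_grp_0[OF M(2)], of _ N] set_sumI[OF sub_grp_0[OF N(2)], of _ M] by auto
  have 5: "set_sum N M \<subseteq> F" unfolding set_sum_def using N(3) M(3)
    by (auto intro!: sub_grp_add[OF N(1)])
  have 6: "0 \<in> set_sum N M" using 4 sub_grp_0[OF N(2)] by blast
  have 7: "\<exists>n\<in>N. \<exists>m\<in>M. x = n + m" if "x \<in> set_sum N M" for x using that unfolding set_sum_def by auto
  have "sub_grp (set_sum N M)"
    unfolding sub_grp_def using 1 2 6 by (blast dest!: 7)
  then show "normal_in F (set_sum N M)"
    unfolding normal_in_def using 3 5 N(1) by (blast dest!: 7)
  show "N \<subseteq> set_sum N M" "M \<subseteq> set_sum N M" by (fact 4)+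
qed

text \<open>Fitting's argument, by induction on i + j: a commutator of x with an element of
  \<open>N\<close> lowers i and, \<open>ucs F M C j\<close> being normal, keeps j; an element of
  \<open>M\<close> does the opposite. As [x, n + m] is [x, n] plus a conjugate of [x, m], both
  contributions land one step lower.\<close>

lemma ucs_set_sum:
  assumes N: "normal_in F N" and M: "normal_in F M" and C: "normal_in F C"
    and x: "x \<in> ucs F N C i" "x \<in> ucs F M C j"
  shows "x \<in> ucs F (set_sum N M) C (i + j)"
  using x
proof (induction "i + j" arbitrary: i j x rule: less_induct)
  case less
  note NM = normal_in_set_sum[OF N M]
  note nU = normal_in_ucs[OF C NM(1)]
  show ?case
  proof (cases "i = 0 \<or> j = 0")
    case True
    then show ?thesis
      using less.prems ucs_increasing[OF C NM(1), of 0 "i + j"] by auto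
  next
    case False
    then obtain i' j' where ij: "i = Suc i'" "j = Suc j'" by (metis not0_implies_Suc)
    have xF: "x \<in> F" using less.prems normal_inD(3)[OF normal_in_ucs[OF C N]] by blast
    have "comm x (n + m) \<in> ucs F (set_sum N M) C (i' + j)" if nm: "n \<in> N" "m \<in> M" for n m
    proof -
      have nF: "n \<in> F" "m \<in> F" using nm N M normal_inD(3) by blast+
      have 1: "comm x n \<in> ucs F (set_sum N M) C (i' + j)"
        using less.hyps[of i' j "comm x n"] less.prems ij nm
          normal_in_comm(1)[OF normal_in_ucs[OF C M] _ nF(1), of x j]
        by (auto simp: ucs_Suc cent_mod_def)
      have 2: "comm x m \<in> ucs F (set_sum N M) C (i + j')"
        using less.hyps[of i j' "comm x m"] less.prems ij nm
          normal_in_comm(1)[OF normal_in_ucs[OF C N] _ nF(2), of x i]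
        by (auto simp: ucs_Suc cent_mod_def)
      have "comm x (n + m) = comm x n + conjg n (comm x m)" by (simp only: free_group_simps)
      moreover have "i + j' = i' + j" using ij by auto
      ultimately show ?thesis
        using 1 2 normal_inD[OF nU] nF by (metis sub_grp_add)
    qed
    then have "x \<in> ucs F (set_sum N M) C (Suc (i' + j))"
      unfolding ucs_Suc cent_mod_def set_sum_def using xF by auto
    then show ?thesis using ij by simp
  qed
qed

text \<open>A nilpotent action on all of \<open>F\<close> is asked for, rather than nilpotency of
  \<open>N\<close>. For a nilpotent normal \<open>N\<close> this costs one more commutator, since
  [F, N] lies in \<open>N\<close>; in return finite subsets of a Fitting group act nilpotently on
  its sections.\<close>

definition nil_act :: "'g::group_add set \<Rightarrow> 'g set \<Rightarrow> bool" where
  "nil_act F N \<longleftrightarrow> normal_in F N \<and> (\<exists>c. F \<subseteq> ucs F N {0} c)"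

definition fitting_group :: "'g::group_add set \<Rightarrow> bool" where
  "fitting_group F \<longleftrightarrow> sub_grp F \<and> (\<forall>x\<in>F. \<exists>N. nil_act F N \<and> x \<in> N)"

lemma nil_act_set_sum:
  assumes "nil_act F N" "nil_act F M"
  shows "nil_act F (set_sum N M)"
proof -
  from assms obtain c d where *: "normal_in F N" "F \<subseteq> ucs F N {0} c" "normal_in F M" "F \<subseteq> ucs F M {0} d"
    unfolding nil_act_def by auto
  then have "F \<subseteq> ucs F (set_sum N M) {0} (c + d)"
    using ucs_set_sum[OF *(1,3) normal_in_zero] normal_inD(1) by blast
  then show ?thesis using normal_in_set_sum(1)[OF *(1,3)] unfolding nil_act_def by auto
qed

lemma fitting_group_finite:
  assumes "fitting_group F" "finite X" "X \<subseteq> F"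
  shows "\<exists>N. nil_act F N \<and> X \<subseteq> N"
  using assms(2,3)
proof (induction X)
  case empty
  show ?case using assms(1) sub_grp_0 unfolding fitting_group_def by blast
next
  case (insert x X)
  then obtain N M where NM: "nil_act F N" "X \<subseteq> N" "nil_act F M" "x \<in> M"
    using assms(1) unfolding fitting_group_def by auto
  then have "normal_in F N" "normal_in F M" unfolding nil_act_def by auto
  from normal_in_set_sum[OF this] NM show ?case
    using nil_act_set_sum[OF NM(1,3)] by blast
qed


lemma set_sumE:
  assumes "x \<in> set_sum T K"
  obtains t where "t \<in> T" "- t + x \<in> K"
  using assms unfolding set_sum_def by (auto simp: minus_add_cancel)


subsection \<open>Finite index\<close>

definition fin_index :: "'g::group_add set \<Rightarrow> 'g set \<Rightarrow> bool" where
  "fin_index H K \<longleftrightarrow> (\<exists>T. finite T \<and> T \<subseteq> H \<and> H \<subseteq> set_sum T K)"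

lemma fin_indexI:
  assumes "finite (p ` H)" "\<And>x y. x \<in> H \<Longrightarrow> y \<in> H \<Longrightarrow> p x = p y \<Longrightarrow> - x + y \<in> K"
  shows "fin_index H K"
proof -
  obtain T where T: "T \<subseteq> H" "finite T" "p ` H = p ` T"
    using finite_subset_image[OF assms(1), of p H] by auto
  have "h \<in> set_sum T K" if "h \<in> H" for h
  proof -
    obtain t where t: "t \<in> T" "p h = p t" using T(3) \<open>h \<in> H\<close> by (metis imageE imageI)
    then have "- t + h \<in> K" using assms(2)[of t h] T(1) \<open>h \<in> H\<close> by auto
    moreover have "h = t + (- t + h)" by (simp only: free_group_simps)
    ultimately show ?thesis using t(1) unfolding set_sum_def by blast
  qed
  then show ?thesis unfolding fin_index_def using T by blast
qed

lemma fin_indexI_cover: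
  assumes "sub_grp K" "finite T" "H \<subseteq> set_sum T K"
  shows "fin_index H K"
proof -
  have "\<forall>h\<in>H. \<exists>t. t \<in> T \<and> - t + h \<in> K"
    using assms(3) set_sumE by (metis subsetD)
  then obtain p where p: "\<And>h. h \<in> H \<Longrightarrow> p h \<in> T \<and> - p h + h \<in> K" by metis
  show ?thesis
  proof (rule fin_indexI)
    show "finite (p ` H)" using p assms(2) by (meson finite_subset image_subsetI)
    fix x y assume "x \<in> H" "y \<in> H" "p x = p y"
    then have "- (- p x + x) + (- p x + y) \<in> K"
      using p assms(1) sub_grp_add sub_grp_minus by metis
    then show "- x + y \<in> K" by (simp only: free_group_simps)
  qed
qed

lemma fin_index_Int:
  assumes "fin_index H K" "sub_grp K" "sub_grp H'" "H' \<subseteq> H"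
  shows "fin_index H' (H' \<inter> K)"
proof -
  obtain T where T: "finite T" "H \<subseteq> set_sum T K" using assms(1) unfolding fin_index_def by auto
  have "\<forall>h\<in>H'. \<exists>t. t \<in> T \<and> - t + h \<in> K"
    using T(2) assms(4) set_sumE by (metis subsetD)
  then obtain p where p: "\<And>h. h \<in> H' \<Longrightarrow> p h \<in> T \<and> - p h + h \<in> K" by metis
  show ?thesis
  proof (rule fin_indexI)
    show "finite (p ` H')" using p T(1) by (meson finite_subset image_subsetI)
    fix x y assume xy: "x \<in> H'" "y \<in> H'" "p x = p y"
    then have "- (- p x + x) + (- p x + y) \<in> K"
      using p assms(2) sub_grp_add sub_grp_minus by metis
    then show "- x + y \<in> H' \<inter> K" 
      using xy sub_grp_add[OF assms(3)] sub_grp_minus[OF assms(3)] by (simp only: free_group_simps Int_iff)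
  qed
qed

lemma neumann_cover:
  assumes "finite \<K>" "\<And>K. K \<in> \<K> \<Longrightarrow> sub_grp K \<and> K \<subseteq> B" "sub_grp B"
    and "finite T" "B \<subseteq> (\<Union>K\<in>\<K>. set_sum T K)"
  shows "\<exists>K\<in>\<K>. fin_index B K"
  using assms
proof (induction \<K> arbitrary: T rule: finite_induct)
  case empty
  then show ?case using sub_grp_0 by fastforce
next
  case (insert K \<K>)
  show ?case
  proof (cases "B \<subseteq> set_sum T K")
    case True
    then show ?thesis using fin_indexI_cover[OF _ insert.prems(3) True] insert.prems(1)[of K] by blast
  next
    case False
    then obtain b where b: "b \<in> B" "b \<notin> set_sum T K" by auto
    define T' where "T' = T \<union> (\<lambda>(t, t'). t - b + t') ` (T \<times> T)"
    have TT': "set_sum T K' \<subseteq> set_sum T' K'" for K' unfolding T'_def set_sum_def by blast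
    have cov: "B \<subseteq> (\<Union>K'\<in>\<K>. set_sum T' K')"
    proof
      fix x assume x: "x \<in> B"
      show "x \<in> (\<Union>K'\<in>\<K>. set_sum T' K')"
      proof (cases "x \<in> (\<Union>K'\<in>\<K>. set_sum T K')")
        case True
        then show ?thesis using TT' by blast
      next
        case False
        then obtain t k where tk: "t \<in> T" "k \<in> K" "x = t + k"
          using x insert.prems(4) unfolding set_sum_def by auto
        have "b + k \<notin> set_sum T K"
        proof
          assume "b + k \<in> set_sum T K"
          then obtain s l where sl: "s \<in> T" "l \<in> K" "b + k = s + l" unfolding set_sum_def by auto
          have "b = b + k - k" by (simp only: free_group_simps)
          also have "\<dots> = s + (l - k)" unfolding sl(3) by (simp only: free_group_simps)
          finally have "b = s + (l - k)" .
          moreover have "l - k \<in> K" using sl tk insert.prems(1)[of K] sub_grp_diff[of K] by blast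
          ultimately show False using b(2) sl(1) unfolding set_sum_def by blast
        qed
        moreover have "b + k \<in> B"
          using b(1) tk(2) insert.prems(1)[of K] sub_grp_add[OF insert.prems(2)] by blast
        ultimately obtain K' where "K' \<in> \<K>" "b + k \<in> set_sum T K'"
          using insert.prems(4) by auto
        then obtain t' k' where tk': "K' \<in> \<K>" "t' \<in> T" "k' \<in> K'" "b + k = t' + k'"
          unfolding set_sum_def by auto
        have "x = (t - b) + (b + k)" unfolding tk(3) by (simp only: free_group_simps)
        then have "x = (t - b + t') + k'" unfolding tk'(4) by (simp only: free_group_simps)
        moreover have "t - b + t' \<in> T'" using tk(1) tk'(2) unfolding T'_def by auto
        ultimately have "x \<in> set_sum T' K'" using tk'(3) unfolding set_sum_def by blast
        then show ?thesis using tk'(1) by blast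
      qed
    qed
    have "finite T'" unfolding T'_def using insert.prems(3) by auto
    have "\<exists>K\<in>\<K>. fin_index B K"
      by (rule insert.IH[OF _ insert.prems(2) \<open>finite T'\<close> cov]) (use insert.prems(1) in auto)
    then show ?thesis by blast
  qed
qed

definition orbit :: "'g::group_add set \<Rightarrow> 'g \<Rightarrow> 'g set" where
  "orbit H y = (\<lambda>x. conjg x y) ` H"

definition centr :: "'g::group_add set \<Rightarrow> 'g set \<Rightarrow> 'g set" where
  "centr H Y = {x \<in> H. \<forall>y\<in>Y. conjg x y = y}"

lemma conjg_eq_iff: "conjg x b = conjg y b \<longleftrightarrow> conjg (- x + y) b = b"
proof
  assume *: "conjg x b = conjg y b"
  have "conjg (- x + y) b = - x + conjg y b + x" by (simp only: free_group_simps)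
  then show "conjg (- x + y) b = b" unfolding *[symmetric] by (simp only: free_group_simps)
next
  assume *: "conjg (- x + y) b = b"
  have "conjg y b = conjg x (conjg (- x + y) b)" by (simp only: free_group_simps)
  then show "conjg x b = conjg y b" unfolding * by simp
qed

lemma sub_grp_centr: "sub_grp H \<Longrightarrow> sub_grp (centr H Y)"
proof -
  have 1: "conjg (x + y) b = conjg x (conjg y b)" for x y b :: 'a by (simp only: free_group_simps)
  have 2: "conjg (- x) b = b" if "conjg x b = b" for x b :: 'a
    using conjg_eq_iff[of x b 0] that by (simp add: conjg_def)
  have 3: "conjg 0 b = b" for b :: 'a by (simp only: free_group_simps)
  show "sub_grp H \<Longrightarrow> sub_grp (centr H Y)"
    unfolding sub_grp_def centr_def using 1 2 3 by auto
qed

lemma normal_in_centr: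
  assumes "normal_in F Y"
  shows "normal_in F (centr F Y)"
proof -
  note Y = normal_inD[OF assms]
  have "conjg (conjg f x) y = y" if "f \<in> F" "\<forall>y\<in>Y. conjg x y = y" "y \<in> Y" for f x y
  proof -
    have "conjg (conjg f x) y = conjg f (conjg x (conjg (- f) y))" by (simp only: free_group_simps)
    also have "conjg x (conjg (- f) y) = conjg (- f) y"
      using that Y(4) sub_grp_minus[OF Y(1)] by blast
    also have "conjg f (conjg (- f) y) = y" by (simp only: free_group_simps)
    finally show ?thesis .
  qed
  then show ?thesis
    using sub_grp_centr[OF Y(1), of Y] Y(1) sub_grp_conjg[OF Y(1)]
    unfolding normal_in_def centr_def by blast
qed

lemma fin_index_centr:
  assumes "sub_grp H" "finite Y" "\<And>y. y \<in> Y \<Longrightarrow> finite (orbit H y)"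
  shows "fin_index H (centr H Y)"
proof (rule fin_indexI[where p = "\<lambda>h. restrict (conjg h) Y"])
  have "(\<lambda>h. restrict (conjg h) Y) ` H \<subseteq> PiE Y (orbit H)"
    unfolding orbit_def by auto
  then show "finite ((\<lambda>h. restrict (conjg h) Y) ` H)"
    using finite_PiE[of Y "orbit H"] assms(2,3) finite_subset by blast
next
  fix x y assume *: "x \<in> H" "y \<in> H" "restrict (conjg x) Y = restrict (conjg y) Y"
  have "conjg (- x + y) b = b" if "b \<in> Y" for b
  proof -
    have "conjg x b = conjg y b" using fun_cong[OF *(3), of b] that by simp
    then show ?thesis by (simp only: conjg_eq_iff)
  qed
  moreover have "- x + y \<in> H" using *(1,2) sub_grp_add[OF assms(1)] sub_grp_minus[OF assms(1)] by blast
  ultimately show "- x + y \<in> centr H Y" unfolding centr_def by blast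
qed

text \<open>Finitely many representatives of \<open>F\<close> modulo \<open>F1\<close> lie in one
  normal \<open>N\<close> that acts nilpotently in c steps. \<open>F1\<close> centralises
  \<open>B\<close> modulo \<open>C\<close>, and \<open>N\<close> and \<open>F1\<close> together make
  up \<open>F\<close>; adding the two actions gives c + 1 steps.\<close>

lemma nil_over_fin_index:
  assumes F: "fitting_group F" and F1: "normal_in F F1" "fin_index F F1"
    and C: "normal_in F C" and B: "B \<subseteq> cent_mod F F1 C"
  shows "nil_over F B C"
proof -
  obtain T where T: "finite T" "T \<subseteq> F" "F \<subseteq> set_sum T F1" using F1(2) unfolding fin_index_def by auto
  obtain N where N: "nil_act F N" "T \<subseteq> N" using fitting_group_finite[OF F T(1,2)] by auto
  obtain c where nN: "normal_in F N" "F \<subseteq> ucs F N {0} c" using N(1) unfolding nil_act_def by auto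
  have "F \<subseteq> set_sum N F1" using T(3) N(2) unfolding set_sum_def by blast
  then have eq: "set_sum N F1 = F" using normal_inD(3)[OF normal_in_set_sum(1)[OF nN(1) F1(1)]] by auto
  have "{0} \<subseteq> C" using sub_grp_0[OF normal_inD(2)[OF C]] by auto
  have "b \<in> ucs F F C (c + 1)" if "b \<in> B" for b
  proof -
    have "b \<in> F" using that B unfolding cent_mod_def by auto
    then have "b \<in> ucs F N C c" using nN(2) ucs_mono[OF \<open>{0} \<subseteq> C\<close>, of F N c] by auto
    moreover have "b \<in> ucs F F1 C 1" using that B by (auto simp: ucs_Suc)
    ultimately show ?thesis using ucs_set_sum[OF nN(1) F1(1) C] eq by metis
  qed
  then show ?thesis unfolding nil_over_def by auto
qed

lemma coset_eq:
  assumes "sub_grp C"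
  shows "(+) x ` C = (+) y ` C \<longleftrightarrow> - x + y \<in> C"
proof
  assume "(+) x ` C = (+) y ` C"
  then have "y \<in> (+) x ` C" using sub_grp_0[OF assms] by (metis add.right_neutral imageI)
  then show "- x + y \<in> C" by (auto simp: minus_add_cancel)
next
  assume *: "- x + y \<in> C"
  have 1: "x + c = y + (- (- x + y) + c)" "y + c = x + ((- x + y) + c)" for c by (simp_all only: free_group_simps)
  show "(+) x ` C = (+) y ` C"
  proof (intro equalityI subsetI)
    fix z assume "z \<in> (+) x ` C"
    then obtain c where "c \<in> C" "z = y + (- (- x + y) + c)" using 1(1) by auto
    then show "z \<in> (+) y ` C" using * sub_grp_add[OF assms] sub_grp_minus[OF assms] by blast
  next
    fix z assume "z \<in> (+) y ` C"
    then obtain c where "c \<in> C" "z = x + ((- x + y) + c)" using 1(2) by auto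
    then show "z \<in> (+) x ` C" using * sub_grp_add[OF assms] by blast
  qed
qed

text \<open>\<open>F\<close> permutes the finite set B/C by conjugation, so the kernel
  \<open>F1\<close> of this action has finite index, and \<open>nil_over_fin_index\<close>
  applies.\<close>

lemma nil_over_fin_quotient:
  assumes F: "fitting_group F" and B: "normal_in F B" and C: "normal_in F C"
    and fin: "fin_index B C"
  shows "nil_over F B C"
proof -
  note B' = normal_inD[OF B] and C' = normal_inD[OF C]
  have sF: "sub_grp F" by (fact B'(1))
  define F1 where "F1 = {f \<in> F. \<forall>b\<in>B. comm b f \<in> C}"
  obtain T where T: "finite T" "T \<subseteq> B" "B \<subseteq> set_sum T C" using fin unfolding fin_index_def by auto
  have F1_alt: "F1 = cent_mod F B C"
    unfolding F1_def cent_mod_def using comm_sym sub_grp_minus[OF C'(2)] minus_minus by metis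
  have nF1: "normal_in F F1" unfolding F1_alt by (rule normal_in_cent_mod[OF C B])
  have quo: "finite ((\<lambda>b. (+) b ` C) ` B)"
  proof (rule finite_subset)
    show "(\<lambda>b. (+) b ` C) ` B \<subseteq> (\<lambda>b. (+) b ` C) ` T"
    proof
      fix X assume "X \<in> (\<lambda>b. (+) b ` C) ` B"
      then obtain b where b: "b \<in> B" "X = (+) b ` C" by auto
      then obtain t where t: "t \<in> T" "- t + b \<in> C" using T(3) set_sumE by (metis subsetD)
      then have "X = (+) t ` C" using b(2) coset_eq[OF C'(2), of t b] by simp
      then show "X \<in> (\<lambda>b. (+) b ` C) ` T" using t(1) by auto
    qed
  qed (use T(1) in auto)
  \<comment> \<open>The invariant of f is its effect on the cosets of the representatives in
    \<open>T\<close>; equal invariants of f and g force - f + g to fix every coset.\<close>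
  have "fin_index F F1"
  proof (rule fin_indexI[where p = "\<lambda>f. restrict (\<lambda>t. (+) (conjg f t) ` C) T"])
    have "(\<lambda>f. restrict (\<lambda>t. (+) (conjg f t) ` C) T) ` F \<subseteq> PiE T (\<lambda>_. (\<lambda>b. (+) b ` C) ` B)"
      using T(2) B'(4) by auto
    then show "finite ((\<lambda>f. restrict (\<lambda>t. (+) (conjg f t) ` C) T) ` F)"
      using finite_PiE[of T "\<lambda>_. (\<lambda>b. (+) b ` C) ` B"] quo T(1) finite_subset by blast
  next
    fix f g assume fg: "f \<in> F" "g \<in> F"
      "restrict (\<lambda>t. (+) (conjg f t) ` C) T = restrict (\<lambda>t. (+) (conjg g t) ` C) T"
    define h where "h = - f + g"
    have hF: "h \<in> F" using fg sub_grp_add[OF sF] sub_grp_minus[OF sF] h_def by auto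
    have "comm b h \<in> C" if b: "b \<in> B" for b
    proof -
      obtain t where t: "t \<in> T" "- t + b \<in> C" using T(3) set_sumE b by (metis subsetD)
      have "(+) (conjg f t) ` C = (+) (conjg g t) ` C" using fun_cong[OF fg(3), of t] t(1) by simp
      then have "- conjg f t + conjg g t \<in> C" using coset_eq[OF C'(2)] by auto
      then have "conjg (- f) (- conjg f t + conjg g t) \<in> C"
        using C'(4) sub_grp_minus[OF sF fg(1)] by blast
      moreover have "conjg (- f) (- conjg f t + conjg g t) = - t + conjg h t"
        unfolding h_def by (simp only: free_group_simps)
      ultimately have c1: "- t + conjg h t \<in> C" by simp
      have c2: "conjg h (- t + b) \<in> C" by (rule C'(4)[OF hF t(2)])
      \<comment> \<open>[b, h] splits into the effect of h on the representative t and on the error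
        - t + b, which lies in the normal subgroup \<open>C\<close>.\<close>
      have "- (- t + b) + (- t + conjg h t) + conjg h (- t + b) \<in> C"
        using c1 c2 t(2) sub_grp_add[OF C'(2)] sub_grp_minus[OF C'(2)] by blast
      then have "conjg b (- (- (- t + b) + (- t + conjg h t) + conjg h (- t + b))) \<in> C"
        using C'(4) b B'(3) sub_grp_minus[OF C'(2)] by blast
      moreover have "conjg b (- (- (- t + b) + (- t + conjg h t) + conjg h (- t + b))) = comm b h"
        by (simp only: free_group_simps)
      ultimately show ?thesis by simp
    qed
    then show "- f + g \<in> F1" unfolding F1_def using hF h_def by auto
  qed
  moreover have "B \<subseteq> cent_mod F F1 C" unfolding cent_mod_def F1_def using B'(3) by auto
  ultimately show ?thesis using nil_over_fin_index[OF F nF1 _ C] by blast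
qed


subsection \<open>Trees of values\<close>

text \<open>\<open>X\<close> contains a tree of depth \<open>length ys\<close> in which every node has \<open>k\<close> children; the children at
  level \<open>i\<close> are distinguished by the value of \<open>f\<close> at \<open>ys ! i\<close>, and each branch is realised in \<open>X\<close>.\<close>

fun tree :: "('x \<Rightarrow> 'y \<Rightarrow> 'v) \<Rightarrow> nat \<Rightarrow> 'y list \<Rightarrow> 'x set \<Rightarrow> bool" where
  "tree f k [] X \<longleftrightarrow> X \<noteq> {}"
| "tree f k (y # ys) X \<longleftrightarrow>
     (\<exists>C. finite C \<and> card C = k \<and> (\<forall>c\<in>C. tree f k ys {x \<in> X. f x y = c}))"

lemma tree_mono: "tree f k ys X \<Longrightarrow> X \<subseteq> X' \<Longrightarrow> k' \<le> k \<Longrightarrow> tree f k' ys X'"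
proof (induction ys arbitrary: X X')
  case (Cons y ys)
  then obtain C where C: "finite C" "card C = k" "\<forall>c\<in>C. tree f k ys {x \<in> X. f x y = c}" by auto
  obtain C' where C': "C' \<subseteq> C" "card C' = k'" using C(2) Cons.prems(3) obtain_subset_with_card_n by metis
  have "tree f k' ys {x \<in> X'. f x y = c}" if "c \<in> C'" for c
    by (rule Cons.IH[of "{x \<in> X. f x y = c}"]) (use C C' that Cons.prems in auto)
  moreover have "finite C'" using C(1) C'(1) finite_subset by blast
  ultimately show ?case using C'(2) by auto
qed auto

lemma tree_nonempty: "tree f k ys X \<Longrightarrow> k > 0 \<Longrightarrow> X \<noteq> {}"
proof (induction ys arbitrary: X)
  case (Cons y ys)
  then obtain C where C: "card C = k" "\<forall>c\<in>C. tree f k ys {x \<in> X. f x y = c}" by auto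
  then obtain c where "c \<in> C" using Cons.prems(2) by fastforce
  then show ?case using C Cons.IH Cons.prems(2) by fastforce
qed auto

lemma tree_cong: "(\<And>x y. x \<in> X \<Longrightarrow> y \<in> set ys \<Longrightarrow> f x y = g x y) \<Longrightarrow> tree f k ys X \<longleftrightarrow> tree g k ys X"
proof (induction ys arbitrary: X)
  case (Cons y ys)
  have "{x \<in> X. f x y = c} = {x \<in> X. g x y = c}" for c using Cons.prems by auto
  moreover have "tree f k ys {x \<in> X. g x y = c} = tree g k ys {x \<in> X. g x y = c}" for c
    by (rule Cons.IH) (use Cons.prems in auto)
  ultimately show ?case by simp
qed auto

lemma tree_map: "tree f k (map h ys) X \<longleftrightarrow> tree (\<lambda>x y. f x (h y)) k ys X"
  by (induction ys arbitrary: X) auto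

text \<open>Only the partition of \<open>X\<close> by the values matters, not the values themselves.
  The new label of a child is the \<open>g\<close>-value of some point in it, and k > 0 guarantees
  that there is one.\<close>

lemma tree_same_fibres:
  assumes "\<And>x x' y. x \<in> X \<Longrightarrow> x' \<in> X \<Longrightarrow> y \<in> set ys \<Longrightarrow> f x y = f x' y \<longleftrightarrow> g x y = g x' y"
    and "tree f k ys X" "k > 0"
  shows "tree g k ys X"
  using assms(1,2)
proof (induction ys arbitrary: X)
  case (Cons y ys)
  then obtain C where C: "finite C" "card C = k" "\<forall>c\<in>C. tree f k ys {x \<in> X. f x y = c}" by auto
  have "\<exists>x. x \<in> X \<and> f x y = c" if "c \<in> C" for c
    using tree_nonempty[OF C(3)[rule_format, OF that] assms(3)] by blast
  then obtain x where x: "\<And>c. c \<in> C \<Longrightarrow> x c \<in> X \<and> f (x c) y = c" by metis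
  have eq: "f u y = f v y \<longleftrightarrow> g u y = g v y" if "u \<in> X" "v \<in> X" for u v
    using Cons.prems(1)[OF that, of y] by simp
  have "inj_on (\<lambda>c. g (x c) y) C"
  proof (rule inj_onI)
    fix c d assume cd: "c \<in> C" "d \<in> C" "g (x c) y = g (x d) y"
    then have "f (x c) y = f (x d) y" using eq x by blast
    then show "c = d" using x cd by metis
  qed
  then have "card ((\<lambda>c. g (x c) y) ` C) = k" using C(2) card_image by blast
  moreover have "tree g k ys {v \<in> X. g v y = d}" if d: "d \<in> (\<lambda>c. g (x c) y) ` C" for d
  proof -
    obtain c where c: "c \<in> C" "d = g (x c) y" using d by blast
    have "g v y = d \<longleftrightarrow> f v y = c" if "v \<in> X" for v
      using eq[OF that, of "x c"] x[OF c(1)] unfolding c(2) by simp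
    then have "{v \<in> X. g v y = d} = {v \<in> X. f v y = c}" by blast
    moreover have "tree g k ys {v \<in> X. f v y = c}"
      by (rule Cons.IH[OF _ C(3)[rule_format, OF c(1)]]) (use Cons.prems(1) in auto)
    ultimately show ?thesis by simp
  qed
  moreover have "finite ((\<lambda>c. g (x c) y) ` C)" using C(1) by simp
  ultimately show ?case by (simp only: tree.simps) blast
qed auto

lemma tree_image:
  "tree f k ys (p ` X) \<longleftrightarrow> tree (\<lambda>x y. f (p x) y) k ys X"
proof (induction ys arbitrary: X)
  case (Cons y ys)
  have "{x \<in> p ` X. f x y = c} = p ` {x \<in> X. f (p x) y = c}" for c by auto
  then show ?case using Cons.IH by simp
qed auto

text \<open>Pigeonhole: by induction each of the k * q children has a subtree within one piece, and
  some piece is chosen for at least k of them. The factor q suffices for all levels because every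
  node starts with k * q children.\<close>

lemma tree_partition:
  assumes "tree f (k * q) ys (\<Union>i\<in>I. X i)" "finite I" "card I \<le> q" "k > 0" "q > 0"
  shows "\<exists>i\<in>I. tree f k ys (X i)"
  using assms(1)
proof (induction ys arbitrary: X)
  case (Cons y ys)
  then obtain C where C: "finite C" "card C = k * q"
    "\<forall>c\<in>C. tree f (k * q) ys {x \<in> (\<Union>i\<in>I. X i). f x y = c}" by auto
  have "\<exists>i\<in>I. tree f k ys {x \<in> X i. f x y = c}" if "c \<in> C" for c
  proof -
    have "{x \<in> (\<Union>i\<in>I. X i). f x y = c} = (\<Union>i\<in>I. {x \<in> X i. f x y = c})" by auto
    moreover have "tree f (k * q) ys {x \<in> (\<Union>i\<in>I. X i). f x y = c}" using C(3) that by blast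
    ultimately show ?thesis using Cons.IH[of "\<lambda>i. {x \<in> X i. f x y = c}"] by simp
  qed
  then obtain p where p: "\<And>c. c \<in> C \<Longrightarrow> p c \<in> I \<and> tree f k ys {x \<in> X (p c). f x y = c}" by metis
  have "\<exists>i\<in>I. k \<le> card {c \<in> C. p c = i}"
  proof (rule ccontr)
    assume neg: "\<not> ?thesis"
    have "C = (\<Union>i\<in>I. {c \<in> C. p c = i})" using p by auto
    then have "card C \<le> (\<Sum>i\<in>I. card {c \<in> C. p c = i})" using card_UN_le[OF assms(2), of "\<lambda>i. {c \<in> C. p c = i}"] by simp
    also have "\<dots> \<le> (\<Sum>i\<in>I. k - 1)" by (rule sum_mono) (use neg in auto)
    also have "\<dots> \<le> q * (k - 1)" using assms(3) by simp
    also have "\<dots> < k * q" using assms(4,5) by (simp add: mult.commute)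
    finally show False using C(2) by simp
  qed
  then obtain i where i: "i \<in> I" "k \<le> card {c \<in> C. p c = i}" by auto
  then obtain C' where C': "C' \<subseteq> {c \<in> C. p c = i}" "card C' = k" using obtain_subset_with_card_n by metis
  have "C' \<subseteq> C" using C'(1) by blast
  then have "finite C'" using C(1) by (rule finite_subset)
  moreover have "tree f k ys {x \<in> X i. f x y = c}" if "c \<in> C'" for c using C'(1) p[of c] that by auto
  ultimately have "tree f k (y # ys) (X i)" using C'(2) by auto
  then show ?case using i(1) by blast
qed auto

text \<open>The fibres of \<open>f\<close> and \<open>g\<close> need not agree; each only meets
  boundedly many of the other. Every level costs a factor q, for cutting an \<open>f\<close>-fibre
  down to a single \<open>g\<close>-value. The one factor q' makes up for as many as q' children
  falling into the same \<open>g\<close>-value.\<close>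

lemma tree_compare:
  assumes f: "\<And>y c. y \<in> Y \<Longrightarrow> finite {g x y | x. x \<in> X0 \<and> f x y = c} \<and> card {g x y | x. x \<in> X0 \<and> f x y = c} \<le> q"
    and g: "\<And>y c. y \<in> Y \<Longrightarrow> finite {f x y | x. x \<in> X0 \<and> g x y = c} \<and> card {f x y | x. x \<in> X0 \<and> g x y = c} \<le> q'"
    and k: "k > 0" "q > 0" "q' > 0"
  shows "X \<subseteq> X0 \<Longrightarrow> set ys \<subseteq> Y \<Longrightarrow> tree f (k * q' * q ^ length ys) ys X \<Longrightarrow> tree g k ys X"
proof (induction ys arbitrary: X)
  case (Cons y ys)
  define k1 where "k1 = k * q' * q ^ length ys"
  have k1: "k * q' * q ^ length (y # ys) = k1 * q" "k1 > 0" "k * q' \<le> k1" using k unfolding k1_def by auto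
  have k1q: "k1 \<le> k1 * q" using k by auto
  have yY: "y \<in> Y" using Cons.prems(2) by simp
  obtain C where C: "finite C" "card C = k1 * q" "\<forall>c\<in>C. tree f (k1 * q) ys {x \<in> X. f x y = c}"
    using Cons.prems(3) unfolding k1(1) by auto
  have "\<exists>e. tree f k1 ys {x \<in> X. f x y = c \<and> g x y = e}" if "c \<in> C" for c
  proof -
    define I where "I = {g x y | x. x \<in> X0 \<and> f x y = c}"
    have "{x \<in> X. f x y = c} = (\<Union>e\<in>I. {x \<in> X. f x y = c \<and> g x y = e})"
      unfolding I_def using Cons.prems(1) by auto
    moreover have "tree f (k1 * q) ys {x \<in> X. f x y = c}" using C(3) that by blast
    ultimately have "tree f (k1 * q) ys (\<Union>e\<in>I. {x \<in> X. f x y = c \<and> g x y = e})" by (simp only:)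
    moreover have "finite I" "card I \<le> q" using f[OF yY, of c] unfolding I_def by blast+
    ultimately show ?thesis
      using tree_partition[of f k1 q ys "\<lambda>e. {x \<in> X. f x y = c \<and> g x y = e}" I] k1(2) k(2) by blast
  qed
  then obtain e where e: "\<And>c. c \<in> C \<Longrightarrow> tree f k1 ys {x \<in> X. f x y = c \<and> g x y = e c}" by metis
  have tg: "tree g k ys {x \<in> X. g x y = e c}" if "c \<in> C" for c
    by (rule tree_mono[OF Cons.IH[OF _ _ e[OF that, unfolded k1_def]]]) (use Cons.prems in auto)
  have fib: "card {c \<in> C. e c = d} \<le> q'" for d
  proof -
    have "{c \<in> C. e c = d} \<subseteq> {f x y | x. x \<in> X0 \<and> g x y = d}"
    proof
      fix c assume c: "c \<in> {c \<in> C. e c = d}"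
      then have "c \<in> C" "e c = d" by auto
      then obtain x where "x \<in> X" "f x y = c" "g x y = d" using tree_nonempty[OF e k1(2)] by blast
      then show "c \<in> {f x y | x. x \<in> X0 \<and> g x y = d}" using Cons.prems(1) by blast
    qed
    then have "card {c \<in> C. e c = d} \<le> card {f x y | x. x \<in> X0 \<and> g x y = d}"
      using card_mono g[OF yY] by blast
    then show ?thesis using g[OF yY, of d] by linarith
  qed
  have C_eq: "C = (\<Union>d\<in>e ` C. {c \<in> C. e c = d})" by auto
  have "k * q' \<le> card C" using C(2) k1(3) k1q by linarith
  also have "card C \<le> (\<Sum>d\<in>e ` C. card {c \<in> C. e c = d})"
    by (subst C_eq) (rule card_UN_le[OF finite_imageI[OF C(1)]])
  also have "\<dots> \<le> (\<Sum>d\<in>e ` C. q')" by (rule sum_mono) (use fib in auto)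
  finally have "k * q' \<le> card (e ` C) * q'" by simp
  then have "k \<le> card (e ` C)" using k by simp
  then obtain D where D: "D \<subseteq> e ` C" "card D = k" using obtain_subset_with_card_n by metis
  have "finite D" using D(1) C(1) finite_subset by blast
  moreover have "\<forall>d\<in>D. tree g k ys {x \<in> X. g x y = d}" using D(1) tg by auto
  ultimately show ?case using D(2) by auto
qed auto

subsection \<open>Group words\<close>

datatype word = WX | WVar nat | WAdd word word | WNeg word

fun ev :: "word \<Rightarrow> 'g::group_add \<Rightarrow> 'g list \<Rightarrow> 'g" where
  "ev WX x ys = x"
| "ev (WVar i) x ys = (if i < length ys then ys ! i else 0)"
| "ev (WAdd v w) x ys = ev v x ys + ev w x ys"
| "ev (WNeg w) x ys = - ev w x ys"

definition evs :: "word list \<Rightarrow> 'g::group_add \<Rightarrow> 'g list \<Rightarrow> 'g list" where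
  "evs ws x ys = map (\<lambda>w. ev w x ys) ws"

definition tuples_in :: "'g set \<Rightarrow> nat \<Rightarrow> 'g list set" where
  "tuples_in F p = {ys. length ys = p \<and> set ys \<subseteq> F}"

definition word_bounded :: "'g::group_add set \<Rightarrow> bool" where
  "word_bounded F \<longleftrightarrow> (\<forall>ws p. \<exists>k d. k > 0 \<and>
     (\<forall>yss. length yss = d \<and> set yss \<subseteq> tuples_in F p \<longrightarrow> \<not> tree (evs ws) k yss F))"

lemma ev_in:
  assumes "sub_grp F" "x \<in> F" "set ys \<subseteq> F"
  shows "ev w x ys \<in> F"
  by (induction w) (use assms sub_grp_0 in \<open>auto intro: sub_grp_add sub_grp_minus\<close>)

definition conj_bounded :: "'g::group_add set \<Rightarrow> nat \<Rightarrow> nat \<Rightarrow> bool" where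
  "conj_bounded F k d \<longleftrightarrow> k > 0 \<and> (\<forall>ys. length ys = d \<and> set ys \<subseteq> F \<longrightarrow> \<not> tree conjg k ys F)"

lemma word_bounded_conj:
  assumes "word_bounded F"
  obtains k d where "conj_bounded F k d"
proof -
  let ?w = "[WAdd (WAdd WX (WVar 0)) (WNeg WX)]"
  obtain k d where kd: "k > 0"
    "\<And>yss. length yss = d \<Longrightarrow> set yss \<subseteq> tuples_in F 1 \<Longrightarrow> \<not> tree (evs ?w) k yss F"
    using assms unfolding word_bounded_def by metis
  have "\<not> tree conjg k ys F" if "length ys = d" "set ys \<subseteq> F" for ys
  proof
    assume "tree conjg k ys F"
    then have 1: "tree (\<lambda>x y. [conjg x y]) k ys F" 
      using tree_same_fibres[of F ys conjg "\<lambda>x y. [conjg x y]"] kd(1) by simp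
    have "tree (\<lambda>x y. evs ?w x [y]) k ys F"
      by (rule iffD1[OF tree_cong 1]) (simp add: evs_def conjg_def)
    then have "tree (evs ?w) k (map (\<lambda>y. [y]) ys) F" by (simp only: tree_map)
    moreover have "set (map (\<lambda>y. [y]) ys) \<subseteq> tuples_in F 1" using that unfolding tuples_in_def by auto
    ultimately show False using kd(2) that by simp
  qed
  then have "conj_bounded F k d" unfolding conj_bounded_def using kd(1) by blast
  then show thesis using that by blast
qed


subsection \<open>Chains of centralisers\<close>

text \<open>The predicate is left open because two kinds of chains occur: with steps of index at
  least k, which \<open>conj_bounded\<close> limits, and with steps of infinite index, on whose
  length the induction in \<open>abelian_normal_nil\<close> runs.\<close>

fun cent_chain :: "('g set \<Rightarrow> 'g \<Rightarrow> bool) \<Rightarrow> 'g::group_add set \<Rightarrow> 'g list \<Rightarrow> bool" where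
  "cent_chain P H [] \<longleftrightarrow> True"
| "cent_chain P H (y # ys) \<longleftrightarrow> P H y \<and> cent_chain P (centr H {y}) ys"

lemma centr_centr: "centr (centr H A) B = centr H (A \<union> B)"
  unfolding centr_def by auto

lemma centr_empty: "centr H {} = H"
  unfolding centr_def by auto

lemma cent_chain_snoc:
  "cent_chain P H (ys @ [y]) \<longleftrightarrow> cent_chain P H ys \<and> P (centr H (set ys)) y"
  by (induction ys arbitrary: H) (auto simp: centr_centr centr_empty)

text \<open>The size of the orbit is the index of \<open>centr H {y}\<close> in \<open>H\<close>.
  Since \<open>card\<close> is 0 on infinite sets, infinite orbits need their own disjunct.\<close>

definition big_orbit :: "nat \<Rightarrow> 'g::group_add set \<Rightarrow> 'g \<Rightarrow> bool" where
  "big_orbit k H y \<longleftrightarrow> infinite (orbit H y) \<or> k \<le> card (orbit H y)"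

lemma tree_translate:
  assumes "tree conjg k ys X"
  shows "tree conjg k ys ((+) h ` X)"
  using assms
proof (induction ys arbitrary: X)
  case (Cons y ys)
  then obtain C where C: "finite C" "card C = k" "\<forall>c\<in>C. tree conjg k ys {x \<in> X. conjg x y = c}" by auto
  have add: "conjg (h + x) y = conjg h (conjg x y)" for x by (simp only: free_group_simps)
  have inj: "inj (conjg h)"
  proof (rule injI)
    fix a b assume "conjg h a = conjg h b"
    then have "conjg (- h) (conjg h a) = conjg (- h) (conjg h b)" by simp
    then show "a = b" by (simp only: free_group_simps)
  qed
  have "tree conjg k ys {x \<in> (+) h ` X. conjg x y = conjg h c}" if "c \<in> C" for c
  proof -
    have "conjg (h + x) y = conjg h c \<longleftrightarrow> conjg x y = c" for x
      unfolding add using inj by (rule inj_eq)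
    then have "(+) h ` {x \<in> X. conjg x y = c} \<subseteq> {x \<in> (+) h ` X. conjg x y = conjg h c}"
      by blast
    moreover have "tree conjg k ys ((+) h ` {x \<in> X. conjg x y = c})"
      using Cons.IH C(3) that by blast
    ultimately show ?thesis by (meson tree_mono order_refl)
  qed
  moreover have "card (conjg h ` C) = k" using C inj card_image inj_on_subset by blast
  moreover have "finite (conjg h ` C)" using C(1) by simp
  ultimately show ?case by (simp only: tree.simps) blast
qed auto

text \<open>The elements of \<open>H\<close> that conjugate y to a given c form a coset of
  \<open>centr H {y}\<close>. The tree inside the centraliser is carried by translation to k such
  cosets, with the same parameters on the lower levels.\<close>

lemma chain_tree:
  assumes "sub_grp H" "cent_chain (big_orbit k) H ys"
  shows "tree conjg k ys H"
  using assms
proof (induction ys arbitrary: H)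
  case Nil
  then show ?case using sub_grp_0 by auto
next
  case (Cons y ys)
  have "\<exists>C. C \<subseteq> orbit H y \<and> finite C \<and> card C = k"
  proof (cases "finite (orbit H y)")
    case True
    then have "k \<le> card (orbit H y)" using Cons.prems(2) by (simp add: big_orbit_def)
    then show ?thesis using obtain_subset_with_card_n True finite_subset by metis
  next
    case False
    then show ?thesis using infinite_arbitrarily_large by blast
  qed
  then obtain C where C: "C \<subseteq> orbit H y" "finite C" "card C = k" by auto
  have "tree conjg k ys {x \<in> H. conjg x y = c}" if c: "c \<in> C" for c
  proof -
    obtain h where h: "h \<in> H" "c = conjg h y" using C(1) c unfolding orbit_def by auto
    have "tree conjg k ys (centr H {y})" using Cons by (simp add: sub_grp_centr)
    then have "tree conjg k ys ((+) h ` centr H {y})" by (rule tree_translate)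
    moreover have "(+) h ` centr H {y} \<subseteq> {x \<in> H. conjg x y = c}"
    proof -
      have "conjg (h + x) y = conjg h (conjg x y)" for x by (simp only: free_group_simps)
      then show ?thesis unfolding centr_def using h sub_grp_add[OF Cons.prems(1)] by auto
    qed
    ultimately show ?thesis by (meson tree_mono order_refl)
  qed
  then show ?case using C(2,3) by (simp only: tree.simps) blast
qed

lemma conj_bounded_mono:
  assumes "conj_bounded F k d" "sub_grp H" "H \<subseteq> F" "set ys \<subseteq> F" "length ys = d"
  shows "\<not> cent_chain (big_orbit k) H ys"
  using chain_tree[OF assms(2)] tree_mono[of conjg k ys H F k] assms unfolding conj_bounded_def by blast

text \<open>Otherwise chains could be extended forever, each time by a step of large index, against
  the bound on trees of conjugates.\<close>

lemma max_centr:
  assumes "conj_bounded F k d" "sub_grp H" "H \<subseteq> F" "Y \<subseteq> F"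
  obtains ys where "finite ys" "ys \<subseteq> Y" "\<And>y. y \<in> Y \<Longrightarrow> \<not> big_orbit k (centr H ys) y"
proof (rule ccontr)
  assume neg: "\<not> thesis"
  note max = that
  have "\<exists>ys. length ys = n \<and> set ys \<subseteq> Y \<and> cent_chain (big_orbit k) H ys" for n
  proof (induction n)
    case (Suc n)
    then obtain ys where ys: "length ys = n" "set ys \<subseteq> Y" "cent_chain (big_orbit k) H ys" by auto
    obtain y where "y \<in> Y" "big_orbit k (centr H (set ys)) y" using neg max[of "set ys"] ys by auto
    then show ?case using ys by (intro exI[of _ "ys @ [y]"]) (auto simp: cent_chain_snoc)
  qed auto
  then obtain ys where "length ys = d" "set ys \<subseteq> Y" "cent_chain (big_orbit k) H ys" by metis
  then show False using conj_bounded_mono assms by blast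
qed

lemma orbit_fin_index:
  assumes "T \<subseteq> H" "H \<subseteq> set_sum T K"
  shows "orbit H y \<subseteq> (\<Union>t\<in>T. conjg t ` orbit K y)"
proof
  fix z assume "z \<in> orbit H y"
  then obtain h where h: "h \<in> H" "z = conjg h y" unfolding orbit_def by auto
  then obtain t k where "t \<in> T" "k \<in> K" "h = t + k" using assms(2) unfolding set_sum_def by blast
  moreover have "conjg (t + k) y = conjg t (conjg k y)" by (simp only: free_group_simps)
  ultimately show "z \<in> (\<Union>t\<in>T. conjg t ` orbit K y)" using h(2) unfolding orbit_def by auto
qed

lemma orbit_mono: "K \<subseteq> H \<Longrightarrow> orbit K y \<subseteq> orbit H y"
  unfolding orbit_def by auto

lemma finite_orbit_fin_index:
  assumes "fin_index H K" "finite (orbit K y)"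
  shows "finite (orbit H y)"
proof -
  obtain T where T: "finite T" "T \<subseteq> H" "H \<subseteq> set_sum T K" using assms(1) unfolding fin_index_def by auto
  show ?thesis by (rule finite_subset[OF orbit_fin_index[OF T(2,3)]]) (use T assms(2) in auto)
qed

text \<open>Some finite \<open>ys\<close> in \<open>Y\<close> has a centraliser whose orbits on
  \<open>Y\<close> have size at most k. This centraliser has finite index because the orbits of
  \<open>ys\<close> are finite, and the number of representatives times k bounds all orbits.\<close>

lemma orbits_bounded:
  assumes "conj_bounded F k d" "sub_grp H" "H \<subseteq> F" "Y \<subseteq> F" "\<And>y. y \<in> Y \<Longrightarrow> finite (orbit H y)"
  obtains m where "\<And>y. y \<in> Y \<Longrightarrow> card (orbit H y) \<le> m"
proof -
  obtain ys where ys: "finite ys" "ys \<subseteq> Y" "\<And>y. y \<in> Y \<Longrightarrow> \<not> big_orbit k (centr H ys) y"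
    using max_centr[OF assms(1-4)] by metis
  have "fin_index H (centr H ys)" using fin_index_centr[OF assms(2) ys(1)] ys(2) assms(5) by blast
  then obtain T where T: "finite T" "T \<subseteq> H" "H \<subseteq> set_sum T (centr H ys)" unfolding fin_index_def by auto
  have "card (orbit H y) \<le> card T * k" if y: "y \<in> Y" for y
  proof -
    have fin: "finite (orbit (centr H ys) y)" "card (orbit (centr H ys) y) \<le> k"
      using ys(3)[OF y] unfolding big_orbit_def by auto
    have "card (orbit H y) \<le> card (\<Union>t\<in>T. conjg t ` orbit (centr H ys) y)"
      by (rule card_mono[OF _ orbit_fin_index[OF T(2,3)]]) (use T fin in auto)
    also have "\<dots> \<le> (\<Sum>t\<in>T. card (conjg t ` orbit (centr H ys) y))" by (rule card_UN_le[OF T(1)])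
    also have "\<dots> \<le> (\<Sum>t\<in>T. k)" 
      by (rule sum_mono) (use card_image_le[OF fin(1)] fin(2) le_trans in blast)
    finally show ?thesis by simp
  qed
  then show thesis using that by blast
qed

section \<open>Elements with finite orbits and almost commuting normal subgroups\<close>

definition fin_orbits :: "'g::group_add set \<Rightarrow> 'g set \<Rightarrow> 'g set" where
  "fin_orbits H B = {h \<in> H. finite (orbit B h)}"

lemma sub_grp_fin_orbits:
  assumes "sub_grp H"
  shows "sub_grp (fin_orbits H B)"
proof -
  have "finite (orbit B (x + y))" if "finite (orbit B x)" "finite (orbit B y)" for x y
  proof (rule finite_subset)
    have "conjg b (x + y) = conjg b x + conjg b y" for b by (simp only: free_group_simps)
    then show "orbit B (x + y) \<subseteq> (\<lambda>(u, v). u + v) ` (orbit B x \<times> orbit B y)"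
      unfolding orbit_def by auto
  qed (use that in auto)
  moreover have "finite (orbit B (- x))" if "finite (orbit B x)" for x
  proof (rule finite_subset)
    have "conjg b (- x) = - conjg b x" for b by (simp only: free_group_simps)
    then show "orbit B (- x) \<subseteq> uminus ` orbit B x" unfolding orbit_def by auto
  qed (use that in auto)
  moreover have "finite (orbit B 0)"
  proof (rule finite_subset)
    have "conjg b 0 = 0" for b :: 'a by (simp only: free_group_simps)
    then show "orbit B 0 \<subseteq> {0}" unfolding orbit_def by auto
  qed auto
  ultimately show ?thesis
    using assms unfolding sub_grp_def fin_orbits_def by auto
qed

lemma normal_in_fin_orbits:
  assumes "normal_in F H" "normal_in F B"
  shows "normal_in F (fin_orbits H B)"
proof -
  note H = normal_inD[OF assms(1)] and B = normal_inD[OF assms(2)]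
  have "finite (orbit B (conjg f x))" if "f \<in> F" "finite (orbit B x)" for f x
  proof (rule finite_subset)
    have "conjg b (conjg f x) = conjg f (conjg (conjg (- f) b) x)" for b by (simp only: free_group_simps)
    moreover have "conjg (- f) b \<in> B" if "b \<in> B" for b
      using B(4) sub_grp_minus[OF H(1)] \<open>f \<in> F\<close> that by blast
    ultimately show "orbit B (conjg f x) \<subseteq> conjg f ` orbit B x" unfolding orbit_def by auto
  qed (use that in auto)
  then show ?thesis
    using sub_grp_fin_orbits[OF H(2), of B] H(1,3,4) unfolding normal_in_def fin_orbits_def by auto
qed

lemma separated_of_infinite_index:
  assumes "\<not> fin_index H K" "sub_grp K"
  shows "\<exists>T. finite T \<and> T \<subseteq> H \<and> card T = m \<and> (\<forall>s\<in>T. \<forall>t\<in>T. s \<noteq> t \<longrightarrow> - s + t \<notin> K)"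
proof (induction m)
  case (Suc m)
  then obtain T where T: "finite T" "T \<subseteq> H" "card T = m" "\<forall>s\<in>T. \<forall>t\<in>T. s \<noteq> t \<longrightarrow> - s + t \<notin> K" by auto
  then obtain h where h: "h \<in> H" "h \<notin> set_sum T K" using assms(1) unfolding fin_index_def by blast
  have 1: "- t + h \<notin> K" if "t \<in> T" for t
  proof
    assume "- t + h \<in> K"
    then have "t + (- t + h) \<in> set_sum T K" using that set_sumI by blast
    moreover have "t + (- t + h) = h" by (simp only: free_group_simps)
    ultimately show False using h(2) by simp
  qed
  have 2: "- h + t \<notin> K" if "t \<in> T" for t
  proof
    assume "- h + t \<in> K"
    then have "- (- h + t) \<in> K" using sub_grp_minus[OF assms(2)] by blast
    moreover have "- (- h + t) = - t + h" by (simp only: free_group_simps)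
    ultimately show False using 1 that by simp
  qed
  have "h \<notin> T" using h(2) set_sumI[of h T 0 K] sub_grp_0[OF assms(2)] by auto
  then show ?case using T h(1) 1 2 by (intro exI[of _ "insert h T"]) auto
qed (auto intro: exI[of _ "{}"])

text \<open>Suppose m + 1 elements of \<open>H\<close> are pairwise inequivalent modulo
  \<open>fin_orbits H B\<close>. Their differences have centralisers of infinite index in
  \<open>B\<close>, so by \<open>neumann_cover\<close> some b in \<open>B\<close> commutes with none
  of them. Then the m + 1 elements send b to different conjugates, too many for its orbit.\<close>

lemma fin_index_fin_orbits:
  assumes B: "sub_grp B" and H: "sub_grp H"
    and bound: "\<And>b. b \<in> B \<Longrightarrow> finite (orbit H b) \<and> card (orbit H b) \<le> m"
  shows "fin_index H (fin_orbits H B)"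
proof (rule ccontr)
  assume "\<not> ?thesis"
  then obtain T where T: "finite T" "T \<subseteq> H" "card T = Suc m"
    "\<And>s t. s \<in> T \<Longrightarrow> t \<in> T \<Longrightarrow> s \<noteq> t \<Longrightarrow> - s + t \<notin> fin_orbits H B"
    using separated_of_infinite_index[OF _ sub_grp_fin_orbits[OF H], of H B "Suc m"] by blast
  define \<K> where "\<K> = (\<lambda>(s, t). centr B {- s + t}) ` {(s, t) \<in> T \<times> T. s \<noteq> t}"
  have fin: "finite \<K>" unfolding \<K>_def by (rule finite_imageI, rule finite_subset[of _ "T \<times> T"]) (use T(1) in auto)
  have no: "\<not> fin_index B K" if K: "K \<in> \<K>" for K
  proof
    assume fi: "fin_index B K"
    obtain s t where st: "s \<in> T" "t \<in> T" "s \<noteq> t" "K = centr B {- s + t}" using K unfolding \<K>_def by auto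
    have "orbit K (- s + t) \<subseteq> {- s + t}" unfolding st(4) orbit_def centr_def by auto
    then have "finite (orbit B (- s + t))" using finite_orbit_fin_index[OF fi] finite_subset by blast
    moreover have "- s + t \<in> H" using st T(2) sub_grp_add[OF H] sub_grp_minus[OF H] by blast
    ultimately show False using T(4) st unfolding fin_orbits_def by blast
  qed
  have "\<exists>b\<in>B. \<forall>K\<in>\<K>. b \<notin> K"
  proof (rule ccontr)
    assume "\<not> ?thesis"
    then have "B \<subseteq> (\<Union>K\<in>\<K>. set_sum {0} K)" unfolding set_sum_def by auto
    moreover have "centr B Y \<subseteq> B" for Y unfolding centr_def by auto
    then have "sub_grp K \<and> K \<subseteq> B" if "K \<in> \<K>" for K
      using that sub_grp_centr[OF B] unfolding \<K>_def by auto
    ultimately show False using neumann_cover[OF fin _ B, of "{0}"] no by blast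
  qed
  then obtain b where b: "b \<in> B" "\<And>s t. s \<in> T \<Longrightarrow> t \<in> T \<Longrightarrow> s \<noteq> t \<Longrightarrow> b \<notin> centr B {- s + t}"
    unfolding \<K>_def by blast
  have "inj_on (\<lambda>t. conjg t b) T"
  proof (rule inj_onI, rule ccontr)
    fix s t assume st: "s \<in> T" "t \<in> T" "conjg s b = conjg t b" "s \<noteq> t"
    then have "conjg (- s + t) b = b" using conjg_eq_iff[of s b t] by simp
    then have "conjg b (- s + t) = - s + t" using comm_0_sym comm_0_iff by metis
    then show False using b st unfolding centr_def by blast
  qed
  then have "card ((\<lambda>t. conjg t b) ` T) = Suc m" using T(3) card_image by metis
  moreover have "(\<lambda>t. conjg t b) ` T \<subseteq> orbit H b" using T(2) unfolding orbit_def by blast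
  ultimately show False using bound[OF b(1)] card_mono[of "orbit H b" "(\<lambda>t. conjg t b) ` T"] by auto
qed

text \<open>Neumann's argument: if \<open>b\<close> has an \<open>H\<close>-orbit of maximal size and \<open>c\<close> commutes with representatives
  of that orbit, then the orbit of \<open>b + c\<close> is the orbit of \<open>b\<close> translated by \<open>c\<close>.\<close>

lemma finite_commutators:
  assumes B: "sub_grp B" and H: "sub_grp H"
    and bH: "\<And>b. b \<in> B \<Longrightarrow> finite (orbit H b) \<and> card (orbit H b) \<le> m"
    and hB: "\<And>h. h \<in> H \<Longrightarrow> finite (orbit B h)"
  shows "finite {comm b h | b h. b \<in> B \<and> h \<in> H}"
proof -
  define \<mu> where "\<mu> = Max ((\<lambda>b. card (orbit H b)) ` B)"
  have finB: "finite ((\<lambda>b. card (orbit H b)) ` B)"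
    by (rule finite_subset[of _ "{..m}"]) (use bH in auto)
  have "B \<noteq> {}" using sub_grp_0[OF B] by auto
  then have "\<mu> \<in> (\<lambda>b. card (orbit H b)) ` B" unfolding \<mu>_def by (intro Max_in[OF finB]) simp
  then obtain b where b: "b \<in> B" "card (orbit H b) = \<mu>" by blast
  have max: "card (orbit H c) \<le> \<mu>" if "c \<in> B" for c
    unfolding \<mu>_def by (rule Max_ge[OF finB]) (use that in auto)
  define Orb where "Orb = orbit H b"
  have finO: "finite Orb" using bH[OF b(1)] unfolding Orb_def by auto
  obtain T where T: "T \<subseteq> H" "finite T" "Orb = (\<lambda>t. conjg t b) ` T"
    using finite_subset_image[OF finO, of "\<lambda>t. conjg t b" H] unfolding Orb_def orbit_def by auto
  define B0 where "B0 = centr B T"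
  have fi: "fin_index B B0"
    unfolding B0_def by (rule fin_index_centr[OF B T(2)]) (use T(1) hB in auto)
  \<comment> \<open>For c in \<open>B0\<close> the commutator with any h in \<open>H\<close> turns
    out to be determined by two points of the orbit of b.\<close>
  define D where "D = (\<lambda>(u, v). - (- u + v)) ` (Orb \<times> Orb)"
  have D: "comm c h \<in> D" if c: "c \<in> B0" and h: "h \<in> H" for c h
  proof -
    have cT: "conjg t c = c" if "t \<in> T" for t
      using c that unfolding B0_def centr_def by (auto simp: comm_0_iff[symmetric] comm_0_sym)
    have cB: "c \<in> B" using c unfolding B0_def centr_def by auto
    have "(\<lambda>v. v + c) ` Orb \<subseteq> orbit H (b + c)"
    proof
      fix z assume "z \<in> (\<lambda>v. v + c) ` Orb"
      then obtain t where t: "t \<in> T" "z = conjg t b + c" using T(3) by auto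
      have "conjg t (b + c) = conjg t b + conjg t c" by (simp only: free_group_simps)
      then show "z \<in> orbit H (b + c)" using t cT T(1) unfolding orbit_def by force
    qed
    moreover have "card ((\<lambda>v. v + c) ` Orb) = \<mu>"
      unfolding b(2)[symmetric] Orb_def[symmetric] by (rule card_image) (auto simp: inj_on_def)
    moreover have bc: "b + c \<in> B" using sub_grp_add[OF B b(1) cB] .
    ultimately have eq: "(\<lambda>v. v + c) ` Orb = orbit H (b + c)"
      using card_seteq[of "orbit H (b + c)" "(\<lambda>v. v + c) ` Orb"] bH[OF bc] max[OF bc] by auto
    have "conjg h (b + c) \<in> orbit H (b + c)" unfolding orbit_def using h by auto
    then obtain v where v: "v \<in> Orb" "conjg h (b + c) = v + c" using eq by auto
    have u: "conjg h b \<in> Orb" unfolding Orb_def orbit_def using h by auto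
    have "comm c h = - (- conjg h b + (conjg h (b + c) - c))" by (simp only: free_group_simps)
    also have "\<dots> = - (- conjg h b + v)" unfolding v(2) by (simp only: free_group_simps)
    finally show ?thesis unfolding D_def using u v(1) by auto
  qed
  have finD: "finite D" unfolding D_def using finO by auto
  obtain S where S: "finite S" "S \<subseteq> B" "B \<subseteq> set_sum S B0" using fi unfolding fin_index_def by auto
  \<comment> \<open>Passage from \<open>B0\<close> to \<open>B\<close>: s + c contributes the
    conjugate of [c, h] by s, plus s minus a point of its own finite orbit.\<close>
  define E where "E = (\<Union>s\<in>S. (\<lambda>(d, u). conjg s d + (s - u)) ` (D \<times> orbit H s))"
  have "finite E" unfolding E_def using S(1) finD bH S(2) by auto
  moreover have "{comm b h | b h. b \<in> B \<and> h \<in> H} \<subseteq> E"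
  proof
    fix z assume "z \<in> {comm b h | b h. b \<in> B \<and> h \<in> H}"
    then obtain x h where x: "x \<in> B" "h \<in> H" "z = comm x h" by auto
    then obtain s c where s: "s \<in> S" "c \<in> B0" "x = s + c" using S(3) unfolding set_sum_def by blast
    have "comm (s + c) h = conjg s (comm c h) + (s - conjg h s)" by (simp only: free_group_simps)
    moreover have "conjg h s \<in> orbit H s" unfolding orbit_def using x by auto
    ultimately have "z = (\<lambda>(d, u). conjg s d + (s - u)) (comm c h, conjg h s)" "(comm c h, conjg h s) \<in> D \<times> orbit H s"
      using x s D by auto
    then show "z \<in> E" unfolding E_def using s(1) by blast
  qed
  ultimately show ?thesis by (rule finite_subset[rotated])
qed

text \<open>The commutators of \<open>B\<close> with \<open>H1\<close> form a finite set that is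
  invariant under \<open>F\<close>, so a normal subgroup \<open>F1\<close> of finite index
  centralises it. Everything centralised by \<open>F1\<close> is hypercentral of finite level by
  \<open>nil_over_fin_index\<close>, and this is \<open>E\<close>.\<close>

lemma almost_commuting:
  assumes F: "fitting_group F" and kd: "conj_bounded F k d"
    and B: "normal_in F B" and H: "normal_in F H"
    and bH: "\<And>b. b \<in> B \<Longrightarrow> finite (orbit H b)"
  defines "H1 \<equiv> fin_orbits H B"
  obtains E where "normal_in F H1" "fin_index H H1" "normal_in F E" "nil_over F E {0}" "B \<subseteq> cent_mod F H1 E"
proof -
  note B' = normal_inD[OF B] and H' = normal_inD[OF H]
  obtain m where m: "\<And>b. b \<in> B \<Longrightarrow> card (orbit H b) \<le> m"
    using orbits_bounded[OF kd H'(2,3) B'(3) bH] by metis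
  have fi: "fin_index H H1" unfolding H1_def by (rule fin_index_fin_orbits[OF B'(2) H'(2)]) (use m bH in auto)
  have nH1: "normal_in F H1" unfolding H1_def by (rule normal_in_fin_orbits[OF H B])
  note H1' = normal_inD[OF nH1]
  have H1H: "H1 \<subseteq> H" unfolding H1_def fin_orbits_def by auto
  define C where "C = {comm b h | b h. b \<in> B \<and> h \<in> H1}"
  have finC: "finite C" unfolding C_def
  proof (rule finite_commutators[OF B'(2) H1'(2)])
    show "finite (orbit H1 b) \<and> card (orbit H1 b) \<le> m" if "b \<in> B" for b
      using bH[OF that] m[OF that] orbit_mono[OF H1H, of b] by (meson card_mono finite_subset le_trans)
    show "finite (orbit B h)" if "h \<in> H1" for h using that unfolding H1_def fin_orbits_def by auto
  qed
  have CF: "C \<subseteq> F" unfolding C_def using B'(3) H1'(3) sub_grp_comm[OF B'(1)] by blast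
  have Cinv: "orbit F c \<subseteq> C" if cC: "c \<in> C" for c
  proof
    fix z assume "z \<in> orbit F c"
    then obtain f b h where f: "f \<in> F" "b \<in> B" "h \<in> H1" "z = conjg f (comm b h)"
      using cC unfolding orbit_def C_def by blast
    have "conjg f (comm b h) = comm (conjg f b) (conjg f h)" by (simp only: free_group_simps)
    then show "z \<in> C" unfolding C_def using f B'(4) H1'(4) by blast
  qed
  define F1 where "F1 = centr F C"
  have fiF1: "fin_index F F1" unfolding F1_def
    by (rule fin_index_centr[OF B'(1) finC]) (use Cinv finC finite_subset in blast)
  have nF1: "normal_in F F1"
  proof -
    have "conjg (conjg f x) y = y" if "f \<in> F" "\<forall>y\<in>C. conjg x y = y" "y \<in> C" for f x y
    proof -
      have "conjg (conjg f x) y = conjg f (conjg x (conjg (- f) y))" by (simp only: free_group_simps)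
      also have "conjg x (conjg (- f) y) = conjg (- f) y"
        using that Cinv[OF that(3)] sub_grp_minus[OF B'(1)] unfolding orbit_def by blast
      also have "conjg f (conjg (- f) y) = y" by (simp only: free_group_simps)
      finally show ?thesis .
    qed
    then show ?thesis
      using sub_grp_centr[OF B'(1), of C] B'(1) sub_grp_conjg[OF B'(1)]
      unfolding normal_in_def centr_def F1_def by blast
  qed
  have n0: "normal_in F {0}" by (rule normal_in_zero[OF B'(1)])
  define E where "E = cent_mod F F1 {0}"
  have "normal_in F E" unfolding E_def by (rule normal_in_cent_mod[OF n0 nF1])
  moreover have "nil_over F E {0}" using nil_over_fin_index[OF F nF1 fiF1 n0] E_def by auto
  moreover have "comm c f = 0" if "c \<in> C" "f \<in> F1" for c f
    using that comm_0_iff comm_0_sym unfolding F1_def centr_def by blast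
  then have "C \<subseteq> E"
    unfolding E_def cent_mod_def using CF by blast
  then have "B \<subseteq> cent_mod F H1 E" unfolding cent_mod_def C_def using B'(3) by auto
  ultimately show thesis using that nH1 fi by blast
qed

section \<open>The FC-centre and the action on the upper central series\<close>

definition fc_centre :: "'g::group_add set \<Rightarrow> 'g set" where
  "fc_centre F = fin_orbits F F"

lemma normal_in_fc_centre: "sub_grp F \<Longrightarrow> normal_in F (fc_centre F)"
  unfolding fc_centre_def using normal_in_fin_orbits normal_in_self by blast

text \<open>\<open>almost_commuting\<close> is applied to the FC-centre and \<open>F\<close> itself:
  modulo a hypercentral \<open>E\<close>, the FC-centre is centralised by a subgroup of finite
  index, and \<open>nil_over_fin_index\<close> does the rest.\<close>

lemma fc_centre_nil:
  assumes F: "fitting_group F" and kd: "conj_bounded F k d"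
  shows "nil_over F (fc_centre F) {0}"
proof -
  have sF: "sub_grp F" using F unfolding fitting_group_def by auto
  obtain E where E: "normal_in F (fin_orbits F (fc_centre F))" "fin_index F (fin_orbits F (fc_centre F))"
    "normal_in F E" "nil_over F E {0}" "fc_centre F \<subseteq> cent_mod F (fin_orbits F (fc_centre F)) E"
    by (rule almost_commuting[OF F kd normal_in_fc_centre[OF sF] normal_in_self[OF sF]])
       (auto simp: fc_centre_def fin_orbits_def)
  show ?thesis using nil_over_trans[OF nil_over_fin_index[OF F E(1,2,3,5)] E(4)] .
qed

text \<open>The centraliser \<open>K\<close> of a suitable finite \<open>ys\<close> has small orbits
  on \<open>F\<close>, hence meets the FC-centre in a subgroup of finite index. If \<open>S\<close>
  contains x other than 0, let \<open>N\<close> act nilpotently and contain x and \<open>ys\<close>.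
  The first nontrivial \<open>D i\<close> is centralised by \<open>N\<close>, so it lies in
  \<open>K\<close>; it avoids the FC-centre and is therefore finite. But a finite normal subgroup
  lies in the FC-centre.\<close>

lemma normal_meets_fc_centre:
  assumes F: "fitting_group F" and kd: "conj_bounded F k d"
    and S: "normal_in F S" "S \<inter> fc_centre F = {0}"
  shows "S = {0}"
proof (rule ccontr)
  assume "S \<noteq> {0}"
  note S' = normal_inD[OF S(1)]
  note sF = S'(1)
  have "0 \<in> S" using sub_grp_0[OF S'(2)] .
  then obtain x where x: "x \<in> S" "x \<noteq> 0" using \<open>S \<noteq> {0}\<close> by auto
  obtain ys where ys: "finite ys" "ys \<subseteq> F" "\<And>y. y \<in> F \<Longrightarrow> \<not> big_orbit k (centr F ys) y"
    using max_centr[OF kd sF order_refl order_refl] by metis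
  define K where "K = centr F ys"
  have sK: "sub_grp K" unfolding K_def by (rule sub_grp_centr[OF sF])
  have KF: "K \<subseteq> F" unfolding K_def centr_def by auto
  have fiK: "fin_index K (fin_orbits K F)"
    by (rule fin_index_fin_orbits[OF sF sK, of k]) (use ys(3) in \<open>auto simp: big_orbit_def K_def not_le intro: less_imp_le\<close>)
  obtain N where N: "nil_act F N" "insert x ys \<subseteq> N"
    using fitting_group_finite[OF F, of "insert x ys"] ys x S'(3) by auto
  then obtain c where nN: "normal_in F N" "F \<subseteq> ucs F N {0} c" unfolding nil_act_def by auto
  note n0 = normal_in_zero[OF sF]
  define D where "D i = N \<inter> S \<inter> ucs F N {0} i" for i
  have "x \<in> D c" unfolding D_def using N(2) x nN(2) S'(3) by auto
  then have "D c \<noteq> {0}" using x by auto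
  have "D 0 = {0}" unfolding D_def using sub_grp_0[OF normal_inD(2)[OF nN(1)]] \<open>0 \<in> S\<close> by auto
  define i where "i = (LEAST i. D i \<noteq> {0})"
  have i: "D i \<noteq> {0}" "\<And>j. j < i \<Longrightarrow> D j = {0}"
    unfolding i_def using LeastI[of "\<lambda>i. D i \<noteq> {0}", OF \<open>D c \<noteq> {0}\<close>] not_less_Least by blast+
  then obtain j where j: "i = Suc j" using \<open>D 0 = {0}\<close> by (cases i) auto
  have Dj: "D j = {0}" using i(2) j by auto
  have nD: "normal_in F (D i)" unfolding D_def
    by (intro normal_in_Int nN(1) S(1) normal_in_ucs[OF n0 nN(1)])
  note D' = normal_inD[OF nD]
  have cen: "comm z n = 0" if z: "z \<in> D i" and n: "n \<in> N" for z n
  proof -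
    have "comm z n \<in> ucs F N {0} j" using z n unfolding D_def j by (auto simp: ucs_Suc cent_mod_def)
    moreover have "n \<in> F" "z \<in> N" "z \<in> S" using z n normal_inD(3)[OF nN(1)] unfolding D_def by auto
    ultimately have "comm z n \<in> D j"
      unfolding D_def using normal_in_comm(1)[OF nN(1)] normal_in_comm(1)[OF S(1)] by auto
    then show ?thesis using Dj by auto
  qed
  have DK: "D i \<subseteq> K"
    unfolding K_def centr_def using cen N(2) D'(3) by (auto simp: comm_0_iff)
  have "D i \<inter> fin_orbits K F \<subseteq> {0}"
    using S(2) unfolding D_def fc_centre_def fin_orbits_def using KF by auto
  then have triv: "D i \<inter> fin_orbits K F = {0}"
    using sub_grp_0[OF D'(2)] sub_grp_0[OF sub_grp_fin_orbits[OF sK]] by auto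
  have "fin_index (D i) (D i \<inter> fin_orbits K F)"
    by (rule fin_index_Int[OF fiK sub_grp_fin_orbits[OF sK] D'(2) DK])
  then have "fin_index (D i) {0}" unfolding triv .
  then obtain T where "finite T" "D i \<subseteq> set_sum T {0}" unfolding fin_index_def by auto
  then have finD: "finite (D i)" unfolding set_sum_def using finite_subset by auto
  have "D i \<subseteq> fc_centre F"
  proof
    fix z assume z: "z \<in> D i"
    have "orbit F z \<subseteq> D i" unfolding orbit_def using D'(4) z by auto
    then show "z \<in> fc_centre F" unfolding fc_centre_def fin_orbits_def using finD finite_subset z D'(3) by blast
  qed
  then have "D i \<subseteq> {0}" using S(2) unfolding D_def by auto
  then show False using i(1) sub_grp_0[OF D'(2)] by auto
qed

text \<open>The classical argument for stability groups: \<open>F\<close> acts trivially on the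
  factors of the series \<open>Z\<close>. The elements of \<open>C i\<close> lower the series by i
  steps, and [C i, F] lies in \<open>C (Suc i)\<close>, so that m commutators lead from
  \<open>C 0 = F\<close> to \<open>C m\<close>, which centralises \<open>Z m\<close>.\<close>

lemma stability_group:
  assumes sF: "sub_grp F"
  defines "Z \<equiv> ucs F F {0}"
  shows "nil_over F F (centr F (Z m))"
proof -
  note nF = normal_in_self[OF sF] and n0 = normal_in_zero[OF sF]
  have nZ: "normal_in F (Z j)" for j unfolding Z_def by (rule normal_in_ucs[OF n0 nF])
  note Z' = normal_inD[OF nZ]
  have ZS: "comm x f \<in> Z (j - 1)" if "x \<in> Z j" "f \<in> F" for x f j
  proof (cases j)
    case 0
    then have "x = 0" using that unfolding Z_def by simp
    then have "comm x f = 0" by (simp only: free_group_simps)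
    then show ?thesis using sub_grp_0[OF Z'(2)] by simp
  next
    case (Suc i)
    then show ?thesis using that unfolding Z_def by (simp add: ucs_Suc cent_mod_def)
  qed
  \<comment> \<open>Subtraction is truncated: for j at most i the commutators have to
    vanish.\<close>
  define C where "C i = {f \<in> F. \<forall>j. \<forall>x\<in>Z j. comm x f \<in> Z (j - i)}" for i
  have step: "comm f g \<in> C (Suc i)" if f: "f \<in> C i" and g: "g \<in> F" for f g i
  proof -
    have fF: "f \<in> F" and fC: "\<And>j x. x \<in> Z j \<Longrightarrow> comm x f \<in> Z (j - i)" using f unfolding C_def by auto
    have "comm x (comm f g) \<in> Z (j - Suc i)" if x: "x \<in> Z j" for x j
    proof -
      define D where "D = Z (j - Suc i)"
      note D' = normal_inD[OF nZ[of "j - Suc i"], folded D_def]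
      \<comment> \<open>A variant of the Hall-Witt identity. Starting from this conjugate of x, the
        element [x, [f, g]] becomes a sum of three commutators built from u and v, each of which is
        low enough in the series.\<close>
      define x' where "x' = conjg (- (g + f)) x"
      have gf: "- (g + f) \<in> F" using g fF sub_grp_add[OF sF] sub_grp_minus[OF sF] by blast
      have x': "x' \<in> Z j" unfolding x'_def using Z'(4)[OF gf x] .
      define u v where "u = - comm x' f" and "v = - comm x' g"
      have u: "u \<in> Z (j - i)" unfolding u_def using fC[OF x'] sub_grp_minus[OF Z'(2)] by blast
      have v: "v \<in> Z (j - 1)" unfolding v_def using ZS[OF x' g] sub_grp_minus[OF Z'(2)] by blast
      have vF: "v \<in> F" using v Z'(3) by blast
      have "comm v f \<in> D" using fC[OF v] unfolding D_def by simp
      moreover have "comm u g \<in> D" using ZS[OF u g] unfolding D_def by simp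
      moreover have "comm u v \<in> D" using ZS[OF u vF] unfolding D_def by simp
      ultimately have "- comm u g + comm u v + comm v f \<in> D"
        by (intro sub_grp_add[OF D'(2)] sub_grp_minus[OF D'(2)])
      moreover have "comm x (comm f g) = - comm u g + comm u v + comm v f"
        unfolding u_def v_def x'_def by (simp only: free_group_simps)
      ultimately show ?thesis unfolding D_def by simp
    qed
    then show ?thesis unfolding C_def using sub_grp_comm[OF sF fF g] by auto
  qed
  have "C (m - i) \<subseteq> ucs F F (C m) i" if "i \<le> m" for i
    using that
  proof (induction i)
    case (Suc i)
    have "f \<in> ucs F F (C m) (Suc i)" if f: "f \<in> C (m - Suc i)" for f
    proof -
      have "Suc (m - Suc i) = m - i" using Suc.prems by auto
      then have "comm f g \<in> ucs F F (C m) i" if "g \<in> F" for g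
        using step[OF f that] Suc by auto
      then show ?thesis using f unfolding ucs_Suc cent_mod_def C_def by auto
    qed
    then show ?case by blast
  qed auto
  from this[of m] have "F \<subseteq> ucs F F (C m) m"
    using Z'(4) unfolding C_def by (auto intro: normal_in_comm(1)[OF nZ])
  moreover have "C m \<subseteq> centr F (Z m)"
    unfolding C_def centr_def
  proof (intro subsetI CollectI conjI ballI)
    fix f x assume f: "f \<in> {f \<in> F. \<forall>j. \<forall>x\<in>Z j. comm x f \<in> Z (j - m)}" and x: "x \<in> Z m"
    then have "comm x f \<in> Z 0" by force
    then have "comm f x = 0" unfolding Z_def using comm_0_sym by auto
    then show "conjg f x = x" by (simp add: comm_0_iff)
  qed auto
  ultimately show ?thesis unfolding nil_over_def using ucs_mono by blast
qed

subsection \<open>Homomorphisms\<close>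

definition hom_on :: "('g::group_add \<Rightarrow> 'h::group_add) \<Rightarrow> 'g set \<Rightarrow> bool" where
  "hom_on \<pi> F \<longleftrightarrow> sub_grp F \<and> (\<forall>x\<in>F. \<forall>y\<in>F. \<pi> (x + y) = \<pi> x + \<pi> y)"

lemma hom_onD:
  assumes "hom_on \<pi> F"
  shows "sub_grp F" "\<And>x y. x \<in> F \<Longrightarrow> y \<in> F \<Longrightarrow> \<pi> (x + y) = \<pi> x + \<pi> y"
    "\<pi> 0 = 0" "\<And>x. x \<in> F \<Longrightarrow> \<pi> (- x) = - \<pi> x"
    "\<And>x y. x \<in> F \<Longrightarrow> y \<in> F \<Longrightarrow> \<pi> (conjg x y) = conjg (\<pi> x) (\<pi> y)"
    "\<And>x y. x \<in> F \<Longrightarrow> y \<in> F \<Longrightarrow> \<pi> (comm x y) = comm (\<pi> x) (\<pi> y)"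
proof -
  show s: "sub_grp F" and a: "\<And>x y. x \<in> F \<Longrightarrow> y \<in> F \<Longrightarrow> \<pi> (x + y) = \<pi> x + \<pi> y"
    using assms unfolding hom_on_def by auto
  note 0 = sub_grp_0[OF s] and m = sub_grp_minus[OF s] and p = sub_grp_add[OF s]
  show z: "\<pi> 0 = 0" using a[OF 0 0] by (metis add.right_neutral add_left_imp_eq)
  show n: "\<And>x. x \<in> F \<Longrightarrow> \<pi> (- x) = - \<pi> x"
    using a m z by (metis add.right_inverse minus_unique)
  show c: "\<And>x y. x \<in> F \<Longrightarrow> y \<in> F \<Longrightarrow> \<pi> (conjg x y) = conjg (\<pi> x) (\<pi> y)"
    by (simp only: conjg_def diff_conv_add_uminus a n p m)
  show "\<And>x y. x \<in> F \<Longrightarrow> y \<in> F \<Longrightarrow> \<pi> (comm x y) = comm (\<pi> x) (\<pi> y)"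
    by (simp only: comm_def diff_conv_add_uminus a n p m)
qed

lemma sub_grp_image: "hom_on \<pi> F \<Longrightarrow> sub_grp H \<Longrightarrow> H \<subseteq> F \<Longrightarrow> sub_grp (\<pi> ` H)"
proof -
  assume \<pi>: "hom_on \<pi> F" and H: "sub_grp H" "H \<subseteq> F"
  note h = hom_onD[OF \<pi>]
  have "\<pi> x + \<pi> y \<in> \<pi> ` H" if "x \<in> H" "y \<in> H" for x y
    using h(2)[of x y] sub_grp_add[OF H(1) that] that H(2) by (metis imageI subsetD)
  moreover have "- \<pi> x \<in> \<pi> ` H" if "x \<in> H" for x
    using h(4)[of x] sub_grp_minus[OF H(1) that] that H(2) by (metis imageI subsetD)
  moreover have "0 \<in> \<pi> ` H" using h(3) sub_grp_0[OF H(1)] by (metis imageI)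
  ultimately show ?thesis unfolding sub_grp_def by blast
qed

lemma normal_in_image:
  assumes "hom_on \<pi> F" "normal_in F N"
  shows "normal_in (\<pi> ` F) (\<pi> ` N)"
  using normal_inD[OF assms(2)] sub_grp_image[OF assms(1)] hom_onD(5)[OF assms(1)]
  unfolding normal_in_def by (auto simp flip: hom_onD(5)[OF assms(1)] simp: subset_iff)

lemma ucs_image:
  assumes "hom_on \<pi> F" "N \<subseteq> F"
  shows "x \<in> F \<Longrightarrow> x \<in> ucs F N B n \<Longrightarrow> \<pi> x \<in> ucs (\<pi> ` F) (\<pi> ` N) (\<pi> ` B) n"
proof (induction n arbitrary: x)
  case (Suc n)
  have "comm (\<pi> x) (\<pi> f) \<in> ucs (\<pi> ` F) (\<pi> ` N) (\<pi> ` B) n" if "f \<in> N" for f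
  proof -
    have f: "f \<in> F" using that assms(2) by auto
    have "comm x f \<in> ucs F N B n" using Suc.prems that by (auto simp: ucs_Suc cent_mod_def)
    moreover have "comm x f \<in> F" using sub_grp_comm[OF hom_onD(1)[OF assms(1)] Suc.prems(1) f] .
    ultimately have "\<pi> (comm x f) \<in> ucs (\<pi> ` F) (\<pi> ` N) (\<pi> ` B) n" using Suc.IH by blast
    then show ?thesis using hom_onD(6)[OF assms(1) Suc.prems(1) f] by simp
  qed
  then show ?case using Suc.prems(1) by (auto simp: ucs_Suc cent_mod_def)
qed auto

lemma ucs_vimage:
  assumes "hom_on \<pi> F"
  shows "x \<in> F \<Longrightarrow> \<pi> x \<in> ucs (\<pi> ` F) (\<pi> ` F) B n \<Longrightarrow> x \<in> ucs F F {y \<in> F. \<pi> y \<in> B} n"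
proof (induction n arbitrary: x)
  case (Suc n)
  have "comm x f \<in> ucs F F {y \<in> F. \<pi> y \<in> B} n" if f: "f \<in> F" for f
  proof (rule Suc.IH)
    show "comm x f \<in> F" using sub_grp_comm[OF hom_onD(1)[OF assms(1)] Suc.prems(1) f] .
    show "\<pi> (comm x f) \<in> ucs (\<pi> ` F) (\<pi> ` F) B n"
      using Suc.prems f hom_onD(6)[OF assms(1) Suc.prems(1) f] by (auto simp: ucs_Suc cent_mod_def)
  qed
  then show ?case using Suc.prems(1) by (auto simp: ucs_Suc cent_mod_def)
qed auto

lemma nil_over_vimage:
  assumes "hom_on \<pi> F" "A \<subseteq> F" "nil_over (\<pi> ` F) (\<pi> ` A) B"
  shows "nil_over F A {y \<in> F. \<pi> y \<in> B}"
proof -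
  obtain n where "\<pi> ` A \<subseteq> ucs (\<pi> ` F) (\<pi> ` F) B n" using assms(3) unfolding nil_over_def by auto
  then have "A \<subseteq> ucs F F {y \<in> F. \<pi> y \<in> B} n" using ucs_vimage[OF assms(1)] assms(2) by blast
  then show ?thesis unfolding nil_over_def by auto
qed

lemma fitting_group_image:
  assumes "hom_on \<pi> F" "fitting_group F"
  shows "fitting_group (\<pi> ` F)"
proof -
  note h = hom_onD[OF assms(1)]
  have "nil_act (\<pi> ` F) (\<pi> ` N)" if N: "nil_act F N" for N
  proof -
    obtain c where c: "normal_in F N" "F \<subseteq> ucs F N {0} c" using N unfolding nil_act_def by auto
    have "\<pi> ` F \<subseteq> ucs (\<pi> ` F) (\<pi> ` N) {0} c"
      using ucs_image[OF assms(1) normal_inD(3)[OF c(1)], of _ "{0}" c] c(2) h(3) by auto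
    then show ?thesis using normal_in_image[OF assms(1) c(1)] unfolding nil_act_def by auto
  qed
  then show ?thesis
    using assms(2) sub_grp_image[OF assms(1) h(1) order_refl] unfolding fitting_group_def by blast
qed


subsection \<open>Quotients by the FC-centre\<close>

fun shift :: "nat \<Rightarrow> word \<Rightarrow> word" where
  "shift r WX = WX"
| "shift r (WVar i) = WVar (r + i)"
| "shift r (WAdd v w) = WAdd (shift r v) (shift r w)"
| "shift r (WNeg w) = WNeg (shift r w)"

lemma ev_shift: "ev (shift (length bs) w) x (bs @ ys) = ev w x ys"
  by (induction w) (auto simp: nth_append)

text \<open>The variables below r are reserved for fixed elements \<open>bs\<close>, and the words
  of \<open>ws\<close>, with their variables moved up by r, conjugate these. Comparing values of the
  new words means comparing values of \<open>ws\<close> modulo the centraliser of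
  \<open>bs\<close>.\<close>

definition conj_words :: "nat \<Rightarrow> word list \<Rightarrow> word list" where
  "conj_words r ws = concat (map (\<lambda>w. map (\<lambda>j. WAdd (WAdd (shift r w) (WVar j)) (WNeg (shift r w))) [0..<r]) ws)"

lemma evs_conj_words:
  "evs (conj_words (length bs) ws) x (bs @ ys) = concat (map (\<lambda>e. map (conjg e) bs) (evs ws x ys))"
proof -
  have "map (\<lambda>j. ev (WAdd (WAdd (shift (length bs) w) (WVar j)) (WNeg (shift (length bs) w))) x (bs @ ys)) [0..<length bs]
      = map (conjg (ev w x ys)) bs" for w
    by (rule nth_equalityI) (auto simp: ev_shift nth_append conjg_def)
  then show ?thesis unfolding evs_def conj_words_def map_concat map_map comp_def by simp
qed

lemma ev_hom:
  assumes "hom_on \<pi> F" "x \<in> F" "set ys \<subseteq> F"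
  shows "ev w (\<pi> x) (map \<pi> ys) = \<pi> (ev w x ys)"
  using hom_onD[OF assms(1)] ev_in[OF hom_onD(1)[OF assms(1)] assms(2,3)]
  by (induction w) auto

lemma card_pointwise_lists:
  assumes "finite \<Omega>" "\<And>zs. zs \<in> S \<Longrightarrow> length zs = length es \<and> (\<forall>i<length es. \<exists>\<omega>\<in>\<Omega>. zs ! i = h (es ! i) \<omega>)"
  shows "finite S \<and> card S \<le> card \<Omega> ^ length es"
proof -
  let ?L = "{\<omega>s. set \<omega>s \<subseteq> \<Omega> \<and> length \<omega>s = length es}"
  have "S \<subseteq> (\<lambda>\<omega>s. map (\<lambda>i. h (es ! i) (\<omega>s ! i)) [0..<length es]) ` ?L"
  proof
    fix zs assume "zs \<in> S"
    then have zs: "length zs = length es" "\<forall>i<length es. \<exists>\<omega>\<in>\<Omega>. zs ! i = h (es ! i) \<omega>" using assms(2) by auto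
    then obtain w where w: "\<And>i. i < length es \<Longrightarrow> w i \<in> \<Omega> \<and> zs ! i = h (es ! i) (w i)" by metis
    have "zs = map (\<lambda>i. h (es ! i) (map w [0..<length es] ! i)) [0..<length es]"
      by (rule nth_equalityI) (use zs w in auto)
    moreover have "map w [0..<length es] \<in> ?L" using w by auto
    ultimately show "zs \<in> (\<lambda>\<omega>s. map (\<lambda>i. h (es ! i) (\<omega>s ! i)) [0..<length es]) ` ?L" by blast
  qed
  moreover have "finite ?L" "card ?L = card \<Omega> ^ length es"
    using finite_lists_length_eq[OF assms(1)] card_lists_length_eq[OF assms(1)] by auto
  ultimately show ?thesis
    using card_image_le[of ?L "\<lambda>\<omega>s. map (\<lambda>i. h (es ! i) (\<omega>s ! i)) [0..<length es]"]
      card_mono finite_subset by (metis (no_types, lifting) finite_imageI le_trans)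
qed

text \<open>By \<open>tree_compare\<close>, trees of values modulo the FC-centre \<open>A\<close>
  are turned into trees of conjugates of a finite list, to which the hypothesis applies. This needs
  \<open>A\<close> to be commensurable with the centraliser \<open>K\<close> of the finite set
  \<open>Z\<close>. Elements of \<open>Z\<close> lie in \<open>H1\<close>, hence have finite orbits
  under \<open>A\<close>; and \<open>Z\<close> is chosen so that \<open>K\<close> has small orbits
  on \<open>H1\<close>, which makes \<open>K\<close> finite modulo \<open>A\<close>.\<close>

lemma word_bounded_quotient:
  assumes F: "fitting_group F" and W: "word_bounded F" and \<pi>: "hom_on \<pi> F"
    and ker: "\<And>x. x \<in> F \<Longrightarrow> \<pi> x = 0 \<longleftrightarrow> x \<in> fc_centre F"
  shows "word_bounded (\<pi> ` F)"
proof -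
  note h = hom_onD[OF \<pi>]
  note sF = h(1)
  obtain k d where kd: "conj_bounded F k d" using word_bounded_conj[OF W] .
  define A where "A = fc_centre F"
  have nA: "normal_in F A" unfolding A_def by (rule normal_in_fc_centre[OF sF])
  note A' = normal_inD[OF nA]
  define H1 where "H1 = fin_orbits F A"
  have H1: "normal_in F H1" "fin_index F H1"
    using almost_commuting[OF F kd nA normal_in_self[OF sF]] 
    unfolding H1_def A_def fc_centre_def fin_orbits_def by (metis (mono_tags, lifting) mem_Collect_eq)+
  note H1' = normal_inD[OF H1(1)]
  obtain Z where Z: "finite Z" "Z \<subseteq> H1" "\<And>y. y \<in> H1 \<Longrightarrow> \<not> big_orbit k (centr F Z) y"
    using max_centr[OF kd sF order_refl H1'(3)] by metis
  define K where "K = centr F Z"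
  have sK: "sub_grp K" unfolding K_def by (rule sub_grp_centr[OF sF])
  have KF: "K \<subseteq> F" unfolding K_def centr_def by auto
  have fiK: "fin_index K (fin_orbits K H1)"
    by (rule fin_index_fin_orbits[OF H1'(2) sK, of k]) (use Z(3) in \<open>auto simp: big_orbit_def K_def not_le intro: less_imp_le\<close>)
  \<comment> \<open>A finite orbit under \<open>H1\<close> is contained in a finite orbit under
    \<open>F\<close>, since \<open>H1\<close> has finite index.\<close>
  have K1A: "fin_orbits K H1 \<subseteq> A"
    using finite_orbit_fin_index[OF H1(2)] KF unfolding A_def fc_centre_def fin_orbits_def by auto
  have finK: "finite (\<pi> ` K)"
  proof -
    obtain T where T: "finite T" "T \<subseteq> K" "K \<subseteq> set_sum T (fin_orbits K H1)" using fiK unfolding fin_index_def by auto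
    have "\<pi> ` K \<subseteq> \<pi> ` T"
    proof
      fix z assume "z \<in> \<pi> ` K"
      then obtain x where x: "x \<in> K" "z = \<pi> x" by auto
      then obtain t a where ta: "t \<in> T" "a \<in> fin_orbits K H1" "x = t + a" using T(3) unfolding set_sum_def by blast
      have "a \<in> A" "t \<in> F" "a \<in> F" using ta K1A T(2) KF A'(3) by auto
      then have "z = \<pi> t + \<pi> a" "\<pi> a = 0" using x(2) ta(3) h(2) ker unfolding A_def by blast+
      then have "z = \<pi> t" by simp
      then show "z \<in> \<pi> ` T" using ta(1) by auto
    qed
    then show ?thesis using T(1) finite_subset by blast
  qed
  obtain bs where bs: "set bs = Z" using finite_list[OF Z(1)] by auto
  \<comment> \<open>The ways in which \<open>A\<close> moves the tuple \<open>bs\<close>. Their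
    number bounds the \<open>g\<close>-values on an \<open>f\<close>-fibre, and the size of the
    image of \<open>K\<close> bounds the \<open>f\<close>-values on a \<open>g\<close>-fibre; either
    bound is raised to the power \<open>L\<close>, one factor for each word.\<close>
  define \<Omega> where "\<Omega> = (\<lambda>a. map (conjg a) bs) ` A"
  have fin\<Omega>: "finite \<Omega>"
  proof (rule finite_subset)
    show "\<Omega> \<subseteq> {xs. set xs \<subseteq> (\<Union>b\<in>Z. orbit A b) \<and> length xs = length bs}"
      unfolding \<Omega>_def orbit_def bs[symmetric] by auto blast
    have "finite (\<Union>b\<in>Z. orbit A b)" using Z(1,2) unfolding H1_def fin_orbits_def by auto
    then show "finite {xs. set xs \<subseteq> (\<Union>b\<in>Z. orbit A b) \<and> length xs = length bs}"
      by (rule finite_lists_length_eq)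
  qed
  have \<Omega>0: "card \<Omega> > 0" using fin\<Omega> sub_grp_0[OF A'(2)] unfolding \<Omega>_def by (auto simp: card_gt_0_iff)
  have K0: "card (\<pi> ` K) > 0" using finK sub_grp_0[OF sK] by (auto simp: card_gt_0_iff)
  show ?thesis
    unfolding word_bounded_def
  proof (intro allI)
    fix ws :: "word list" and p
    define L where "L = length ws"
    define r where "r = length bs"
    define f where "f x ys = map \<pi> (evs ws x ys)" for x and ys :: "'a list"
    define g where "g x ys = evs (conj_words r ws) x (bs @ ys)" for x ys
    have g: "g x ys = concat (map (\<lambda>e. map (conjg e) bs) (evs ws x ys))" for x ys
      unfolding g_def r_def evs_conj_words ..
    have esF: "set (evs ws x ys) \<subseteq> F" if "x \<in> F" "ys \<in> tuples_in F p" for x ys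
      using ev_in[OF sF] that unfolding evs_def tuples_in_def by auto
    have len: "length (evs ws x ys) = L" for x :: 'a and ys unfolding evs_def L_def by simp
    have cond_f: "finite {g x y | x. x \<in> F \<and> f x y = c} \<and> card {g x y | x. x \<in> F \<and> f x y = c} \<le> card \<Omega> ^ L"
      if y: "y \<in> tuples_in F p" for y c
    proof (cases "\<exists>x0\<in>F. f x0 y = c")
      case True
      then obtain x0 where x0: "x0 \<in> F" "f x0 y = c" by auto
      let ?es = "evs ws x0 y"
      let ?S = "{map (\<lambda>e. map (conjg e) bs) (evs ws x y) | x. x \<in> F \<and> f x y = c}"
      have fS: "finite ?S \<and> card ?S \<le> card \<Omega> ^ length ?es"
      proof (rule card_pointwise_lists[OF fin\<Omega>, where h = "\<lambda>e. map (conjg e)"])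
        fix zs assume "zs \<in> ?S"
        then obtain x where x: "x \<in> F" "f x y = c" "zs = map (\<lambda>e. map (conjg e) bs) (evs ws x y)" by auto
        have "\<exists>\<omega>\<in>\<Omega>. zs ! i = map (conjg (?es ! i)) \<omega>" if i: "i < L" for i
        proof -
          define e0 e where "e0 = ?es ! i" and "e = evs ws x y ! i"
          have eF: "e0 \<in> F" "e \<in> F"
            unfolding e0_def e_def using esF[OF x0(1) y] esF[OF x(1) y] len i by (metis nth_mem subsetD)+
          have "f x y ! i = f x0 y ! i" using x0 x by simp
          then have "\<pi> e = \<pi> e0" unfolding f_def e0_def e_def using i len by simp
          then have "\<pi> (- e0 + e) = 0" using h(2,4) eF sub_grp_minus[OF sF] by simp
          then have a: "- e0 + e \<in> A" 
            unfolding A_def using ker eF sub_grp_add[OF sF] sub_grp_minus[OF sF] by blast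
          have "conjg e b = conjg e0 (conjg (- e0 + e) b)" for b by (simp only: free_group_simps)
          then have "zs ! i = map (conjg e0) (map (conjg (- e0 + e)) bs)"
            unfolding x(3) using i len by (simp add: e_def[symmetric] comp_def)
          then show ?thesis using a unfolding \<Omega>_def e0_def by blast
        qed
        then show "length zs = length ?es \<and> (\<forall>i<length ?es. \<exists>\<omega>\<in>\<Omega>. zs ! i = map (conjg (?es ! i)) \<omega>)"
          using x(3) len by simp
      qed
      have gS: "{g x y | x. x \<in> F \<and> f x y = c} = concat ` ?S" unfolding g by blast
      have "finite (concat ` ?S)" "card (concat ` ?S) \<le> card \<Omega> ^ length ?es"
        by (rule finite_imageI[OF conjunct1[OF fS]])
          (rule order_trans[OF card_image_le[OF conjunct1[OF fS]] conjunct2[OF fS]])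
      then show ?thesis unfolding gS len by blast
    next
      case False
      then have "{g x y | x. x \<in> F \<and> f x y = c} = {}" by auto
      then show ?thesis by (simp only: finite.emptyI card.empty le0 simp_thms)
    qed
    have cond_g: "finite {f x y | x. x \<in> F \<and> g x y = c} \<and> card {f x y | x. x \<in> F \<and> g x y = c} \<le> card (\<pi> ` K) ^ L"
      if y: "y \<in> tuples_in F p" for y c
    proof (cases "\<exists>x0\<in>F. g x0 y = c")
      case True
      then obtain x0 where x0: "x0 \<in> F" "g x0 y = c" by auto
      let ?es = "evs ws x0 y"
      have "finite {f x y | x. x \<in> F \<and> g x y = c} \<and> card {f x y | x. x \<in> F \<and> g x y = c} \<le> card (\<pi> ` K) ^ length ?es"
      proof (rule card_pointwise_lists[OF finK, where h = "\<lambda>e \<omega>. \<pi> e + \<omega>"])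
        fix zs assume "zs \<in> {f x y | x. x \<in> F \<and> g x y = c}"
        then obtain x where x: "x \<in> F" "g x y = c" "zs = f x y" by auto
        have "concat (map (\<lambda>e. map (conjg e) bs) (evs ws x y)) = concat (map (\<lambda>e. map (conjg e) bs) ?es)"
          using x(2) x0(2) unfolding g by simp
        \<comment> \<open>All blocks have the length of \<open>bs\<close>, so the concatenation can
          be undone.\<close>
        then have eq: "map (\<lambda>e. map (conjg e) bs) (evs ws x y) = map (\<lambda>e. map (conjg e) bs) ?es"
          by (rule concat_injective) (auto simp: len set_zip)
        have "\<exists>\<omega>\<in>\<pi> ` K. zs ! i = \<pi> (?es ! i) + \<omega>" if i: "i < L" for i
        proof -
          define e0 e where "e0 = ?es ! i" and "e = evs ws x y ! i"
          have eF: "e0 \<in> F" "e \<in> F"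
            unfolding e0_def e_def using esF[OF x0(1) y] esF[OF x(1) y] len i by (metis nth_mem subsetD)+
          have "map (conjg e) bs = map (conjg e0) bs"
            using arg_cong[OF eq, of "\<lambda>l. l ! i"] i len unfolding e0_def e_def by simp
          then have "conjg e0 b = conjg e b" if "b \<in> Z" for b using that bs by auto
          then have "conjg (- e0 + e) b = b" if "b \<in> Z" for b using that conjg_eq_iff by blast
          then have K: "- e0 + e \<in> K"
            unfolding K_def centr_def using eF sub_grp_add[OF sF] sub_grp_minus[OF sF] by blast
          have "e = e0 + (- e0 + e)" by (simp only: free_group_simps)
          then have "\<pi> e = \<pi> e0 + \<pi> (- e0 + e)" using h(2)[OF eF(1)] K KF by (metis subsetD)
          then have "zs ! i = \<pi> e0 + \<pi> (- e0 + e)"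
            unfolding x(3) f_def using i len by (simp add: e_def[symmetric])
          then show ?thesis using K unfolding e0_def by blast
        qed
        then show "length zs = length ?es \<and> (\<forall>i<length ?es. \<exists>\<omega>\<in>\<pi> ` K. zs ! i = \<pi> (?es ! i) + \<omega>)"
          using x(3) len unfolding f_def by simp
      qed
      then show ?thesis using len by simp
    next
      case False
      then have "{f x y | x. x \<in> F \<and> g x y = c} = {}" by auto
      then show ?thesis by (simp only: finite.emptyI card.empty le0 simp_thms)
    qed
    obtain k2 d2 where k2: "k2 > 0"
      "\<And>yss. length yss = d2 \<Longrightarrow> set yss \<subseteq> tuples_in F (r + p) \<Longrightarrow> \<not> tree (evs (conj_words r ws)) k2 yss F"
      using W unfolding word_bounded_def by metis
    define kk where "kk = k2 * card (\<pi> ` K) ^ L * (card \<Omega> ^ L) ^ d2"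
    have "\<not> tree (evs ws) kk yss' (\<pi> ` F)"
      if yss': "length yss' = d2" "set yss' \<subseteq> tuples_in (\<pi> ` F) p" for yss'
    proof
      assume tr: "tree (evs ws) kk yss' (\<pi> ` F)"
      define lift where "lift ys' = map (inv_into F \<pi>) ys'" for ys'
      define yss where "yss = map lift yss'"
      have lift: "map \<pi> (lift ys') = ys'" "lift ys' \<in> tuples_in F p" if "ys' \<in> tuples_in (\<pi> ` F) p" for ys'
        using that inv_into_into[of _ \<pi> F] unfolding lift_def tuples_in_def
        by (auto simp: subset_iff f_inv_into_f intro!: map_idI)
      have yssF: "set yss \<subseteq> tuples_in F p" unfolding yss_def using lift(2) yss'(2) by auto
      have "map (map \<pi>) yss = yss'" unfolding yss_def map_map comp_def
        by (rule map_idI) (use lift(1) yss'(2) in auto)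
      then have "tree (evs ws) kk (map (map \<pi>) yss) (\<pi> ` F)" using tr by simp
      then have tr': "tree (\<lambda>x ys. evs ws (\<pi> x) (map \<pi> ys)) kk yss F"
        by (simp only: tree_map tree_image)
      have "evs ws (\<pi> x) (map \<pi> ys) = f x ys" if "x \<in> F" "ys \<in> set yss" for x ys
        using ev_hom[OF \<pi> that(1)] that(2) yssF unfolding evs_def f_def tuples_in_def by auto
      then have "tree f kk yss F" by (rule iffD1[OF tree_cong tr'])
      then have "tree g k2 yss F"
        using tree_compare[of "tuples_in F p" g F f, OF cond_f cond_g k2(1) _ _ order_refl yssF]
          yss'(1) \<Omega>0 K0 unfolding kk_def yss_def by simp
      then have "tree (evs (conj_words r ws)) k2 (map ((@) bs) yss) F"
        unfolding tree_map g_def .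
      moreover have "set (map ((@) bs) yss) \<subseteq> tuples_in F (r + p)"
        using yssF Z(2) H1'(3) bs unfolding tuples_in_def r_def by (auto simp: subset_iff)
      ultimately show False using k2(2)[of "map ((@) bs) yss"] yss'(1) unfolding yss_def by simp
    qed
    moreover have "kk > 0" unfolding kk_def using k2(1) \<Omega>0 K0 by simp
    ultimately show "\<exists>k d. 0 < k \<and> (\<forall>yss. length yss = d \<and> set yss \<subseteq> tuples_in (\<pi> ` F) p \<longrightarrow> \<not> tree (evs ws) k yss (\<pi> ` F))"
      by blast
  qed
qed

subsection \<open>Groups of bijections\<close>

text \<open>A concrete type of class \<open>group_add\<close> that is rich enough: every group whose
  elements can be labelled injectively by points of \<open>'a\<close> embeds here by
  translation.\<close>

typedef 'a bijection = "{f :: 'a \<Rightarrow> 'a. bij f}"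
  by (rule exI[of _ id]) simp

setup_lifting type_definition_bijection

instantiation bijection :: (type) group_add
begin

lift_definition zero_bijection :: "'a bijection" is id by simp
lift_definition plus_bijection :: "'a bijection \<Rightarrow> 'a bijection \<Rightarrow> 'a bijection" is "(\<circ>)" by (simp add: bij_comp)
lift_definition uminus_bijection :: "'a bijection \<Rightarrow> 'a bijection" is "inv_into UNIV" by (simp add: bij_imp_bij_inv)
definition minus_bijection :: "'a bijection \<Rightarrow> 'a bijection \<Rightarrow> 'a bijection" where "minus_bijection f g = f + - g"

instance
proof
  fix a b c :: "'a bijection"
  show "a + b + c = a + (b + c)" by transfer (simp add: comp_assoc)
  show "0 + a = a" by transfer simp
  show "a + 0 = a" by transfer simp
  show "- a + a = 0" by transfer (metis bij_is_inj inv_o_cancel)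
  show "a + - b = a - b" by (simp add: minus_bijection_def)
qed

end

text \<open>\<open>G\<close> acts on its labels by left translation, and points that are no labels
  stay fixed. With c the identity this is the regular representation; with c a labelling of the
  cosets of a normal subgroup, that subgroup is the kernel.\<close>

lemma regular_embedding:
  fixes G (structure) and c :: "_ \<Rightarrow> 'a"
  assumes "group G"
    and c: "\<And>x y z. x \<in> carrier G \<Longrightarrow> y \<in> carrier G \<Longrightarrow> z \<in> carrier G \<Longrightarrow> c x = c y \<Longrightarrow> c (z \<otimes> x) = c (z \<otimes> y)"
  obtains \<pi> :: "_ \<Rightarrow> 'a bijection" where
    "\<And>x y. x \<in> carrier G \<Longrightarrow> y \<in> carrier G \<Longrightarrow> \<pi> (x \<otimes> y) = \<pi> x + \<pi> y"
    "\<And>x y. x \<in> carrier G \<Longrightarrow> y \<in> carrier G \<Longrightarrow> \<pi> x = \<pi> y \<longleftrightarrow> (\<forall>z\<in>carrier G. c (x \<otimes> z) = c (y \<otimes> z))"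
proof -
  interpret group G by fact
  define act where "act x p = (if p \<in> c ` carrier G then c (x \<otimes> inv_into (carrier G) c p) else p)" for x p
  have act: "act x (c y) = c (x \<otimes> y)" if "x \<in> carrier G" "y \<in> carrier G" for x y
  proof -
    have "inv_into (carrier G) c (c y) \<in> carrier G" "c (inv_into (carrier G) c (c y)) = c y"
      using that by (auto intro: inv_into_into f_inv_into_f)
    then have "c (x \<otimes> inv_into (carrier G) c (c y)) = c (x \<otimes> y)" using c that by blast
    then show ?thesis unfolding act_def using that by simp
  qed
  have out: "act x p = p" if "p \<notin> c ` carrier G" for x p using that unfolding act_def by simp
  have comp: "act x (act y p) = act (x \<otimes> y) p" if "x \<in> carrier G" "y \<in> carrier G" for x y p
  proof (cases "p \<in> c ` carrier G")
    case True
    then obtain z where "z \<in> carrier G" "p = c z" by auto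
    then show ?thesis using that by (simp add: act m_assoc)
  qed (simp add: out)
  have one: "act \<one> p = p" for p
  proof (cases "p \<in> c ` carrier G")
    case True
    then obtain z where "z \<in> carrier G" "p = c z" by auto
    then show ?thesis by (simp add: act)
  qed (simp add: out)
  have bij: "bij (act x)" if "x \<in> carrier G" for x
    by (rule o_bij[of "act (inv x)"]) (use that in \<open>auto simp: fun_eq_iff comp one\<close>)
  define \<pi> where "\<pi> x = Abs_bijection (act x)" for x
  have Rep: "Rep_bijection (\<pi> x) = act x" if "x \<in> carrier G" for x
    unfolding \<pi>_def using bij[OF that] by (simp add: Abs_bijection_inverse)
  show thesis
  proof (rule that)
    fix x y assume xy: "x \<in> carrier G" "y \<in> carrier G"
    show "\<pi> (x \<otimes> y) = \<pi> x + \<pi> y"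
      unfolding Rep_bijection_inject[symmetric] plus_bijection.rep_eq
      using xy by (auto simp: Rep fun_eq_iff comp)
    show "\<pi> x = \<pi> y \<longleftrightarrow> (\<forall>z\<in>carrier G. c (x \<otimes> z) = c (y \<otimes> z))"
      unfolding Rep_bijection_inject[symmetric] Rep[OF xy(1)] Rep[OF xy(2)]
    proof
      assume "act x = act y"
      then show "\<forall>z\<in>carrier G. c (x \<otimes> z) = c (y \<otimes> z)" using act xy by metis
    next
      assume *: "\<forall>z\<in>carrier G. c (x \<otimes> z) = c (y \<otimes> z)"
      show "act x = act y"
      proof
        fix p show "act x p = act y p"
        proof (cases "p \<in> c ` carrier G")
          case True
          then obtain z where "z \<in> carrier G" "p = c z" by auto
          then show ?thesis using * xy by (simp add: act)
        qed (simp add: out)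
      qed
    qed
  qed
qed


subsection \<open>Fitting groups with bounded word trees\<close>

text \<open>The injection makes a quotient of \<open>F\<close> act on the same base type, so that statements about all
  tame groups can be proved by induction through quotients.\<close>

definition tame :: "'a bijection set \<Rightarrow> bool" where
  "tame F \<longleftrightarrow> fitting_group F \<and> word_bounded F \<and> (\<exists>\<iota> :: 'a bijection \<Rightarrow> 'a. inj_on \<iota> F)"

definition kernel_on :: "('g \<Rightarrow> 'h::group_add) \<Rightarrow> 'g set \<Rightarrow> 'g set" where
  "kernel_on \<pi> F = {x \<in> F. \<pi> x = 0}"

text \<open>A coset of the FC-centre is labelled by the image of a chosen representative under the
  injection into \<open>'a\<close>. The action on labels represents the quotient by permutations of
  the same \<open>'a\<close>, and the labels also give the injection that tameness of the quotient
  requires.\<close>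

lemma tame_quotient_fc_centre:
  fixes F :: "'a bijection set"
  assumes "tame F"
  obtains \<pi> :: "'a bijection \<Rightarrow> 'a bijection" where "hom_on \<pi> F" "tame (\<pi> ` F)" "kernel_on \<pi> F = fc_centre F"
proof -
  have F: "fitting_group F" and W: "word_bounded F" using assms unfolding tame_def by auto
  obtain \<iota> :: "'a bijection \<Rightarrow> 'a" where \<iota>: "inj_on \<iota> F" using assms unfolding tame_def by auto
  have sF: "sub_grp F" using F unfolding fitting_group_def by auto
  define A where "A = fc_centre F"
  have nA: "normal_in F A" unfolding A_def by (rule normal_in_fc_centre[OF sF])
  note A' = normal_inD[OF nA]
  define c where "c x = \<iota> (SOME z. z \<in> (+) x ` A)" for x
  have some: "(SOME z. z \<in> (+) x ` A) \<in> (+) x ` A" for x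
    by (rule someI_ex) (use sub_grp_0[OF A'(2)] in blast)
  have c: "c x = c y \<longleftrightarrow> - x + y \<in> A" if xy: "x \<in> F" "y \<in> F" for x y
  proof
    assume "- x + y \<in> A"
    then have "(+) x ` A = (+) y ` A" using coset_eq[OF A'(2)] by blast
    then show "c x = c y" unfolding c_def by simp
  next
    assume *: "c x = c y"
    obtain a b where ab: "a \<in> A" "b \<in> A" "(SOME z. z \<in> (+) x ` A) = x + a" "(SOME z. z \<in> (+) y ` A) = y + b"
      using some[of x] some[of y] by blast
    have "x + a \<in> F" "y + b \<in> F" using ab xy A'(3) sub_grp_add[OF sF] by blast+
    then have "x + a = y + b" using * \<iota> ab unfolding c_def by (metis inj_onD)
    then have "- x + (y + b) - b = - x + (x + a) - b" by simp
    then have "- x + y = a - b" by (simp only: free_group_simps)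
    then show "- x + y \<in> A" using ab sub_grp_diff[OF A'(2)] by simp
  qed
  let ?G = "\<lparr>carrier = F, mult = (+), one = 0 :: 'a bijection\<rparr>"
  have "group ?G"
  proof (rule groupI)
    fix x assume "x \<in> carrier ?G"
    then show "\<exists>y\<in>carrier ?G. y \<otimes>\<^bsub>?G\<^esub> x = \<one>\<^bsub>?G\<^esub>"
      using sub_grp_minus[OF sF] by (intro bexI[of _ "- x"]) auto
  qed (use sub_grp_add[OF sF] sub_grp_0[OF sF] in \<open>auto simp: add.assoc\<close>)
  then obtain \<pi> :: "'a bijection \<Rightarrow> 'a bijection" where
    \<pi>: "\<And>x y. x \<in> F \<Longrightarrow> y \<in> F \<Longrightarrow> \<pi> (x + y) = \<pi> x + \<pi> y"
    "\<And>x y. x \<in> F \<Longrightarrow> y \<in> F \<Longrightarrow> \<pi> x = \<pi> y \<longleftrightarrow> (\<forall>z\<in>F. c (x + z) = c (y + z))"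
  proof (rule regular_embedding[where c = c])
    fix x y z assume "x \<in> carrier ?G" "y \<in> carrier ?G" "z \<in> carrier ?G" "c x = c y"
    then have *: "x \<in> F" "y \<in> F" "z \<in> F" "- x + y \<in> A" using c by auto
    have "- (z + x) + (z + y) = - x + y" by (simp only: free_group_simps)
    then show "c (z \<otimes>\<^bsub>?G\<^esub> x) = c (z \<otimes>\<^bsub>?G\<^esub> y)" using * c sub_grp_add[OF sF] by simp
  qed auto
  have hom: "hom_on \<pi> F" unfolding hom_on_def using sF \<pi>(1) by auto
  have eq: "\<pi> x = \<pi> y \<longleftrightarrow> - x + y \<in> A" if xy: "x \<in> F" "y \<in> F" for x y
  proof -
    have "c (x + z) = c (y + z) \<longleftrightarrow> - x + y \<in> A" if z: "z \<in> F" for z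
    proof -
      have "c (x + z) = c (y + z) \<longleftrightarrow> - (x + z) + (y + z) \<in> A" using c sub_grp_add[OF sF] xy z by blast
      also have "- (x + z) + (y + z) = conjg (- z) (- x + y)" by (simp only: free_group_simps)
      also have "conjg (- z) (- x + y) \<in> A \<longleftrightarrow> - x + y \<in> A"
      proof
        assume "conjg (- z) (- x + y) \<in> A"
        then have "conjg z (conjg (- z) (- x + y)) \<in> A" using A'(4) z by blast
        then show "- x + y \<in> A" by (simp only: free_group_simps)
      qed (use A'(4) sub_grp_minus[OF sF z] in blast)
      finally show ?thesis .
    qed
    then show ?thesis using \<pi>(2)[OF xy] sub_grp_0[OF sF] by blast
  qed
  have ker: "\<pi> x = 0 \<longleftrightarrow> x \<in> A" if "x \<in> F" for x
  proof -
    have "\<pi> x = 0 \<longleftrightarrow> - x \<in> A" using eq[OF that sub_grp_0[OF sF]] hom_onD(3)[OF hom] by simp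
    then show ?thesis using sub_grp_minus[OF A'(2)] by (metis minus_minus)
  qed
  have "inj_on (\<lambda>p. c (inv_into F \<pi> p)) (\<pi> ` F)"
  proof (rule inj_onI)
    fix p q assume pq: "p \<in> \<pi> ` F" "q \<in> \<pi> ` F" "c (inv_into F \<pi> p) = c (inv_into F \<pi> q)"
    then have "\<pi> (inv_into F \<pi> p) = \<pi> (inv_into F \<pi> q)" using eq c inv_into_into by metis
    then show "p = q" using pq by (metis f_inv_into_f)
  qed
  moreover have "word_bounded (\<pi> ` F)" by (rule word_bounded_quotient[OF F W hom]) (use ker A_def in auto)
  ultimately have "tame (\<pi> ` F)" using fitting_group_image[OF hom F] unfolding tame_def by blast
  moreover have "kernel_on \<pi> F = fc_centre F" unfolding kernel_on_def using ker A_def A'(3) by auto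
  ultimately show thesis using that hom by blast
qed

lemma hom_on_comp:
  assumes "hom_on \<pi> F" "hom_on \<sigma> (\<pi> ` F)"
  shows "hom_on (\<sigma> \<circ> \<pi>) F"
  using assms unfolding hom_on_def by auto

text \<open>The FC-centre is divided out n times. Each round absorbs at least the centre, since
  central elements have one-point orbits, and by \<open>fc_centre_nil\<close> it keeps the kernel
  within a finite term of the upper central series. The kernel may exceed the n-th term.\<close>

lemma tame_quotient_ucs:
  fixes F :: "'a bijection set"
  assumes "tame F"
  shows "\<exists>\<pi> :: 'a bijection \<Rightarrow> 'a bijection. hom_on \<pi> F \<and> tame (\<pi> ` F) \<and>
    ucs F F {0} n \<subseteq> kernel_on \<pi> F \<and> nil_over F (kernel_on \<pi> F) {0}"
proof (induction n)
  case 0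
  have sF: "sub_grp F" using assms unfolding tame_def fitting_group_def by auto
  have "hom_on (\<lambda>x. x) F" unfolding hom_on_def using sF by auto
  moreover have "kernel_on (\<lambda>x. x) F = {0}" unfolding kernel_on_def using sub_grp_0[OF sF] by auto
  ultimately show ?case using assms nil_over_subset[OF order_refl] by (intro exI[of _ "\<lambda>x. x"]) simp
next
  case (Suc n)
  have sF: "sub_grp F" using assms unfolding tame_def fitting_group_def by auto
  obtain \<pi> :: "'a bijection \<Rightarrow> 'a bijection" where \<pi>: "hom_on \<pi> F" "tame (\<pi> ` F)"
    "ucs F F {0} n \<subseteq> kernel_on \<pi> F" "nil_over F (kernel_on \<pi> F) {0}" using Suc by auto
  obtain \<sigma> :: "'a bijection \<Rightarrow> 'a bijection" where \<sigma>: "hom_on \<sigma> (\<pi> ` F)" "tame (\<sigma> ` \<pi> ` F)"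
    "kernel_on \<sigma> (\<pi> ` F) = fc_centre (\<pi> ` F)" using tame_quotient_fc_centre[OF \<pi>(2)] by metis
  have ker: "kernel_on (\<sigma> \<circ> \<pi>) F = {x \<in> F. \<pi> x \<in> fc_centre (\<pi> ` F)}"
    unfolding \<sigma>(3)[symmetric] kernel_on_def by auto
  have "ucs F F {0} (Suc n) \<subseteq> kernel_on (\<sigma> \<circ> \<pi>) F"
  proof
    fix x assume x: "x \<in> ucs F F {0} (Suc n)"
    then have xF: "x \<in> F" by (auto simp: ucs_Suc cent_mod_def)
    have "conjg (\<pi> f) (\<pi> x) = \<pi> x" if f: "f \<in> F" for f
    proof -
      have "comm x f \<in> kernel_on \<pi> F" using x f \<pi>(3) by (auto simp: ucs_Suc cent_mod_def)
      then have "comm (\<pi> x) (\<pi> f) = 0" using hom_onD(6)[OF \<pi>(1) xF f] unfolding kernel_on_def by simp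
      then show ?thesis using comm_0_sym comm_0_iff by blast
    qed
    then have "orbit (\<pi> ` F) (\<pi> x) \<subseteq> {\<pi> x}" unfolding orbit_def by auto
    then have "\<pi> x \<in> fc_centre (\<pi> ` F)" unfolding fc_centre_def fin_orbits_def using xF finite_subset by auto
    then show "x \<in> kernel_on (\<sigma> \<circ> \<pi>) F" unfolding ker using xF by auto
  qed
  moreover have "nil_over F (kernel_on (\<sigma> \<circ> \<pi>) F) {0}"
  proof (rule nil_over_trans[OF _ \<pi>(4)])
    obtain k d where kd: "conj_bounded (\<pi> ` F) k d" using \<pi>(2) word_bounded_conj unfolding tame_def by metis
    have "nil_over (\<pi> ` F) (fc_centre (\<pi> ` F)) {0}"
      using fc_centre_nil[OF _ kd] \<pi>(2) unfolding tame_def by blast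
    then have "nil_over (\<pi> ` F) (\<pi> ` kernel_on (\<sigma> \<circ> \<pi>) F) {0}"
      by (rule nil_over_trans[OF nil_over_subset, rotated]) (auto simp: ker)
    then have "nil_over F (kernel_on (\<sigma> \<circ> \<pi>) F) {y \<in> F. \<pi> y \<in> {0}}"
      by (rule nil_over_vimage[OF \<pi>(1), rotated]) (auto simp: ker)
    then show "nil_over F (kernel_on (\<sigma> \<circ> \<pi>) F) (kernel_on \<pi> F)" unfolding kernel_on_def by simp
  qed
  ultimately show ?case
    using hom_on_comp[OF \<pi>(1) \<sigma>(1)] \<sigma>(2)[unfolded image_comp] by blast
qed

section \<open>Abelian normal subgroups and nilpotency of tame groups\<close>

text \<open>Conjugating g by an element of \<open>F\<close> changes it only by an element of
  \<open>S\<close>, which v centralises; so if v commutes with g, it commutes with all these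
  conjugates.\<close>

lemma centr_single_normal:
  assumes V: "normal_in F V" and S: "normal_in F S" and VS: "\<And>v s. v \<in> V \<Longrightarrow> s \<in> S \<Longrightarrow> comm v s = 0"
    and g: "g \<in> cent_mod F F S"
  shows "normal_in F (centr V {g})"
proof -
  note V' = normal_inD[OF V] and S' = normal_inD[OF S]
  have gF: "g \<in> F" using g unfolding cent_mod_def by auto
  have "conjg (conjg f v) g = g" if f: "f \<in> F" and v: "v \<in> V" "conjg v g = g" for f v
  proof -
    have mf: "- f \<in> F" using f sub_grp_minus[OF V'(1)] by auto
    have "comm g (- f) \<in> S" using g mf unfolding cent_mod_def by auto
    then have "conjg v (comm g (- f)) = comm g (- f)" using VS[OF v(1)] comm_0_iff by blast
    moreover have "conjg (- f) g = - comm g (- f) + g" by (simp only: free_group_simps)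
    moreover have "conjg v (- comm g (- f) + g) = - conjg v (comm g (- f)) + conjg v g" by (simp only: free_group_simps)
    ultimately have "conjg v (conjg (- f) g) = conjg (- f) g" using v(2) by metis
    moreover have "conjg (conjg f v) g = conjg f (conjg v (conjg (- f) g))" by (simp only: free_group_simps)
    moreover have "conjg f (conjg (- f) g) = g" by (simp only: free_group_simps)
    ultimately show ?thesis by metis
  qed
  then show ?thesis
    using sub_grp_centr[OF V'(2), of "{g}"] V'(1,3,4) unfolding normal_in_def centr_def by auto
qed

text \<open>Let \<open>g\<close> be central in \<open>F\<close> modulo \<open>S\<close>. Then \<open>v \<mapsto> [v, g]\<close> is a nilpotent \<open>F\<close>-endomorphism of \<open>V\<close>, so
  it suffices to treat its kernel, which has shorter centraliser chains if its index is infinite. If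
  no such kernel has infinite index, the centre of \<open>F/S\<close> almost centralises \<open>V\<close> and the length of the
  central series of \<open>F/S\<close> drops.\<close>

lemma abelian_normal_nil:
  fixes F :: "'a bijection set"
  assumes "tame F" "normal_in F V" "normal_in F S" "V \<subseteq> S"
    and "\<And>v s. v \<in> V \<Longrightarrow> s \<in> S \<Longrightarrow> comm v s = 0" and "F \<subseteq> ucs F F S c"
  shows "nil_over F V {0}"
  using assms
proof (induction c arbitrary: F V S)
  case (0 F V S)
  have "V \<subseteq> cent_mod F F {0}" using 0 normal_inD(3)[OF 0(2)] unfolding cent_mod_def by auto
  then have "V \<subseteq> ucs F F {0} 1" by (simp add: ucs_Suc)
  then show ?case unfolding nil_over_def by blast
next
  case (Suc c F V S)
  note IH = Suc.IH
  note tame = Suc.prems(1) and nS = Suc.prems(3)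
  have F: "fitting_group F" using Suc.prems(1) unfolding tame_def by auto
  obtain k d where kd: "conj_bounded F k d" using Suc.prems(1) word_bounded_conj unfolding tame_def by metis
  define R where "R = cent_mod F F S"
  note S' = normal_inD[OF Suc.prems(3)]
  note sF = S'(1)
  have nR: "normal_in F R" unfolding R_def by (rule normal_in_cent_mod[OF Suc.prems(3) normal_in_self[OF sF]])
  note R' = normal_inD[OF nR]
  have SR: "S \<subseteq> R" unfolding R_def by (rule cent_mod_upper[OF Suc.prems(3) order_refl])
  have FR: "F \<subseteq> ucs F F R c" using Suc.prems(6) unfolding R_def ucs_Suc' .
  define P :: "'a bijection set \<Rightarrow> 'a bijection \<Rightarrow> bool" where "P H y \<longleftrightarrow> infinite (orbit H y)" for H y
  \<comment> \<open>An inner induction on the length l of chains of centralisers in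
    \<open>V\<close>, with \<open>F\<close> and \<open>S\<close> fixed. The outer hypothesis on c
    enters only when no step of infinite index is left.\<close>
  have main: "nil_over F V {0}"
    if "normal_in F V" "V \<subseteq> S" "\<And>v s. v \<in> V \<Longrightarrow> s \<in> S \<Longrightarrow> comm v s = 0"
      "\<And>ys. length ys = l \<Longrightarrow> set ys \<subseteq> F \<Longrightarrow> \<not> cent_chain P V ys" for l V
    using that
  proof (induction l arbitrary: V)
    case (0 V)
    then show ?case by auto
  next
    case (Suc l V)
    note V' = normal_inD[OF Suc.prems(1)]
    show ?case
    proof (cases "\<exists>g\<in>R. infinite (orbit V g)")
      case True
      then obtain g where g: "g \<in> R" "infinite (orbit V g)" by auto
      have gF: "g \<in> F" using g R'(3) by auto
      define V1 where "V1 = centr V {g}"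
      have V1V: "V1 \<subseteq> V" unfolding V1_def centr_def by auto
      have nV1: "normal_in F V1"
        unfolding V1_def by (rule centr_single_normal[OF Suc.prems(1) nS Suc.prems(3)]) (use g R_def in auto)
      have "nil_over F V1 {0}"
      proof (rule Suc.IH[OF nV1])
        show "V1 \<subseteq> S" using V1V Suc.prems(2) by auto
        show "comm v s = 0" if "v \<in> V1" "s \<in> S" for v s using that V1V Suc.prems(3) by auto
        show "\<not> cent_chain P V1 ys" if "length ys = l" "set ys \<subseteq> F" for ys
          using Suc.prems(4)[of "g # ys"] that g(2) gF unfolding V1_def P_def by auto
      qed
      then obtain q where q: "V1 \<subseteq> ucs F F {0} q" unfolding nil_over_def by auto
      obtain N where N: "nil_act F N" "g \<in> N" using F gF unfolding fitting_group_def by auto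
      then obtain e where nN: "normal_in F N" "F \<subseteq> ucs F N {0} e" unfolding nil_act_def by auto
      note n0 = normal_in_zero[OF sF]
      \<comment> \<open>As g is central modulo \<open>S\<close> and \<open>V\<close> is abelian, the
        map v \<mapsto> [v, g] commutes with the action of \<open>F\<close>.\<close>
      have comm_swap: "comm (comm v f) g = comm (comm v g) f" if v: "v \<in> V" and f: "f \<in> F" for v f
      proof -
        let ?s = "- (f + g) + (g + f)"
        have "comm (- g) (- f) \<in> S"
          using g(1) sub_grp_minus[OF R'(2)] sub_grp_minus[OF sF] f unfolding R_def cent_mod_def by blast
        moreover have "comm (- g) (- f) = ?s" by (simp only: free_group_simps)
        ultimately have "?s \<in> S" by simp
        then have "comm v ?s = 0" using Suc.prems(3) v by blast
        then have "conjg ?s v = v" using comm_0_sym comm_0_iff by blast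
        then have eq: "conjg (f + g) v = conjg (g + f) v" by (simp only: conjg_eq_iff)
        have ab: "x + y = y + x" if "x \<in> V" "y \<in> V" for x y
        proof -
          have "comm x y = 0" using Suc.prems(2,3) that by blast
          then have "comm x y + (y + x) = y + x" by simp
          moreover have "comm x y + (y + x) = x + y" by (simp only: free_group_simps)
          ultimately show ?thesis by simp
        qed
        have cV: "conjg h v \<in> V" if "h \<in> F" for h using V'(4) that v by blast
        have mV: "- x \<in> V" if "x \<in> V" for x using sub_grp_minus[OF V'(2) that] .
        have "comm (comm v f) g = v + (- conjg f v + (conjg (g + f) v + - conjg g v))"
          by (simp only: free_group_simps)
        also have "- conjg f v + (conjg (g + f) v + - conjg g v) = (- conjg f v + conjg (g + f) v) + - conjg g v"
          by (simp only: add.assoc)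
        also have "\<dots> = - conjg g v + (- conjg f v + conjg (g + f) v)"
          by (rule ab) (use cV f gF mV sub_grp_add[OF V'(2)] sub_grp_add[OF sF] in blast)+
        also have "- conjg f v + conjg (g + f) v = conjg (g + f) v + - conjg f v"
          using ab cV f gF mV sub_grp_add[OF sF] by blast
        also have "v + (- conjg g v + (conjg (g + f) v + - conjg f v)) = comm (comm v g) f"
          unfolding eq[symmetric] by (simp only: free_group_simps)
        finally show ?thesis .
      qed
      \<comment> \<open>The kernel \<open>V1\<close> of v \<mapsto> [v, g] lies in the q-th term, so
        taking preimages under this map costs q terms.\<close>
      have pull: "v \<in> ucs F F {0} (n + q)" if "v \<in> V" "comm v g \<in> ucs F F {0} n" for v n
        using that
      proof (induction n arbitrary: v)
        case (0 v)
        then have "comm v g = 0" by simp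
        then have "v \<in> V1" unfolding V1_def centr_def using 0 comm_0_iff by blast
        then show ?case using q by auto
      next
        case (Suc n v)
        have "comm v f \<in> ucs F F {0} (n + q)" if f: "f \<in> F" for f
        proof (rule Suc.IH)
          show "comm v f \<in> V" using normal_in_comm(1)[OF \<open>normal_in F V\<close> Suc.prems(1) f] .
          show "comm (comm v f) g \<in> ucs F F {0} n"
            unfolding comm_swap[OF Suc.prems(1) f] using Suc.prems(2) f by (auto simp: ucs_Suc cent_mod_def)
        qed
        then show ?case using Suc.prems(1) V'(3) by (auto simp: ucs_Suc cent_mod_def)
      qed
      \<comment> \<open>g lies in an \<open>N\<close> that acts nilpotently in e steps, so that e
        applications of v \<mapsto> [v, g] reach 0.\<close>
      have "V \<inter> ucs F N {0} i \<subseteq> ucs F F {0} (i * q)" for i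
      proof (induction i)
        case (Suc i)
        show ?case
        proof
          fix v assume v: "v \<in> V \<inter> ucs F N {0} (Suc i)"
          then have "comm v g \<in> V \<inter> ucs F N {0} i"
            using N(2) normal_in_comm(1)[OF \<open>normal_in F V\<close> _ gF] by (auto simp: ucs_Suc cent_mod_def)
          then have "v \<in> ucs F F {0} (i * q + q)" using Suc pull v by blast
          then show "v \<in> ucs F F {0} (Suc i * q)" by (simp add: add.commute)
        qed
      qed auto
      then have "V \<subseteq> ucs F F {0} (e * q)" using V'(3) nN(2) by blast
      then show ?thesis unfolding nil_over_def by blast
    next
      case False
      then have fin: "\<And>g. g \<in> R \<Longrightarrow> finite (orbit V g)" by auto
      define V1 where "V1 = fin_orbits V R"
      \<comment> \<open>Modulo \<open>E\<close>, the subgroup \<open>V1\<close> of finite index in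
        \<open>V\<close> is centralised by \<open>R\<close> and not just by \<open>S\<close>, and
        above \<open>R\<close> the group \<open>F\<close> is nilpotent in one step fewer. Dividing
        out a kernel that contains \<open>E\<close> makes the outer hypothesis applicable.\<close>
      obtain E where E: "normal_in F V1" "fin_index V V1" "normal_in F E" "nil_over F E {0}" "R \<subseteq> cent_mod F V1 E"
        using almost_commuting[OF F kd nR Suc.prems(1) fin] unfolding V1_def by metis
      have V1V: "V1 \<subseteq> V" unfolding V1_def fin_orbits_def by auto
      obtain n where "E \<subseteq> ucs F F {0} n" using E(4) unfolding nil_over_def by auto
      then obtain \<pi> :: "'a bijection \<Rightarrow> 'a bijection" where \<pi>: "hom_on \<pi> F" "tame (\<pi> ` F)"
        "E \<subseteq> kernel_on \<pi> F" "nil_over F (kernel_on \<pi> F) {0}"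
        using tame_quotient_ucs[OF tame, of n] by blast
      have V1F: "V1 \<subseteq> F" using V1V V'(3) by auto
      have "nil_over (\<pi> ` F) (\<pi> ` V1) {0}"
      proof (rule IH[of "\<pi> ` F" "\<pi> ` V1" "\<pi> ` R", OF \<pi>(2) normal_in_image[OF \<pi>(1) E(1)] normal_in_image[OF \<pi>(1) nR]])
        show "\<pi> ` V1 \<subseteq> \<pi> ` R" using V1V Suc.prems(2) SR by blast
        show "\<pi> ` F \<subseteq> ucs (\<pi> ` F) (\<pi> ` F) (\<pi> ` R) c"
          using ucs_image[OF \<pi>(1) order_refl] FR by blast
        show "comm y z = 0" if yz: "y \<in> \<pi> ` V1" "z \<in> \<pi> ` R" for y z
        proof -
          obtain v r where vr: "v \<in> V1" "r \<in> R" "y = \<pi> v" "z = \<pi> r" using yz by blast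
          have "comm r v \<in> E" using E(5) vr(1,2) unfolding cent_mod_def by auto
          then have "\<pi> (comm r v) = 0" using \<pi>(3) unfolding kernel_on_def by auto
          moreover have "r \<in> F" "v \<in> F" using vr(1,2) V1F R'(3) by auto
          ultimately have "comm z y = 0" using hom_onD(6)[OF \<pi>(1)] vr(3,4) by simp
          then show ?thesis using comm_0_sym by blast
        qed
      qed
      then have "nil_over F V1 {y \<in> F. \<pi> y \<in> {0}}" by (rule nil_over_vimage[OF \<pi>(1) V1F])
      then have "nil_over F V1 {0}" using nil_over_trans \<pi>(4) unfolding kernel_on_def by auto
      then show ?thesis
        using nil_over_trans nil_over_fin_quotient[OF F Suc.prems(1) E(1,2)] by blast
    qed
  qed
  show ?case
  proof (rule main[OF Suc.prems(2,4,5)])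
    fix ys assume ys: "length ys = d" "set ys \<subseteq> F"
    \<comment> \<open>Infinite orbits have size at least k in the sense of \<open>big_orbit\<close>,
      so the general bound d starts the inner induction.\<close>
    have "cent_chain (big_orbit k) H ys" if "cent_chain P H ys" for H
      using that by (induction ys arbitrary: H) (auto simp: P_def big_orbit_def)
    then show "\<not> cent_chain P V ys"
      using conj_bounded_mono[OF kd normal_inD(2,3)[OF Suc.prems(2)] ys(2,1)] by blast
  qed auto
qed


theorem tame_nilpotent:
  fixes F :: "'a bijection set"
  assumes "tame F"
  shows "\<exists>c. F \<subseteq> ucs F F {0} c"
proof -
  have F: "fitting_group F" using assms unfolding tame_def by auto
  then have sF: "sub_grp F" unfolding fitting_group_def by auto
  obtain k d where kd: "conj_bounded F k d" using assms word_bounded_conj unfolding tame_def by metis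
  note nF = normal_in_self[OF sF] and n0 = normal_in_zero[OF sF]
  define Z where "Z = ucs F F {0}"
  have nZ: "normal_in F (Z j)" for j unfolding Z_def by (rule normal_in_ucs[OF n0 nF])
  have Z_mono: "Z i \<subseteq> Z j" if "i \<le> j" for i j unfolding Z_def by (rule ucs_increasing[OF n0 nF that])
  define Z\<omega> where "Z\<omega> = (\<Union>n. Z n)"
  have "x + y \<in> Z\<omega>" if xy: "x \<in> Z\<omega>" "y \<in> Z\<omega>" for x y
  proof -
    obtain i j where "x \<in> Z i" "y \<in> Z j" using xy unfolding Z\<omega>_def by auto
    then have "x \<in> Z (max i j)" "y \<in> Z (max i j)" using Z_mono max.cobounded1 max.cobounded2 by blast+
    then show ?thesis unfolding Z\<omega>_def using sub_grp_add[OF normal_inD(2)[OF nZ]] by blast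
  qed
  moreover have "- x \<in> Z\<omega>" if "x \<in> Z\<omega>" for x
    using that sub_grp_minus[OF normal_inD(2)[OF nZ]] unfolding Z\<omega>_def by blast
  moreover have "0 \<in> Z\<omega>" using sub_grp_0[OF normal_inD(2)[OF nZ]] unfolding Z\<omega>_def by blast
  ultimately have "sub_grp Z\<omega>" unfolding sub_grp_def by blast
  moreover have "conjg f x \<in> Z\<omega>" if "f \<in> F" "x \<in> Z\<omega>" for f x
    using that normal_inD(4)[OF nZ] unfolding Z\<omega>_def by blast
  moreover have "Z\<omega> \<subseteq> F" using normal_inD(3)[OF nZ] unfolding Z\<omega>_def by blast
  ultimately have n\<omega>: "normal_in F Z\<omega>" using sF unfolding normal_in_def by blast
  have \<omega>_nil: "B \<subseteq> Z\<omega>" if "nil_over F B {0}" for B using that unfolding nil_over_def Z\<omega>_def Z_def by blast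
  \<comment> \<open>A finite subset of \<open>Z\<omega>\<close> witnesses that orbits on
    \<open>Z\<omega>\<close> are small; being finite, it lies in a single \<open>Z m\<close>, which
    explains the choice of m.\<close>
  obtain ys where ys: "finite ys" "ys \<subseteq> Z\<omega>" "\<And>y. y \<in> Z\<omega> \<Longrightarrow> \<not> big_orbit k (centr F ys) y"
    using max_centr[OF kd sF order_refl normal_inD(3)[OF n\<omega>]] by metis
  have "\<exists>m. ys \<subseteq> Z m"
    using ys(1,2)
  proof (induction ys)
    case (insert y ys)
    then obtain m j where "ys \<subseteq> Z m" "y \<in> Z j" unfolding Z\<omega>_def by auto
    then have "insert y ys \<subseteq> Z (max m j)" using Z_mono[of m "max m j"] Z_mono[of j "max m j"] by auto
    then show ?case by blast
  qed auto
  then obtain m where m: "ys \<subseteq> Z m" by auto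
  define S0 where "S0 = centr F (Z m)"
  have nS0: "normal_in F S0" unfolding S0_def by (rule normal_in_centr[OF nZ])
  have nilS0: "nil_over F F S0" unfolding S0_def Z_def by (rule stability_group[OF sF])
  have fin: "finite (orbit S0 y)" if "y \<in> Z\<omega>" for y
  proof (rule finite_subset[OF orbit_mono])
    show "S0 \<subseteq> centr F ys" unfolding S0_def centr_def using m by auto
    show "finite (orbit (centr F ys) y)" using ys(3)[OF that] unfolding big_orbit_def by auto
  qed
  \<comment> \<open>Passing to a subgroup of finite index keeps \<open>F\<close> nilpotent above it;
    in return \<open>Z\<omega>\<close> and \<open>S\<close> commute modulo \<open>E\<close>.\<close>
  define S where "S = fin_orbits S0 Z\<omega>"
  obtain E where E: "normal_in F S" "fin_index S0 S" "normal_in F E" "nil_over F E {0}" "Z\<omega> \<subseteq> cent_mod F S E"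
    using almost_commuting[OF F kd n\<omega> nS0 fin] unfolding S_def by metis
  have nilS: "nil_over F F S"
    by (rule nil_over_trans[OF nilS0 nil_over_fin_quotient[OF F nS0 E(1,2)]])
  define V where "V = Z\<omega> \<inter> S"
  have nV: "normal_in F V" unfolding V_def by (rule normal_in_Int[OF n\<omega> E(1)])
  note V' = normal_inD[OF nV] and S' = normal_inD[OF E(1)]
  have "nil_over F V {0}"
  proof -
    obtain n where "E \<subseteq> ucs F F {0} n" using E(4) unfolding nil_over_def by auto
    then obtain \<pi> :: "'a bijection \<Rightarrow> 'a bijection" where \<pi>: "hom_on \<pi> F" "tame (\<pi> ` F)"
      "E \<subseteq> kernel_on \<pi> F" "nil_over F (kernel_on \<pi> F) {0}"
      using tame_quotient_ucs[OF assms, of n] by blast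
    obtain c where c: "F \<subseteq> ucs F F S c" using nilS unfolding nil_over_def by auto
    have "nil_over (\<pi> ` F) (\<pi> ` V) {0}"
    proof (rule abelian_normal_nil[OF \<pi>(2) normal_in_image[OF \<pi>(1) nV] normal_in_image[OF \<pi>(1) E(1)]])
      show "\<pi> ` V \<subseteq> \<pi> ` S" unfolding V_def by blast
      show "\<pi> ` F \<subseteq> ucs (\<pi> ` F) (\<pi> ` F) (\<pi> ` S) c" using ucs_image[OF \<pi>(1) order_refl] c by blast
      show "comm y z = 0" if yz: "y \<in> \<pi> ` V" "z \<in> \<pi> ` S" for y z
      proof -
        obtain v s where vs: "v \<in> V" "s \<in> S" "y = \<pi> v" "z = \<pi> s" using yz by blast
        have "comm v s \<in> E" using E(5) vs(1,2) unfolding cent_mod_def V_def by auto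
        then have "\<pi> (comm v s) = 0" using \<pi>(3) unfolding kernel_on_def by auto
        moreover have "v \<in> F" "s \<in> F" using vs(1,2) V'(3) S'(3) by auto
        ultimately show "comm y z = 0" using hom_onD(6)[OF \<pi>(1)] vs(3,4) by simp
      qed
    qed
    then have "nil_over F V {y \<in> F. \<pi> y \<in> {0}}" by (rule nil_over_vimage[OF \<pi>(1) V'(3)])
    then show ?thesis using nil_over_trans \<pi>(4) unfolding kernel_on_def by auto
  qed
  then obtain n where n: "V \<subseteq> ucs F F {0} n" unfolding nil_over_def by auto
  obtain \<pi> :: "'a bijection \<Rightarrow> 'a bijection" where \<pi>: "hom_on \<pi> F" "tame (\<pi> ` F)"
    "ucs F F {0} n \<subseteq> kernel_on \<pi> F" "nil_over F (kernel_on \<pi> F) {0}"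
    using tame_quotient_ucs[OF assms, of n] by blast
  have F': "fitting_group (\<pi> ` F)" using \<pi>(2) unfolding tame_def by auto
  obtain k' d' where kd': "conj_bounded (\<pi> ` F) k' d'" using \<pi>(2) word_bounded_conj unfolding tame_def by metis
  have "\<pi> ` S = {0}"
  proof (rule normal_meets_fc_centre[OF F' kd' normal_in_image[OF \<pi>(1) E(1)]])
    \<comment> \<open>The FC-centre of the image is hypercentral of finite level, and so is the
      kernel of \<open>\<pi>\<close>. Hence s lies in \<open>Z\<omega>\<close>, therefore in
      \<open>V\<close>, which \<open>\<pi>\<close> kills.\<close>
    have "y = 0" if y: "y \<in> \<pi> ` S" "y \<in> fc_centre (\<pi> ` F)" for y
    proof -
      obtain s where s: "s \<in> S" "y = \<pi> s" using y(1) by auto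
      have sF: "s \<in> F" using s S'(3) by auto
      have "nil_over (\<pi> ` F) {\<pi> s} {0}"
        by (rule nil_over_trans[OF nil_over_subset fc_centre_nil[OF F' kd']]) (use y s in auto)
      then have "nil_over F {s} {y \<in> F. \<pi> y \<in> {0}}"
        using nil_over_vimage[OF \<pi>(1), of "{s}" "{0}"] sF by simp
      then have "nil_over F {s} {0}" using nil_over_trans \<pi>(4) unfolding kernel_on_def by auto
      then have "s \<in> V" using \<omega>_nil s(1) unfolding V_def by blast
      then have "\<pi> s = 0" using n \<pi>(3) unfolding kernel_on_def by auto
      then show ?thesis using s(2) by simp
    qed
    moreover have "0 \<in> \<pi> ` S" using sub_grp_0[OF S'(2)] hom_onD(3)[OF \<pi>(1)] by (metis imageI)
    moreover have "0 \<in> fc_centre (\<pi> ` F)"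
      using sub_grp_0[OF normal_inD(2)[OF normal_in_fc_centre]] F' unfolding fitting_group_def by blast
    ultimately show "\<pi> ` S \<inter> fc_centre (\<pi> ` F) = {0}" by blast
  qed
  then have "S \<subseteq> kernel_on \<pi> F" unfolding kernel_on_def using S'(3) by auto
  then have "nil_over F F {0}" using nil_over_trans nil_over_subset nilS \<pi>(4) by metis
  then show ?thesis unfolding nil_over_def by auto
qed

subsection \<open>Substitution\<close>

fun tsub :: "(nat \<Rightarrow> nat) \<Rightarrow> ('f \<Rightarrow> 'g tm list \<Rightarrow> 'g tm) \<Rightarrow> 'f tm \<Rightarrow> 'g tm" where
  "tsub \<rho> h (Var i) = Var (\<rho> i)"
| "tsub \<rho> h (App f ts) = h f (map (tsub \<rho> h) ts)"

text \<open>Renames variables by \<open>\<rho>\<close> and rebuilds applications by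
  \<open>h\<close>. Bound variables become larger than \<open>B\<close> and than the variables in
  use, so that \<open>h\<close> may insert variables below \<open>B\<close> without capture. Pure
  renaming takes \<open>h = App\<close>; parameters are removed by an \<open>h\<close> that turns
  constants into variables.\<close>

fun fsub :: "(nat \<Rightarrow> nat) \<Rightarrow> ('f \<Rightarrow> 'g tm list \<Rightarrow> 'g tm) \<Rightarrow> nat \<Rightarrow> ('f, 'r) fm \<Rightarrow> ('g, 'r) fm" where
  "fsub \<rho> h B (Eq s t) = Eq (tsub \<rho> h s) (tsub \<rho> h t)"
| "fsub \<rho> h B (Rel R ts) = Rel R (map (tsub \<rho> h) ts)"
| "fsub \<rho> h B (Neg \<phi>) = Neg (fsub \<rho> h B \<phi>)"
| "fsub \<rho> h B (Conj \<phi> \<psi>) = Conj (fsub \<rho> h B \<phi>) (fsub \<rho> h B \<psi>)"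
| "fsub \<rho> h B (Ex i \<phi>) = (let k = Suc (Max (insert B (\<rho> ` fv \<phi>))) in Ex k (fsub (\<rho>(i := k)) h B \<phi>))"

lemma finite_fv_tm: "finite (fv_tm t)"
  by (induction t) auto

lemma finite_fv: "finite (fv \<phi>)"
  by (induction \<phi>) (auto simp: finite_fv_tm)

lemma tm_val_cong: "(\<And>i. i \<in> fv_tm t \<Longrightarrow> e i = e' i) \<Longrightarrow> tm_val M e t = tm_val M e' t"
proof (induction t)
  case (App f ts)
  have "map (tm_val M e) ts = map (tm_val M e') ts" using App by auto
  then show ?case by (simp only: tm_val.simps)
qed auto

lemma sat_cong: "(\<And>i. i \<in> fv \<phi> \<Longrightarrow> e i = e' i) \<Longrightarrow> sat M e \<phi> = sat M e' \<phi>"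
proof (induction \<phi> arbitrary: e e')
  case (Eq s t)
  then show ?case using tm_val_cong[of s e e' M] tm_val_cong[of t e e' M] by auto
next
  case (Rel R ts)
  have "map (tm_val M e) ts = map (tm_val M e') ts"
    using Rel by (auto intro!: tm_val_cong)
  then show ?case by (simp only: sat.simps)
next
  case (Neg \<phi>)
  have "sat M e \<phi> = sat M e' \<phi>" by (rule Neg.IH) (use Neg.prems in auto)
  then show ?case by simp
next
  case (Conj \<phi> \<psi>)
  have "sat M e \<phi> = sat M e' \<phi>" by (rule Conj.IH(1)) (use Conj.prems in auto)
  moreover have "sat M e \<psi> = sat M e' \<psi>" by (rule Conj.IH(2)) (use Conj.prems in auto)
  ultimately show ?case by simp
next
  case (Ex i \<phi>)
  have "sat M (e(i := a)) \<phi> = sat M (e'(i := a)) \<phi>" for a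
    by (rule Ex.IH) (use Ex.prems in auto)
  then show ?case by simp
qed

lemma tm_val_tsub:
  assumes h: "\<And>f ts. f \<in> funs La \<Longrightarrow> length ts = fun_arity La f \<Longrightarrow>
      tm_val Mb e (h f ts) = fun_int Ma f (map (tm_val Mb e) ts)"
  shows "wf_tm La t \<Longrightarrow> tm_val Mb e (tsub \<rho> h t) = tm_val Ma (\<lambda>i. e (\<rho> i)) t"
proof (induction t)
  case (App f ts)
  have "map (\<lambda>t. tm_val Mb e (tsub \<rho> h t)) ts = map (tm_val Ma (\<lambda>i. e (\<rho> i))) ts" using App by auto
  moreover have "tm_val Mb e (h f (map (tsub \<rho> h) ts)) = fun_int Ma f (map (\<lambda>t. tm_val Mb e (tsub \<rho> h t)) ts)"
    using App.prems h[of f "map (tsub \<rho> h) ts"] by (simp add: comp_def)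
  ultimately show ?case by (simp only: tsub.simps tm_val.simps)
qed auto

text \<open>Quantifiers alter the assignment, but only above \<open>B\<close>. The hypothesis on
  \<open>h\<close> therefore ranges over all assignments that agree with \<open>e0\<close> below
  \<open>B\<close>.\<close>

lemma sat_fsub:
  assumes M: "universe Ma = universe Mb" "rel_int Ma = rel_int Mb"
    and h: "\<And>e f ts. (\<And>i. i < B \<Longrightarrow> e i = e0 i) \<Longrightarrow> f \<in> funs La \<Longrightarrow> length ts = fun_arity La f \<Longrightarrow>
      tm_val Mb e (h f ts) = fun_int Ma f (map (tm_val Mb e) ts)"
  shows "wf_fm La \<phi> \<Longrightarrow> (\<And>i. i < B \<Longrightarrow> e i = e0 i) \<Longrightarrow>
    sat Mb e (fsub \<rho> h B \<phi>) = sat Ma (\<lambda>i. e (\<rho> i)) \<phi>"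
proof (induction \<phi> arbitrary: e \<rho>)
  case (Eq s t)
  have "tm_val Mb e (tsub \<rho> h t) = tm_val Ma (\<lambda>i. e (\<rho> i)) t" if "wf_tm La t" for t
    by (rule tm_val_tsub[where La = La, OF h[OF Eq.prems(2)] that])
  then show ?case using Eq.prems(1) by simp
next
  case (Rel R ts)
  have "tm_val Mb e (tsub \<rho> h t) = tm_val Ma (\<lambda>i. e (\<rho> i)) t" if "wf_tm La t" for t
    by (rule tm_val_tsub[where La = La, OF h[OF Rel.prems(2)] that])
  then have "map (tm_val Mb e) (map (tsub \<rho> h) ts) = map (tm_val Ma (\<lambda>i. e (\<rho> i))) ts"
    using Rel.prems(1) by auto
  then show ?case using M(2) by (simp only: fsub.simps sat.simps)
next
  case (Ex i \<phi>)
  define k where "k = Suc (Max (insert B (\<rho> ` fv \<phi>)))"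
  have fin: "finite (insert B (\<rho> ` fv \<phi>))" using finite_fv by auto
  have "B \<le> Max (insert B (\<rho> ` fv \<phi>))" by (rule Max_ge[OF fin]) auto
  then have kB: "k > B" unfolding k_def by simp
  have kf: "\<rho> j \<noteq> k" if "j \<in> fv \<phi>" for j
  proof -
    have "\<rho> j \<le> Max (insert B (\<rho> ` fv \<phi>))" by (rule Max_ge[OF fin]) (use that in auto)
    then show ?thesis unfolding k_def by simp
  qed
  have "sat Mb (e(k := a)) (fsub (\<rho>(i := k)) h B \<phi>) = sat Ma ((\<lambda>i. e (\<rho> i))(i := a)) \<phi>" for a
  proof -
    have "sat Mb (e(k := a)) (fsub (\<rho>(i := k)) h B \<phi>) = sat Ma (\<lambda>j. (e(k := a)) ((\<rho>(i := k)) j)) \<phi>"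
      by (rule Ex.IH) (use Ex.prems kB in auto)
    also have "\<dots> = sat Ma ((\<lambda>i. e (\<rho> i))(i := a)) \<phi>"
      by (rule sat_cong) (use kf in auto)
    finally show ?thesis .
  qed
  then show ?case using M(1) by (simp add: k_def[symmetric] Let_def)
qed auto

lemma wf_tm_tsub:
  assumes "\<And>f ts. f \<in> funs La \<Longrightarrow> length ts = fun_arity La f \<Longrightarrow> \<forall>t\<in>set ts. wf_tm Lb t \<Longrightarrow> wf_tm Lb (h f ts)"
  shows "wf_tm La t \<Longrightarrow> wf_tm Lb (tsub \<rho> h t)"
  by (induction t) (auto intro!: assms)

lemma wf_fm_fsub:
  assumes "\<And>f ts. f \<in> funs La \<Longrightarrow> length ts = fun_arity La f \<Longrightarrow> \<forall>t\<in>set ts. wf_tm Lb t \<Longrightarrow> wf_tm Lb (h f ts)"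
    and "rels La = rels Lb" "rel_arity La = rel_arity Lb"
  shows "wf_fm La \<phi> \<Longrightarrow> wf_fm Lb (fsub \<rho> h B \<phi>)"
proof (induction \<phi> arbitrary: \<rho>)
  case (Eq s t)
  have "wf_tm Lb (tsub \<rho> h u)" if "wf_tm La u" for u
    by (rule wf_tm_tsub[OF assms(1) that])
  then show ?case using Eq by (simp only: fsub.simps wf_fm.simps)
next
  case (Rel R ts)
  have "wf_tm Lb (tsub \<rho> h t)" if "t \<in> set ts" for t
    by (rule wf_tm_tsub[where La = La and Lb = Lb and h = h, OF assms(1)]) (use Rel that in auto)
  then show ?case using assms(2,3) Rel by simp
qed (simp_all add: Let_def)

lemma fv_tm_tsub:
  assumes "\<And>f ts. fv_tm (h f ts) \<subseteq> (\<Union>t\<in>set ts. fv_tm t) \<union> C"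
  shows "fv_tm (tsub \<rho> h t) \<subseteq> \<rho> ` fv_tm t \<union> C"
proof (induction t)
  case (App f ts)
  have "fv_tm (tsub \<rho> h (App f ts)) \<subseteq> (\<Union>t\<in>set ts. fv_tm (tsub \<rho> h t)) \<union> C"
    using assms[of f "map (tsub \<rho> h) ts"] by simp
  also have "\<dots> \<subseteq> (\<Union>t\<in>set ts. \<rho> ` fv_tm t \<union> C) \<union> C" using App by blast
  also have "\<dots> \<subseteq> \<rho> ` (\<Union>t\<in>set ts. fv_tm t) \<union> C" by blast
  finally show ?case by simp
qed auto

lemma fv_fsub:
  assumes "\<And>f ts. fv_tm (h f ts) \<subseteq> (\<Union>t\<in>set ts. fv_tm t) \<union> C"
  shows "fv (fsub \<rho> h B \<phi>) \<subseteq> \<rho> ` fv \<phi> \<union> C"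
proof (induction \<phi> arbitrary: \<rho>)
  case (Eq s t)
  then show ?case using fv_tm_tsub[OF assms] by fastforce
next
  case (Rel R ts)
  have "fv_tm (tsub \<rho> h t) \<subseteq> \<rho> ` fv_tm t \<union> C" for t by (rule fv_tm_tsub[OF assms])
  then show ?case by fastforce
next
  case (Conj \<phi> \<psi>)
  then show ?case by (simp add: image_Un) blast
next
  case (Ex i \<phi>)
  define k where "k = Suc (Max (insert B (\<rho> ` fv \<phi>)))"
  have "fv (fsub (\<rho>(i := k)) h B \<phi>) \<subseteq> (\<rho>(i := k)) ` fv \<phi> \<union> C" by (rule Ex.IH)
  then have "fv (fsub (\<rho>(i := k)) h B \<phi>) - {k} \<subseteq> \<rho> ` (fv \<phi> - {i}) \<union> C" by auto
  then show ?case by (simp add: k_def[symmetric] Let_def)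
qed auto


subsection \<open>Definable predicates on assignments\<close>

definition assign :: "('f, 'r, 'a) fo_structure \<Rightarrow> (nat \<Rightarrow> 'a) set" where
  "assign M = {e. range e \<subseteq> universe M}"

text \<open>Definability of a predicate on assignments, so that formulas need not be written out:
  the closure rules follow the shape of the predicate.\<close>

definition dfn :: "('f, 'r) fo_language \<Rightarrow> ('f, 'r, 'a) fo_structure \<Rightarrow> 'a set \<Rightarrow> ((nat \<Rightarrow> 'a) \<Rightarrow> bool) \<Rightarrow> bool" where
  "dfn L M A Q \<longleftrightarrow> (\<exists>\<phi>. wf_fm (with_params L A) \<phi> \<and> (\<forall>e\<in>assign M. sat (expand M) e \<phi> = Q e))"

lemma expand_simps [simp]:
  "universe (expand M) = universe M" "rel_int (expand M) = rel_int M"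
  "fun_int (expand M) (Inl f) = fun_int M f" "fun_int (expand M) (Inr a) xs = a"
  by (auto simp: expand_def)

lemma with_params_simps [simp]:
  "funs (with_params L A) = Inl ` funs L \<union> Inr ` A" "rels (with_params L A) = rels L"
  "fun_arity (with_params L A) (Inl f) = fun_arity L f" "fun_arity (with_params L A) (Inr a) = 0"
  "rel_arity (with_params L A) = rel_arity L"
  by (auto simp: with_params_def)

lemma assignD: "e \<in> assign M \<Longrightarrow> e i \<in> universe M"
  unfolding assign_def by auto

lemma wf_tm_mono: "wf_tm (with_params L A) t \<Longrightarrow> A \<subseteq> A' \<Longrightarrow> wf_tm (with_params L A') t"
proof (induction t)
  case (App f ts)
  then show ?case by (cases f) auto
qed auto

lemma wf_fm_mono: "wf_fm (with_params L A) \<phi> \<Longrightarrow> A \<subseteq> A' \<Longrightarrow> wf_fm (with_params L A') \<phi>"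
  by (induction \<phi>) (auto intro: wf_tm_mono)

lemma wf_tm_finite: "wf_tm (with_params L A) t \<Longrightarrow> \<exists>A0\<subseteq>A. finite A0 \<and> wf_tm (with_params L A0) t"
proof (induction t)
  case (App f ts)
  then have "\<forall>t\<in>set ts. \<exists>A0\<subseteq>A. finite A0 \<and> wf_tm (with_params L A0) t" by auto
  then obtain P where P: "\<And>t. t \<in> set ts \<Longrightarrow> P t \<subseteq> A \<and> finite (P t) \<and> wf_tm (with_params L (P t)) t" by metis
  define A0 where "A0 = (\<Union>t\<in>set ts. P t) \<union> (case f of Inl _ \<Rightarrow> {} | Inr a \<Rightarrow> {a})"
  have "wf_tm (with_params L A0) t" if "t \<in> set ts" for t
    by (rule wf_tm_mono[of L "P t"]) (use P that A0_def in auto)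
  then have "wf_tm (with_params L A0) (App f ts)"
    using App.prems by (cases f) (auto simp: A0_def)
  moreover have "finite A0" "A0 \<subseteq> A" unfolding A0_def using P App.prems by (auto split: sum.splits)
  ultimately show ?case by blast
qed auto

lemma wf_fm_finite: "wf_fm (with_params L A) \<phi> \<Longrightarrow> \<exists>A0\<subseteq>A. finite A0 \<and> wf_fm (with_params L A0) \<phi>"
proof (induction \<phi>)
  case (Eq s t)
  then obtain A1 A2 where "A1 \<subseteq> A" "finite A1" "wf_tm (with_params L A1) s"
    "A2 \<subseteq> A" "finite A2" "wf_tm (with_params L A2) t" using wf_tm_finite by (metis wf_fm.simps(1))
  then show ?case using wf_tm_mono[of L A1 s "A1 \<union> A2"] wf_tm_mono[of L A2 t "A1 \<union> A2"]
    by (intro exI[of _ "A1 \<union> A2"]) auto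
next
  case (Rel R ts)
  then have "\<forall>t\<in>set ts. \<exists>A0\<subseteq>A. finite A0 \<and> wf_tm (with_params L A0) t"
    using wf_tm_finite[of L A] by (simp only: wf_fm.simps) blast
  then obtain P where P: "\<And>t. t \<in> set ts \<Longrightarrow> P t \<subseteq> A \<and> finite (P t) \<and> wf_tm (with_params L (P t)) t" by metis
  have "wf_tm (with_params L (\<Union>t\<in>set ts. P t)) t" if "t \<in> set ts" for t
    by (rule wf_tm_mono[of L "P t"]) (use P that in auto)
  then show ?case using Rel P by (intro exI[of _ "\<Union>t\<in>set ts. P t"]) auto
next
  case (Conj \<phi> \<psi>)
  then obtain A1 A2 where "A1 \<subseteq> A" "finite A1" "wf_fm (with_params L A1) \<phi>"
    "A2 \<subseteq> A" "finite A2" "wf_fm (with_params L A2) \<psi>" by auto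
  then show ?case using wf_fm_mono[of L A1 \<phi> "A1 \<union> A2"] wf_fm_mono[of L A2 \<psi> "A1 \<union> A2"]
    by (intro exI[of _ "A1 \<union> A2"]) auto
qed auto

lemma dfn_mono: "dfn L M A Q \<Longrightarrow> A \<subseteq> A' \<Longrightarrow> dfn L M A' Q"
  unfolding dfn_def using wf_fm_mono by blast

lemma dfn_cong: "dfn L M A Q \<Longrightarrow> (\<And>e. e \<in> assign M \<Longrightarrow> Q e = Q' e) \<Longrightarrow> dfn L M A Q'"
  unfolding dfn_def by auto

lemma dfn_Neg: "dfn L M A Q \<Longrightarrow> dfn L M A (\<lambda>e. \<not> Q e)"
  unfolding dfn_def by (metis sat.simps(3) wf_fm.simps(3))

lemma dfn_Conj: "dfn L M A Q \<Longrightarrow> dfn L M A Q' \<Longrightarrow> dfn L M A (\<lambda>e. Q e \<and> Q' e)"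
  unfolding dfn_def by (metis sat.simps(4) wf_fm.simps(4))

lemma dfn_eq: "dfn L M A (\<lambda>e. e i = e j)"
  unfolding dfn_def by (rule exI[of _ "Eq (Var i) (Var j)"]) simp

lemma dfn_True: "dfn L M A (\<lambda>e. True)"
  using dfn_cong[OF dfn_eq[of L M A 0 0]] by simp

lemma dfn_const: "a \<in> A \<Longrightarrow> dfn L M A (\<lambda>e. e i = a)"
  unfolding dfn_def by (rule exI[of _ "Eq (Var i) (App (Inr a) [])"]) simp

lemma dfn_All: "finite I \<Longrightarrow> (\<And>i. i \<in> I \<Longrightarrow> dfn L M A (Q i)) \<Longrightarrow> dfn L M A (\<lambda>e. \<forall>i\<in>I. Q i e)"
proof (induction I rule: finite_induct)
  case empty
  then show ?case using dfn_True by simp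
next
  case (insert i I)
  then show ?case using dfn_Conj[of L M A "Q i" "\<lambda>e. \<forall>i\<in>I. Q i e"] by simp
qed

lemma sat_ren:
  assumes "wf_fm L \<phi>"
  shows "sat M e (fsub \<rho> App 0 \<phi>) = sat M (\<lambda>i. e (\<rho> i)) \<phi>"
  by (rule sat_fsub[where e0 = e and La = L]) (use assms in auto)

lemma wf_ren: "wf_fm L \<phi> \<Longrightarrow> wf_fm L (fsub \<rho> App B \<phi>)"
  by (rule wf_fm_fsub[where La = L]) auto

lemma fv_ren: "fv (fsub \<rho> App B \<phi>) \<subseteq> \<rho> ` fv \<phi>"
  using fv_fsub[of App "{}" \<rho> B \<phi>] by simp

lemma dfn_rename:
  assumes "dfn L M A Q"
  shows "dfn L M A (\<lambda>e. Q (\<lambda>i. e (\<rho> i)))"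
proof -
  obtain \<phi> where \<phi>: "wf_fm (with_params L A) \<phi>" "\<And>e. e \<in> assign M \<Longrightarrow> sat (expand M) e \<phi> = Q e"
    using assms unfolding dfn_def by auto
  have "(\<lambda>i. e (\<rho> i)) \<in> assign M" if "e \<in> assign M" for e using that unfolding assign_def by auto
  then have "sat (expand M) e (fsub \<rho> App 0 \<phi>) = Q (\<lambda>i. e (\<rho> i))" if "e \<in> assign M" for e
    using that \<phi>(2) by (simp add: sat_ren[OF \<phi>(1)])
  then show ?thesis unfolding dfn_def using wf_ren[OF \<phi>(1)] by blast
qed

fun exs :: "nat list \<Rightarrow> ('f, 'r) fm \<Rightarrow> ('f, 'r) fm" where
  "exs [] \<phi> = \<phi>"
| "exs (v # vs) \<phi> = Ex v (exs vs \<phi>)"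

lemma sat_exs:
  "sat M e (exs vs \<phi>) \<longleftrightarrow>
    (\<exists>e'. (\<forall>i. i \<notin> set vs \<longrightarrow> e' i = e i) \<and> (\<forall>i\<in>set vs. e' i \<in> universe M) \<and> sat M e' \<phi>)"
proof (induction vs arbitrary: e)
  case Nil
  have "(\<forall>i. e' i = e i) \<longleftrightarrow> e' = e" for e' by auto
  then show ?case by auto
next
  case (Cons v vs)
  show ?case
  proof
    assume "sat M e (exs (v # vs) \<phi>)"
    then obtain a e' where a: "a \<in> universe M" "\<And>i. i \<notin> set vs \<Longrightarrow> e' i = (e(v := a)) i"
      "\<forall>i\<in>set vs. e' i \<in> universe M" "sat M e' \<phi>" by (auto simp: Cons.IH)
    have "e' v \<in> universe M" using a(1,3) a(2)[of v] by (cases "v \<in> set vs") auto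
    moreover have "e' i = e i" if "i \<notin> set (v # vs)" for i using a(2)[of i] that by auto
    ultimately show "\<exists>e'. (\<forall>i. i \<notin> set (v # vs) \<longrightarrow> e' i = e i) \<and> (\<forall>i\<in>set (v # vs). e' i \<in> universe M) \<and> sat M e' \<phi>"
      using a(3,4) by (intro exI[of _ e']) auto
  next
    assume "\<exists>e'. (\<forall>i. i \<notin> set (v # vs) \<longrightarrow> e' i = e i) \<and> (\<forall>i\<in>set (v # vs). e' i \<in> universe M) \<and> sat M e' \<phi>"
    then obtain e' where e': "\<And>i. i \<notin> set (v # vs) \<Longrightarrow> e' i = e i" "\<forall>i\<in>set (v # vs). e' i \<in> universe M" "sat M e' \<phi>"
      by auto
    have "sat M (e(v := e' v)) (exs vs \<phi>)"
      unfolding Cons.IH by (rule exI[of _ e']) (use e' in auto)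
    then show "sat M e (exs (v # vs) \<phi>)" using e'(2) by auto
  qed
qed

lemma wf_exs [simp]: "wf_fm L (exs vs \<phi>) = wf_fm L \<phi>"
  by (induction vs) auto

lemma fv_exs [simp]: "fv (exs vs \<phi>) = fv \<phi> - set vs"
  by (induction vs) auto

lemma dfn_exs:
  assumes "dfn L M A Q"
  shows "dfn L M A (\<lambda>e. \<exists>e'\<in>assign M. (\<forall>i. i \<notin> set vs \<longrightarrow> e' i = e i) \<and> Q e')"
proof -
  obtain \<phi> where \<phi>: "wf_fm (with_params L A) \<phi>" "\<And>e. e \<in> assign M \<Longrightarrow> sat (expand M) e \<phi> = Q e"
    using assms unfolding dfn_def by auto
  have "sat (expand M) e (exs vs \<phi>) = (\<exists>e'\<in>assign M. (\<forall>i. i \<notin> set vs \<longrightarrow> e' i = e i) \<and> Q e')"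
    if e: "e \<in> assign M" for e
  proof -
    have "((\<forall>i. i \<notin> set vs \<longrightarrow> e' i = e i) \<and> (\<forall>i\<in>set vs. e' i \<in> universe M) \<and> sat (expand M) e' \<phi>) \<longleftrightarrow>
      (e' \<in> assign M \<and> (\<forall>i. i \<notin> set vs \<longrightarrow> e' i = e i) \<and> Q e')" for e'
    proof (cases "\<forall>i. i \<notin> set vs \<longrightarrow> e' i = e i")
      case True
      have "(\<forall>i\<in>set vs. e' i \<in> universe M) \<longleftrightarrow> e' \<in> assign M"
      proof
        assume *: "\<forall>i\<in>set vs. e' i \<in> universe M"
        have "e' i \<in> universe M" for i using * True assignD[OF e, of i] by (cases "i \<in> set vs") auto
        then show "e' \<in> assign M" unfolding assign_def by auto
      qed (auto simp: assignD)
      then show ?thesis using True \<phi>(2) by auto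
    qed auto
    then show ?thesis unfolding sat_exs by auto
  qed
  then show ?thesis unfolding dfn_def using \<phi>(1) by (intro exI[of _ "exs vs \<phi>"]) auto
qed

lemma dfn_support:
  assumes "dfn L M A Q"
  obtains m where "\<And>e e'. e \<in> assign M \<Longrightarrow> e' \<in> assign M \<Longrightarrow> (\<And>i. i < m \<Longrightarrow> e i = e' i) \<Longrightarrow> Q e = Q e'"
proof -
  obtain \<phi> where \<phi>: "wf_fm (with_params L A) \<phi>" "\<And>e. e \<in> assign M \<Longrightarrow> sat (expand M) e \<phi> = Q e"
    using assms unfolding dfn_def by auto
  obtain m where m: "\<forall>i\<in>fv \<phi>. i < m" using finite_fv finite_nat_set_iff_bounded by metis
  have "Q e = Q e'" if "e \<in> assign M" "e' \<in> assign M" "\<And>i. i < m \<Longrightarrow> e i = e' i" for e e'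
    using sat_cong[of \<phi> e e' "expand M"] that \<phi>(2) m by auto
  then show thesis using that by blast
qed


subsection \<open>Saturation in countably many variables\<close>

text \<open>One coordinate is added. The values \<open>es\<close> found so far become parameters;
  for each finite q, the existence of an assignment that extends \<open>es\<close> by b and
  satisfies q is a formula in the single variable b, so saturation provides a common b.\<close>

lemma saturated_step:
  assumes sat: "saturated \<kappa> L M" and A: "A \<subseteq> universe M"
    and es: "set es \<subseteq> universe M" and card: "|A \<union> set es| <o \<kappa>"
    and dfn: "\<And>Q. Q \<in> \<Q> \<Longrightarrow> dfn L M A Q"
    and fs: "\<And>q. finite q \<Longrightarrow> q \<subseteq> \<Q> \<Longrightarrow> \<exists>e\<in>assign M. (\<forall>j<length es. e j = es ! j) \<and> (\<forall>Q\<in>q. Q e)"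
  shows "\<exists>b\<in>universe M. \<forall>q. finite q \<and> q \<subseteq> \<Q> \<longrightarrow>
    (\<exists>e\<in>assign M. (\<forall>j<length (es @ [b]). e j = (es @ [b]) ! j) \<and> (\<forall>Q\<in>q. Q e))"
proof -
  define n where "n = length es"
  define A' where "A' = A \<union> set es"
  define good where "good q \<chi> \<longleftrightarrow> \<chi> \<in> formulas_in (with_params L A') 1 \<and>
    (\<forall>b\<in>universe M. holds (expand M) \<chi> [b] \<longleftrightarrow>
      (\<exists>e\<in>assign M. (\<forall>j<n. e j = es ! j) \<and> e n = b \<and> (\<forall>Q\<in>q. Q e)))" for q \<chi>
  have ex_good: "\<exists>\<chi>. good q \<chi>" if q: "finite q" "q \<subseteq> \<Q>" for q
  proof -
    have "dfn L M A' (\<lambda>e. (\<forall>j\<in>{..<n}. e j = es ! j) \<and> (\<forall>Q\<in>q. Q e))"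
      by (intro dfn_Conj dfn_All dfn_const q(1))
        (use dfn q(2) dfn_mono[of L M A _ A'] in \<open>auto simp: A'_def n_def\<close>)
    then obtain \<phi> where \<phi>: "wf_fm (with_params L A') \<phi>"
      "\<And>e. e \<in> assign M \<Longrightarrow> sat (expand M) e \<phi> = ((\<forall>j\<in>{..<n}. e j = es ! j) \<and> (\<forall>Q\<in>q. Q e))"
      unfolding dfn_def by auto
    obtain m where m: "\<forall>i\<in>insert n (fv \<phi>). i < m" using finite_fv finite_nat_set_iff_bounded by (metis finite_insert)
    \<comment> \<open>All variables move up by one to free \<open>Var 0\<close> for b, which is
      equated with the former n-th variable; everything else is quantified away.\<close>
    define \<chi> where "\<chi> = exs [1..<Suc m] (Conj (fsub Suc App 0 \<phi>) (Eq (Var (Suc n)) (Var 0)))"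
    have fv: "fv \<chi> \<subseteq> {0}"
    proof -
      have "fv (fsub Suc App 0 \<phi>) \<subseteq> Suc ` fv \<phi>" by (rule fv_ren)
      then have "fv (fsub Suc App 0 \<phi>) \<subseteq> {1..<Suc m}" using m by fastforce
      then show ?thesis unfolding \<chi>_def using m by auto
    qed
    have "wf_fm (with_params L A') \<chi>" unfolding \<chi>_def using wf_ren[OF \<phi>(1)] by simp
    then have "\<chi> \<in> formulas_in (with_params L A') 1" unfolding formulas_in_def formulas_def using fv by auto
    moreover have "holds (expand M) \<chi> [b] \<longleftrightarrow> (\<exists>e\<in>assign M. (\<forall>j<n. e j = es ! j) \<and> e n = b \<and> (\<forall>Q\<in>q. Q e))"
      if b: "b \<in> universe M" for b
    proof -
      have "holds (expand M) \<chi> [b] = sat (expand M) (\<lambda>_. b) \<chi>"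
        unfolding holds_def by (rule sat_cong) (use fv in auto)
      also have "\<dots> \<longleftrightarrow> (\<exists>e'. (\<forall>i. i \<notin> {1..<Suc m} \<longrightarrow> e' i = b) \<and> (\<forall>i\<in>{1..<Suc m}. e' i \<in> universe M) \<and>
          sat (expand M) (\<lambda>i. e' (Suc i)) \<phi> \<and> e' (Suc n) = e' 0)"
        unfolding \<chi>_def sat_exs
        by (simp only: set_upt sat.simps tm_val.simps sat_ren[OF \<phi>(1)] expand_simps)
      also have "\<dots> \<longleftrightarrow> (\<exists>e\<in>assign M. sat (expand M) e \<phi> \<and> e n = b)"
      proof
        assume "\<exists>e'. (\<forall>i. i \<notin> {1..<Suc m} \<longrightarrow> e' i = b) \<and> (\<forall>i\<in>{1..<Suc m}. e' i \<in> universe M) \<and>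
          sat (expand M) (\<lambda>i. e' (Suc i)) \<phi> \<and> e' (Suc n) = e' 0"
        then obtain e' where e': "\<forall>i. i \<notin> {1..<Suc m} \<longrightarrow> e' i = b" "\<forall>i\<in>{1..<Suc m}. e' i \<in> universe M"
          "sat (expand M) (\<lambda>i. e' (Suc i)) \<phi>" "e' (Suc n) = e' 0" by blast
        have "e' i \<in> universe M" for i using e'(1,2) b by (cases "i \<in> {1..<Suc m}") auto
        then have "(\<lambda>i. e' (Suc i)) \<in> assign M" unfolding assign_def by auto
        moreover have "e' (Suc n) = b" using e'(1,4) by auto
        ultimately show "\<exists>e\<in>assign M. sat (expand M) e \<phi> \<and> e n = b"
          using e'(3) by (intro bexI[of _ "\<lambda>i. e' (Suc i)"]) auto
      next
        assume "\<exists>e\<in>assign M. sat (expand M) e \<phi> \<and> e n = b"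
        then obtain e where e: "e \<in> assign M" "sat (expand M) e \<phi>" "e n = b" by auto
        define e' where "e' i = (if i \<in> {1..<Suc m} then e (i - 1) else b)" for i
        have "sat (expand M) (\<lambda>i. e' (Suc i)) \<phi> = sat (expand M) e \<phi>"
          by (rule sat_cong) (use m e'_def in auto)
        then show "\<exists>e'. (\<forall>i. i \<notin> {1..<Suc m} \<longrightarrow> e' i = b) \<and> (\<forall>i\<in>{1..<Suc m}. e' i \<in> universe M) \<and>
          sat (expand M) (\<lambda>i. e' (Suc i)) \<phi> \<and> e' (Suc n) = e' 0"
          using e m assignD[OF e(1)] by (intro exI[of _ e']) (auto simp: e'_def)
      qed
      also have "\<dots> \<longleftrightarrow> (\<exists>e\<in>assign M. (\<forall>j<n. e j = es ! j) \<and> e n = b \<and> (\<forall>Q\<in>q. Q e))"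
        using \<phi>(2) by auto
      finally show ?thesis .
    qed
    ultimately show ?thesis unfolding good_def by blast
  qed
  define \<chi> where "\<chi> q = (SOME \<chi>. good q \<chi>)" for q
  have good: "good q (\<chi> q)" if "finite q" "q \<subseteq> \<Q>" for q
    unfolding \<chi>_def by (rule someI_ex) (rule ex_good[OF that])
  have \<chi>: "\<chi> q \<in> formulas_in (with_params L A') 1" "b \<in> universe M \<Longrightarrow> holds (expand M) (\<chi> q) [b] \<longleftrightarrow>
      (\<exists>e\<in>assign M. (\<forall>j<n. e j = es ! j) \<and> e n = b \<and> (\<forall>Q\<in>q. Q e))" if "finite q" "q \<subseteq> \<Q>" for q b
    using good[OF that] unfolding good_def by blast+
  define p where "p = \<chi> ` {q. finite q \<and> q \<subseteq> \<Q>}"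
  have fsat: "\<exists>b\<in>universe M. \<forall>\<phi>\<in>r. holds (expand M) \<phi> [b]" if r: "finite r" "r \<subseteq> p" for r
  proof -
    obtain qs where qs: "finite qs" "qs \<subseteq> {q. finite q \<and> q \<subseteq> \<Q>}" "r = \<chi> ` qs"
      using finite_subset_image[OF r[unfolded p_def]] by auto
    \<comment> \<open>Finitely many of the formulas involve only finitely many predicates, which one
      assignment satisfies together; its n-th value is the b sought.\<close>
    obtain e where e: "e \<in> assign M" "\<forall>j<n. e j = es ! j" "\<forall>Q\<in>\<Union>qs. Q e"
      using fs[of "\<Union>qs"] qs unfolding n_def by auto
    have "holds (expand M) (\<chi> q) [e n]" if "q \<in> qs" for q
    proof -
      have q: "finite q" "q \<subseteq> \<Q>" using that qs(2) by auto
      show ?thesis unfolding \<chi>(2)[OF q assignD[OF e(1)]] using e that by blast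
    qed
    then show ?thesis unfolding qs(3) using assignD[OF e(1), of n] by blast
  qed
  have "A' \<subseteq> universe M \<and> |A'| <o \<kappa> \<and> p \<subseteq> formulas_in (with_params L A') 1 \<and>
    (\<forall>q. finite q \<and> q \<subseteq> p \<longrightarrow> (\<exists>b\<in>universe M. \<forall>\<phi>\<in>q. holds (expand M) \<phi> [b]))"
  proof (intro conjI allI impI)
    show "A' \<subseteq> universe M" "|A'| <o \<kappa>" unfolding A'_def using A es card by auto
    show "p \<subseteq> formulas_in (with_params L A') 1" unfolding p_def using \<chi>(1) by auto
  qed (use fsat in blast)
  from sat[unfolded saturated_def, THEN spec[of _ A'], THEN spec[of _ p], THEN mp, OF this]
  obtain b where b: "b \<in> universe M" "\<forall>\<phi>\<in>p. holds (expand M) \<phi> [b]" by blast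
  have "\<exists>e\<in>assign M. (\<forall>j<length (es @ [b]). e j = (es @ [b]) ! j) \<and> (\<forall>Q\<in>q. Q e)"
    if q: "finite q" "q \<subseteq> \<Q>" for q
  proof -
    have "holds (expand M) (\<chi> q) [b]" using b(2) q unfolding p_def by auto
    then obtain e where "e \<in> assign M" "\<forall>j<n. e j = es ! j" "e n = b" "\<forall>Q\<in>q. Q e"
      using \<chi>(2)[OF q b(1)] by auto
    then show ?thesis by (intro bexI[of _ e]) (auto simp: n_def nth_append less_Suc_eq)
  qed
  then show ?thesis using b(1) by blast
qed

text \<open>Coordinates are found one after the other while finite satisfiability is preserved. Each
  predicate depends on finitely many coordinates, so the limit satisfies it. A stage has only
  finitely many parameters besides \<open>A\<close>, which keeps their number below the infinite
  \<open>\<kappa>\<close>.\<close>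

lemma saturated_omega:
  assumes sat: "saturated \<kappa> L M" and \<kappa>: "Card_order \<kappa>" "natLeq \<le>o \<kappa>"
    and A: "A \<subseteq> universe M" "|A| <o \<kappa>"
    and dfn: "\<And>Q. Q \<in> \<Q> \<Longrightarrow> dfn L M A Q"
    and fs: "\<And>q. finite q \<Longrightarrow> q \<subseteq> \<Q> \<Longrightarrow> \<exists>e\<in>assign M. \<forall>Q\<in>q. Q e"
  shows "\<exists>e\<in>assign M. \<forall>Q\<in>\<Q>. Q e"
proof -
  have "natLeq \<le>o |Field \<kappa>|"
    by (rule ordLeq_ordIso_trans[OF \<kappa>(2) ordIso_symmetric[OF card_of_Field_ordIso[OF \<kappa>(1)]]])
  then have infk: "infinite (Field \<kappa>)" using infinite_iff_natLeq_ordLeq[of "Field \<kappa>"] by blast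
  have card: "|A \<union> set es| <o \<kappa>" for es
  proof (rule card_of_Un_ordLess_infinite_Field[OF infk \<kappa>(1) A(2)])
    show "|set es| <o \<kappa>"
      by (rule finite_ordLess_infinite[OF card_of_Well_order _ _ infk])
        (use \<kappa>(1) in \<open>auto simp: card_order_on_def Field_card_of\<close>)
  qed
  define fs' where "fs' es \<longleftrightarrow> set es \<subseteq> universe M \<and> (\<forall>q. finite q \<and> q \<subseteq> \<Q> \<longrightarrow>
    (\<exists>e\<in>assign M. (\<forall>j<length es. e j = es ! j) \<and> (\<forall>Q\<in>q. Q e)))" for es
  have "\<exists>f. \<forall>n. (fs' (f n) \<and> length (f n) = n) \<and> (\<exists>b. f (Suc n) = f n @ [b])"
  proof (rule dependent_nat_choice)
    show "\<exists>x. fs' x \<and> length x = 0" using fs unfolding fs'_def by auto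
    fix es n assume es: "fs' es \<and> length es = n"
    then have es2: "\<exists>e\<in>assign M. (\<forall>j<length es. e j = es ! j) \<and> (\<forall>Q\<in>q. Q e)" if "finite q" "q \<subseteq> \<Q>" for q
      using that unfolding fs'_def by blast
    have es1: "set es \<subseteq> universe M" using es unfolding fs'_def by blast
    have "\<exists>b\<in>universe M. \<forall>q. finite q \<and> q \<subseteq> \<Q> \<longrightarrow>
      (\<exists>e\<in>assign M. (\<forall>j<length (es @ [b]). e j = (es @ [b]) ! j) \<and> (\<forall>Q\<in>q. Q e))"
      by (rule saturated_step[OF sat A(1) es1 card]) (fact dfn, fact es2)
    then
    obtain b where "b \<in> universe M" "\<forall>q. finite q \<and> q \<subseteq> \<Q> \<longrightarrow>
      (\<exists>e\<in>assign M. (\<forall>j<length (es @ [b]). e j = (es @ [b]) ! j) \<and> (\<forall>Q\<in>q. Q e))"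
      by (rule bexE)
    then have "fs' (es @ [b])" using es1 unfolding fs'_def by simp
    then show "\<exists>y. (fs' y \<and> length y = Suc n) \<and> (\<exists>b. y = es @ [b])" using es by auto
  qed
  then obtain f where f: "\<And>n. fs' (f n)" "\<And>n. length (f n) = n" "\<And>n. \<exists>b. f (Suc n) = f n @ [b]" by metis
  define e where "e i = f (Suc i) ! i" for i
  have ef: "f n ! j = e j" if "j < n" for n j
    using that
  proof (induction n)
    case (Suc n)
    obtain b where b: "f (Suc n) = f n @ [b]" using f(3) by blast
    show ?case
    proof (cases "j = n")
      case False
      then have "j < n" using Suc.prems by simp
      then show ?thesis using Suc.IH b f(2) by (simp add: nth_append)
    qed (simp add: e_def)
  qed simp
  have "e i \<in> set (f (Suc i))" for i unfolding e_def using f(2)[of "Suc i"] by simp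
  then have eM: "e \<in> assign M" unfolding assign_def using f(1) unfolding fs'_def by blast
  have "Q e" if Q: "Q \<in> \<Q>" for Q
  proof -
    obtain m where m: "\<And>e e'. e \<in> assign M \<Longrightarrow> e' \<in> assign M \<Longrightarrow> (\<And>i. i < m \<Longrightarrow> e i = e' i) \<Longrightarrow> Q e = Q e'"
      using dfn_support[OF dfn[OF Q]] by metis
    obtain e' where "e' \<in> assign M" "\<forall>j<length (f m). e' j = f m ! j" "Q e'"
      using f(1)[of m] Q unfolding fs'_def by (metis empty_subsetI finite.emptyI finite_insert insert_subset singletonI)
    then show ?thesis using m[of e' e] eM f(2) ef by auto
  qed
  then show ?thesis using eM by blast
qed

subsection \<open>Blocks of variables\<close>

text \<open>Elements of the group are n-tuples: the v-th group variable is the v-th block of n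
  consecutive variables. For n = 0 all blocks are empty.\<close>

definition bidx :: "nat \<Rightarrow> nat \<Rightarrow> nat list" where
  "bidx n v = [v * n..<v * n + n]"

definition blk :: "nat \<Rightarrow> (nat \<Rightarrow> 'a) \<Rightarrow> nat \<Rightarrow> 'a list" where
  "blk n e v = map e (bidx n v)"

lemma length_bidx [simp]: "length (bidx n v) = n"
  by (simp add: bidx_def)

lemma blk_in_tuples: "e \<in> assign M \<Longrightarrow> blk n e v \<in> tuples M n"
  unfolding blk_def tuples_def assign_def by auto

lemma div_bidx: "i \<in> set (bidx n v) \<Longrightarrow> i div n = v"
proof -
  assume i: "i \<in> set (bidx n v)"
  then have "n > 0" by (cases n) (auto simp: bidx_def)
  moreover have "v * n \<le> i" "i < Suc v * n" using i by (auto simp: bidx_def)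
  ultimately show ?thesis by (metis div_nat_eqI mult.commute)
qed

lemma nth_blk: "j < n \<Longrightarrow> blk n e v ! j = e (v * n + j)"
  unfolding blk_def bidx_def by simp

lemma length_blk [simp]: "length (blk n e v) = n"
  unfolding blk_def by simp

lemma blk_eqI: "length t = n \<Longrightarrow> (\<And>j. j < n \<Longrightarrow> e (v * n + j) = t ! j) \<Longrightarrow> blk n e v = t"
  by (rule nth_equalityI) (auto simp: nth_blk length_blk)

lemma assign_of_blocks:
  assumes "\<And>v. val v \<in> tuples M n" "universe M \<noteq> {}"
  shows "\<exists>e\<in>assign M. \<forall>v. blk n e v = val v"
proof -
  obtain u where u: "u \<in> universe M" using assms(2) by auto
  define e where "e i = (if n = 0 then u else val (i div n) ! (i mod n))" for i
  have "e i \<in> universe M" for i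
  proof (cases "n = 0")
    case False
    then have "i mod n < length (val (i div n))" using assms(1)[of "i div n"] by (simp add: tuples_def)
    then have "val (i div n) ! (i mod n) \<in> set (val (i div n))" by (rule nth_mem)
    then show ?thesis using False assms(1)[of "i div n"] unfolding e_def tuples_def by auto
  qed (use u e_def in auto)
  then have "e \<in> assign M" unfolding assign_def by auto
  moreover have "blk n e v = val v" for v
    by (rule blk_eqI) (use assms(1)[of v] in \<open>auto simp: tuples_def e_def\<close>)
  ultimately show ?thesis by blast
qed

lemma map_blocks: "map e [0..<q * n] = concat (map (blk n e) [0..<q])"
proof (induction q)
  case (Suc q)
  have "[0..<Suc q * n] = [0..<q * n] @ [q * n..<q * n + n]"
    using upt_add_eq_append[of 0 "q * n" n] by (simp add: add.commute)
  then show ?case using Suc by (simp add: blk_def bidx_def)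
qed auto

text \<open>As \<open>definable\<close>, but with the parameters confined to \<open>A\<close>, since
  saturation requires their number to be controlled.\<close>

definition dfn_set :: "('f, 'r) fo_language \<Rightarrow> ('f, 'r, 'a) fo_structure \<Rightarrow> 'a set \<Rightarrow> nat \<Rightarrow> 'a list set \<Rightarrow> bool" where
  "dfn_set L M A N D \<longleftrightarrow> (\<exists>\<phi>\<in>formulas_in (with_params L A) N. D = {b \<in> tuples M N. holds (expand M) \<phi> b})"

lemma dfn_set_mono: "dfn_set L M A N D \<Longrightarrow> A \<subseteq> A' \<Longrightarrow> dfn_set L M A' N D"
  unfolding dfn_set_def formulas_in_def formulas_def using wf_fm_mono by blast

lemma definable_finite:
  assumes "definable L M N D"
  shows "\<exists>A. finite A \<and> A \<subseteq> universe M \<and> dfn_set L M A N D"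
proof -
  obtain \<phi> where \<phi>: "\<phi> \<in> formulas_in (with_params L (universe M)) N" "D = {b \<in> tuples M N. holds (expand M) \<phi> b}"
    using assms unfolding definable_def by auto
  then obtain A where "A \<subseteq> universe M" "finite A" "wf_fm (with_params L A) \<phi>"
    using wf_fm_finite[of L "universe M" \<phi>] unfolding formulas_in_def formulas_def by auto
  then show ?thesis using \<phi> unfolding dfn_set_def formulas_in_def formulas_def by blast
qed

lemma dfn_mem:
  assumes "dfn_set L M A N D" "length idx = N"
  shows "dfn L M A (\<lambda>e. map e idx \<in> D)"
proof -
  obtain \<phi> where \<phi>: "wf_fm (with_params L A) \<phi>" "fv \<phi> \<subseteq> {..<N}" "D = {b \<in> tuples M N. holds (expand M) \<phi> b}"
    using assms(1) unfolding dfn_set_def formulas_in_def formulas_def by auto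
  have "dfn L M A (\<lambda>e. sat (expand M) e \<phi>)" unfolding dfn_def using \<phi>(1) by blast
  then have "dfn L M A (\<lambda>e. sat (expand M) (\<lambda>i. e (idx ! i)) \<phi>)" by (rule dfn_rename)
  then show ?thesis
  proof (rule dfn_cong)
    fix e assume e: "e \<in> assign M"
    have "map e idx \<in> tuples M N" using e assms(2) unfolding tuples_def assign_def by auto
    moreover have "holds (expand M) \<phi> (map e idx) = sat (expand M) (\<lambda>i. e (idx ! i)) \<phi>"
      unfolding holds_def by (rule sat_cong) (use \<phi>(2) assms(2) in auto)
    ultimately show "sat (expand M) (\<lambda>i. e (idx ! i)) \<phi> = (map e idx \<in> D)" unfolding \<phi>(3) by blast
  qed
qed

definition blk_upd :: "nat \<Rightarrow> nat \<Rightarrow> 'a list \<Rightarrow> (nat \<Rightarrow> 'a) \<Rightarrow> nat \<Rightarrow> 'a" where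
  "blk_upd n v t e = (\<lambda>i. if i \<in> set (bidx n v) then t ! (i - v * n) else e i)"

lemma blk_upd_same: "length t = n \<Longrightarrow> blk n (blk_upd n v t e) v = t"
  by (rule blk_eqI) (auto simp: blk_upd_def bidx_def)

lemma blk_upd_other: "v' \<noteq> v \<Longrightarrow> blk n (blk_upd n v t e) v' = blk n e v'"
  unfolding blk_def by (rule map_cong[OF refl]) (auto simp: blk_upd_def dest: div_bidx)

lemma blk_upd_assign: "e \<in> assign M \<Longrightarrow> t \<in> tuples M n \<Longrightarrow> blk_upd n v t e \<in> assign M"
  unfolding assign_def blk_upd_def tuples_def bidx_def by (force simp: subset_iff)

lemma dfn_ex_blk:
  assumes "dfn L M A Q"
  shows "dfn L M A (\<lambda>e. \<exists>t\<in>tuples M n. Q (blk_upd n v t e))"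
proof (rule dfn_cong[OF dfn_exs[OF assms, of "bidx n v"]])
  fix e assume e: "e \<in> assign M"
  show "(\<exists>e'\<in>assign M. (\<forall>i. i \<notin> set (bidx n v) \<longrightarrow> e' i = e i) \<and> Q e') = (\<exists>t\<in>tuples M n. Q (blk_upd n v t e))"
  proof
    assume "\<exists>e'\<in>assign M. (\<forall>i. i \<notin> set (bidx n v) \<longrightarrow> e' i = e i) \<and> Q e'"
    then obtain e' where e': "e' \<in> assign M" "\<forall>i. i \<notin> set (bidx n v) \<longrightarrow> e' i = e i" "Q e'" by auto
    have "blk_upd n v (blk n e' v) e = e'"
    proof
      fix i show "blk_upd n v (blk n e' v) e i = e' i"
      proof (cases "i \<in> set (bidx n v)")
        case True
        then have "i - v * n < n" "v * n + (i - v * n) = i" by (auto simp: bidx_def)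
        then show ?thesis using True nth_blk[of "i - v * n" n e' v] by (simp add: blk_upd_def)
      qed (use e'(2) in \<open>auto simp: blk_upd_def\<close>)
    qed
    then show "\<exists>t\<in>tuples M n. Q (blk_upd n v t e)"
      using e'(3) blk_in_tuples[OF e'(1)] by (intro bexI[of _ "blk n e' v"]) auto
  next
    assume "\<exists>t\<in>tuples M n. Q (blk_upd n v t e)"
    then obtain t where "t \<in> tuples M n" "Q (blk_upd n v t e)" by auto
    then show "\<exists>e'\<in>assign M. (\<forall>i. i \<notin> set (bidx n v) \<longrightarrow> e' i = e i) \<and> Q e'"
      using blk_upd_assign[OF e] by (intro bexI[of _ "blk_upd n v t e"]) (auto simp: blk_upd_def)
  qed
qed

lemma dfn_blk_eq: "dfn L M A (\<lambda>e. blk n e v = blk n e w)"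
proof (rule dfn_cong)
  show "dfn L M A (\<lambda>e. \<forall>j\<in>{..<n}. e (v * n + j) = e (w * n + j))" by (intro dfn_All dfn_eq) simp
  fix e :: "nat \<Rightarrow> 'c"
  have "blk n e v = blk n e w \<longleftrightarrow> (\<forall>j<n. blk n e v ! j = blk n e w ! j)"
    by (subst list_eq_iff_nth_eq) (auto simp: blk_def)
  then show "(\<forall>j\<in>{..<n}. e (v * n + j) = e (w * n + j)) = (blk n e v = blk n e w)"
    by (auto simp: nth_blk)
qed

lemma dfn_blk_const:
  fixes t :: "'a list"
  assumes "set t \<subseteq> A" "length t = n"
  shows "dfn L M A (\<lambda>e. blk n e v = t)"
proof (rule dfn_cong)
  show "dfn L M A (\<lambda>e. \<forall>j\<in>{..<n}. e (v * n + j) = t ! j)"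
    by (intro dfn_All dfn_const) (use assms in auto)
  fix e :: "nat \<Rightarrow> 'a"
  have "blk n e v = t \<longleftrightarrow> (\<forall>j<n. blk n e v ! j = t ! j)"
    by (subst list_eq_iff_nth_eq) (use assms(2) in \<open>auto simp: blk_def\<close>)
  then show "(\<forall>j\<in>{..<n}. e (v * n + j) = t ! j) = (blk n e v = t)"
    by (auto simp: nth_blk)
qed

lemma dfn_blk_mem: "dfn_set L M A n D \<Longrightarrow> dfn L M A (\<lambda>e. blk n e v \<in> D)"
  unfolding blk_def by (rule dfn_mem) auto

lemma dfn_blk_mem3: "dfn_set L M A (3 * n) D \<Longrightarrow> dfn L M A (\<lambda>e. blk n e u @ blk n e v @ blk n e w \<in> D)"
  unfolding blk_def map_append[symmetric] by (rule dfn_mem[where N = "3 * n"]) auto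


subsection \<open>Removing parameters\<close>

text \<open>The tree property speaks of formulas of \<open>L\<close>, with all parameters in the
  tuples of the tree. The finitely many parameters that occur are listed in ps and read from the
  variables from K on. The formula may itself mention such variables; they are first quantified
  away, which is harmless as \<open>Q\<close> depends on the first K only.\<close>

lemma dfn_without_params:
  assumes "dfn L M A Q" "A \<subseteq> universe M" "universe M \<noteq> {}"
    and dep: "\<And>e e'. e \<in> assign M \<Longrightarrow> e' \<in> assign M \<Longrightarrow> (\<And>i. i < K \<Longrightarrow> e i = e' i) \<Longrightarrow> Q e = Q e'"
  shows "\<exists>\<phi> ps. set ps \<subseteq> universe M \<and> \<phi> \<in> formulas_in L (K + length ps) \<and>
    (\<forall>e\<in>assign M. holds M \<phi> (map e [0..<K] @ ps) = Q e)"
proof -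
  obtain \<phi> where \<phi>: "wf_fm (with_params L A) \<phi>" "\<And>e. e \<in> assign M \<Longrightarrow> sat (expand M) e \<phi> = Q e"
    using assms(1) unfolding dfn_def by auto
  obtain A0 where A0: "A0 \<subseteq> A" "finite A0" "wf_fm (with_params L A0) \<phi>" using wf_fm_finite[OF \<phi>(1)] by auto
  obtain u where u: "u \<in> universe M" using assms(3) by auto
  \<comment> \<open>Adding u makes the list nonempty, so that variable K, the default for constants
    outside \<open>A0\<close>, stays below \<open>B\<close>.\<close>
  obtain ps where ps: "set ps = insert u A0" using finite_list[of "insert u A0"] A0(2) by auto
  then have ps0: "length ps > 0" by auto
  obtain vs where vs: "set vs = fv \<phi> - {..<K}" using finite_list[of "fv \<phi> - {..<K}"] finite_fv by auto
  define \<psi> where "\<psi> = exs vs \<phi>"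
  have \<psi>: "wf_fm (with_params L A0) \<psi>" "fv \<psi> \<subseteq> {..<K}" unfolding \<psi>_def using A0(3) vs by auto
  have sat\<psi>: "sat (expand M) e \<psi> = Q e" if e: "e \<in> assign M" for e
  proof
    assume "sat (expand M) e \<psi>"
    then obtain e' where e': "\<And>i. i \<notin> set vs \<Longrightarrow> e' i = e i" "\<forall>i\<in>set vs. e' i \<in> universe M" "sat (expand M) e' \<phi>"
      unfolding \<psi>_def sat_exs by auto
    have "e' i \<in> universe M" for i using e'(1,2) assignD[OF e, of i] by (cases "i \<in> set vs") auto
    then have "e' \<in> assign M" unfolding assign_def by auto
    moreover have "e' i = e i" if "i < K" for i using e'(1)[of i] vs that by auto
    ultimately show "Q e" using dep[of e' e] e e'(3) \<phi>(2) by auto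
  next
    assume "Q e"
    then show "sat (expand M) e \<psi>" unfolding \<psi>_def sat_exs
      using \<phi>(2)[OF e] assignD[OF e] by (intro exI[of _ e]) auto
  qed
  define c where "c a = K + (LEAST j. j < length ps \<and> ps ! j = a)" for a
  have c: "c a < K + length ps" "(K \<le> c a)" "ps ! (c a - K) = a" if "a \<in> A0" for a
  proof -
    have "\<exists>j. j < length ps \<and> ps ! j = a" using that ps by (metis in_set_conv_nth insertI2)
    then have "(LEAST j. j < length ps \<and> ps ! j = a) < length ps \<and> ps ! (LEAST j. j < length ps \<and> ps ! j = a) = a"
      by (rule LeastI_ex)
    then show "c a < K + length ps" "(K \<le> c a)" "ps ! (c a - K) = a" unfolding c_def by auto
  qed
  define h :: "'a + 'c \<Rightarrow> 'a tm list \<Rightarrow> 'a tm" where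
    "h f ts = (case f of Inl g \<Rightarrow> App g ts | Inr a \<Rightarrow> Var (if a \<in> A0 then c a else K))" for f ts
  define B where "B = K + length ps"
  define \<chi> where "\<chi> = fsub id h B \<psi>"
  have wf: "wf_fm L \<chi>" unfolding \<chi>_def
    by (rule wf_fm_fsub[where La = "with_params L A0"]) (use \<psi>(1) in \<open>auto simp: h_def\<close>)
  have "fv_tm (h f ts) \<subseteq> (\<Union>t\<in>set ts. fv_tm t) \<union> {..<B}" for f ts
    unfolding h_def B_def using c ps0 by (auto split: sum.split)
  then have "fv \<chi> \<subseteq> id ` fv \<psi> \<union> {..<B}" unfolding \<chi>_def by (rule fv_fsub)
  then have "\<chi> \<in> formulas_in L (K + length ps)"
    using wf \<psi>(2) unfolding formulas_in_def formulas_def B_def by auto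
  moreover have "holds M \<chi> (map e [0..<K] @ ps) = Q e" if e: "e \<in> assign M" for e
  proof -
    define e0 where "e0 i = (map e [0..<K] @ ps) ! i" for i
    have "sat M e0 \<chi> = sat (expand M) (\<lambda>i. e0 (id i)) \<psi>"
      unfolding \<chi>_def
    proof (rule sat_fsub[where La = "with_params L A0" and ?e0.0 = e0])
      fix e' f ts assume e': "\<And>i. i < B \<Longrightarrow> e' i = e0 i" and f: "f \<in> funs (with_params L A0)"
      show "tm_val M e' (h f ts) = fun_int (expand M) f (map (tm_val M e') ts)"
      proof (cases f)
        case (Inr a)
        then have a: "a \<in> A0" using f by auto
        have "e' (c a) = a" using e' c[OF a] unfolding B_def e0_def by (simp add: nth_append)
        then show ?thesis using Inr a by (simp add: h_def)
      qed (simp add: h_def)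
    qed (use \<psi>(1) in auto)
    also have "\<dots> = sat (expand M) e \<psi>"
      by (rule sat_cong) (use \<psi>(2) in \<open>auto simp: e0_def nth_append\<close>)
    finally show ?thesis using sat\<psi>[OF e] unfolding holds_def e0_def by simp
  qed
  moreover have "set ps \<subseteq> universe M" using ps u A0(1) assms(2) by auto
  ultimately show ?thesis by blast
qed


subsection \<open>Labelled trees\<close>

text \<open>Unfolds the recursive notion into two functions on sequences: \<open>xs\<close> realises
  full branches, and \<open>cs\<close> gives the value at a node, common to all branches through it.
  The root carries no label.\<close>

lemma tree_labels:
  assumes "tree f k ys X"
  shows "\<exists>xs cs. (\<forall>s. length s = length ys \<and> set s \<subseteq> {..<k} \<longrightarrow>
      xs s \<in> X \<and> (\<forall>i<length ys. f (xs s) (ys ! i) = cs (take (Suc i) s))) \<and>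
    (\<forall>s i j. length s < length ys \<and> set s \<subseteq> {..<k} \<and> i < k \<and> j < k \<and> i \<noteq> j \<longrightarrow> cs (s @ [i]) \<noteq> cs (s @ [j]))"
  using assms
proof (induction ys arbitrary: X)
  case Nil
  then obtain x where "x \<in> X" by auto
  then show ?case by (intro exI[of _ "\<lambda>_. x"]) auto
next
  case (Cons y ys)
  then obtain C where C: "finite C" "card C = k" "\<forall>c\<in>C. tree f k ys {x \<in> X. f x y = c}" by auto
  obtain b where b: "bij_betw b {..<k} C" using ex_bij_betw_nat_finite[OF C(1)] C(2) by (metis atLeast0LessThan)
  have "\<forall>i\<in>{..<k}. \<exists>p. (\<forall>s. length s = length ys \<and> set s \<subseteq> {..<k} \<longrightarrow>
      fst p s \<in> X \<and> f (fst p s) y = b i \<and> (\<forall>j<length ys. f (fst p s) (ys ! j) = snd p (take (Suc j) s))) \<and>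
    (\<forall>s i j. length s < length ys \<and> set s \<subseteq> {..<k} \<and> i < k \<and> j < k \<and> i \<noteq> j \<longrightarrow> snd p (s @ [i]) \<noteq> snd p (s @ [j]))"
  proof
    fix i assume "i \<in> {..<k}"
    then have "b i \<in> C" using b bij_betwE by blast
    then obtain xs cs where "(\<forall>s. length s = length ys \<and> set s \<subseteq> {..<k} \<longrightarrow>
      xs s \<in> {x \<in> X. f x y = b i} \<and> (\<forall>j<length ys. f (xs s) (ys ! j) = cs (take (Suc j) s)))"
      "(\<forall>s i j. length s < length ys \<and> set s \<subseteq> {..<k} \<and> i < k \<and> j < k \<and> i \<noteq> j \<longrightarrow> cs (s @ [i]) \<noteq> cs (s @ [j]))"
      using Cons.IH[OF C(3)[rule_format, OF \<open>b i \<in> C\<close>]] by blast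
    then show "\<exists>p. (\<forall>s. length s = length ys \<and> set s \<subseteq> {..<k} \<longrightarrow>
      fst p s \<in> X \<and> f (fst p s) y = b i \<and> (\<forall>j<length ys. f (fst p s) (ys ! j) = snd p (take (Suc j) s))) \<and>
    (\<forall>s i j. length s < length ys \<and> set s \<subseteq> {..<k} \<and> i < k \<and> j < k \<and> i \<noteq> j \<longrightarrow> snd p (s @ [i]) \<noteq> snd p (s @ [j]))"
      by (intro exI[of _ "(xs, cs)"]) simp
  qed
  from bchoice[OF this] obtain p where p: "\<And>i s. i < k \<Longrightarrow> length s = length ys \<Longrightarrow> set s \<subseteq> {..<k} \<Longrightarrow>
      fst (p i) s \<in> X \<and> f (fst (p i) s) y = b i \<and> (\<forall>j<length ys. f (fst (p i) s) (ys ! j) = snd (p i) (take (Suc j) s))"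
    "\<And>m s i j. m < k \<Longrightarrow> length s < length ys \<Longrightarrow> set s \<subseteq> {..<k} \<Longrightarrow> i < k \<Longrightarrow> j < k \<Longrightarrow> i \<noteq> j \<Longrightarrow>
      snd (p m) (s @ [i]) \<noteq> snd (p m) (s @ [j])" by fastforce
  define xs where "xs s = fst (p (hd s)) (tl s)" for s
  \<comment> \<open>Nodes of length 1 are labelled by the first level; for longer ones the head
    selects the subtree.\<close>
  define cs where "cs s = (if length s = 1 then b (hd s) else snd (p (hd s)) (tl s))" for s
  have "xs s \<in> X \<and> (\<forall>i<length (y # ys). f (xs s) ((y # ys) ! i) = cs (take (Suc i) s))"
    if s: "length s = length (y # ys)" "set s \<subseteq> {..<k}" for s
  proof -
    obtain m t where mt: "s = m # t" using s(1) by (cases s) auto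
    then have mt': "m < k" "length t = length ys" "set t \<subseteq> {..<k}" using s by auto
    have "f (xs s) ((y # ys) ! i) = cs (take (Suc i) s)" if i: "i < length (y # ys)" for i
    proof (cases i)
      case 0
      then show ?thesis using p(1)[OF mt'] mt by (simp add: xs_def cs_def)
    next
      case (Suc j)
      then have "j < length ys" using i by simp
      then have "t \<noteq> []" using mt'(2) by auto
      then have "cs (take (Suc i) s) = snd (p m) (take (Suc j) t)"
        unfolding cs_def mt Suc by (cases t) auto
      moreover have "f (xs s) (ys ! j) = snd (p m) (take (Suc j) t)"
        using p(1)[OF mt'] \<open>j < length ys\<close> mt by (simp add: xs_def)
      ultimately show ?thesis using Suc by simp
    qed
    then show ?thesis using p(1)[OF mt'] mt by (simp add: xs_def)
  qed
  moreover have "cs (s @ [i]) \<noteq> cs (s @ [j])"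
    if s: "length s < length (y # ys)" "set s \<subseteq> {..<k}" "i < k" "j < k" "i \<noteq> j" for s i j
  proof (cases s)
    case Nil
    then show ?thesis using b s(3-5) unfolding cs_def bij_betw_def inj_on_def by auto
  next
    case (Cons m t)
    then show ?thesis using p(2)[of m t i j] s by (simp add: cs_def)
  qed
  ultimately show ?case by blast
qed

section \<open>Type-definable groups: compactness and definable word values\<close>

text \<open>Collects what model theory has to supply, with \<open>\<kappa>\<close> eliminated: one
  parameter set \<open>A\<close> serves \<open>\<D>\<close>, \<open>P\<close> and the entries of the
  unit, and saturation appears as realisation in countably many variables over
  \<open>A\<close>.\<close>

locale type_def_group =
  fixes L :: "('f, 'r) fo_language" and M :: "('f, 'r, 'a) fo_structure" and A :: "'a set" and n :: nat
    and G :: "('a list, 'b) monoid_scheme" (structure) and \<D> :: "'a list set set" and P :: "'a list set"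
  assumes grp: "group G"
    and A: "A \<subseteq> universe M" "universe M \<noteq> {}"
    and sat_omega: "\<And>\<Q>. (\<And>Q. Q \<in> \<Q> \<Longrightarrow> dfn L M A Q) \<Longrightarrow>
      (\<And>q. finite q \<Longrightarrow> q \<subseteq> \<Q> \<Longrightarrow> \<exists>e\<in>assign M. \<forall>Q\<in>q. Q e) \<Longrightarrow> \<exists>e\<in>assign M. \<forall>Q\<in>\<Q>. Q e"
    and D: "\<And>D. D \<in> \<D> \<Longrightarrow> dfn_set L M A n D"
    and P: "dfn_set L M A (3 * n) P"
    and one_A: "set \<one> \<subseteq> A"
    and carrier: "carrier G = tuples M n \<inter> \<Inter>\<D>"
    and mult: "\<And>a b c. a \<in> carrier G \<Longrightarrow> b \<in> carrier G \<Longrightarrow> c \<in> carrier G \<Longrightarrow> a \<otimes> b = c \<longleftrightarrow> a @ b @ c \<in> P"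
begin

interpretation group G by (rule grp)

lemma one_length: "length \<one> = n"
  using one_closed carrier unfolding tuples_def by auto

lemma carrier_tuples: "carrier G \<subseteq> tuples M n"
  using carrier by auto

text \<open>Membership in the carrier is split into one condition for each block and each member of
  \<open>\<D>\<close>; finitely many of these involve only a finite part of
  \<open>\<D>\<close>.\<close>

lemma compactness:
  assumes R: "dfn L M A R"
    and fin: "\<And>\<D>0. finite \<D>0 \<Longrightarrow> \<D>0 \<subseteq> \<D> \<Longrightarrow> \<exists>e\<in>assign M. R e \<and> (\<forall>v<m. \<forall>D\<in>\<D>0. blk n e v \<in> D)"
  shows "\<exists>e\<in>assign M. R e \<and> (\<forall>v<m. blk n e v \<in> carrier G)"
proof -
  define p :: "nat \<times> 'a list set \<Rightarrow> (nat \<Rightarrow> 'a) \<Rightarrow> bool" where "p = (\<lambda>(v, D) e. blk n e v \<in> D)"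
  have "\<exists>e\<in>assign M. \<forall>Q\<in>insert R (p ` ({..<m} \<times> \<D>)). Q e"
  proof (rule sat_omega)
    show "dfn L M A Q" if "Q \<in> insert R (p ` ({..<m} \<times> \<D>))" for Q
      using that R dfn_blk_mem[OF D] unfolding p_def by auto
    fix q assume q: "finite q" "q \<subseteq> insert R (p ` ({..<m} \<times> \<D>))"
    then have "finite (q - {R})" "q - {R} \<subseteq> p ` ({..<m} \<times> \<D>)" by auto
    then obtain J where J: "J \<subseteq> {..<m} \<times> \<D>" "finite J" "q - {R} = p ` J" using finite_subset_image by metis
    have fJ: "finite (snd ` J)" "snd ` J \<subseteq> \<D>" using J(1,2) by auto
    from fin[OF fJ] obtain e where e: "e \<in> assign M" "R e" "\<forall>v<m. \<forall>D\<in>snd ` J. blk n e v \<in> D" by blast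
    have "Q e" if "Q \<in> q" for Q
    proof (cases "Q = R")
      case False
      then have "Q \<in> p ` J" using that J(3) by auto
      then show ?thesis using e(3) J(1) unfolding p_def by force
    qed (use e(2) in simp)
    then show "\<exists>e\<in>assign M. \<forall>Q\<in>q. Q e" using e(1) by blast
  qed
  then obtain e where e: "e \<in> assign M" "R e" "\<forall>Q\<in>p ` ({..<m} \<times> \<D>). Q e" by auto
  have "blk n e v \<in> carrier G" if "v < m" for v
    unfolding carrier using e(3) blk_in_tuples[OF e(1)] that unfolding p_def by auto
  then show ?thesis using e(1,2) by blast
qed

lemma local_uniqueness:
  assumes R: "dfn L M A R" and no: "\<And>e. e \<in> assign M \<Longrightarrow> \<forall>v<m. blk n e v \<in> carrier G \<Longrightarrow> \<not> R e"
  obtains \<D>0 where "finite \<D>0" "\<D>0 \<subseteq> \<D>" "\<And>e. e \<in> assign M \<Longrightarrow> \<forall>v<m. \<forall>D\<in>\<D>0. blk n e v \<in> D \<Longrightarrow> \<not> R e"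
proof (rule ccontr)
  note ex = that
  assume "\<not> thesis"
  then have "\<exists>e\<in>assign M. R e \<and> (\<forall>v<m. \<forall>D\<in>\<D>0. blk n e v \<in> D)" if "finite \<D>0" "\<D>0 \<subseteq> \<D>" for \<D>0
    using ex[OF that] by blast
  from compactness[OF R this] no show False by blast
qed

text \<open>Outside \<open>G\<close> the relation \<open>P\<close> is arbitrary, whereas the formula with the tree property has to be
  inconsistent over the whole model; compactness provides a definable set on which \<open>P\<close> still behaves.\<close>

lemma definable_neighbourhood:
  obtains X where "dfn_set L M A n X" "carrier G \<subseteq> X" "X \<subseteq> tuples M n"
    "\<And>a b c c'. a \<in> X \<Longrightarrow> b \<in> X \<Longrightarrow> c \<in> X \<Longrightarrow> c' \<in> X \<Longrightarrow> a @ b @ c \<in> P \<Longrightarrow> a @ b @ c' \<in> P \<Longrightarrow> c = c'"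
    "\<And>a b b'. a \<in> X \<Longrightarrow> b \<in> X \<Longrightarrow> b' \<in> X \<Longrightarrow> a @ b @ \<one> \<in> P \<Longrightarrow> a @ b' @ \<one> \<in> P \<Longrightarrow> b = b'"
proof -
  \<comment> \<open>\<open>R1\<close> says that a product has two values, \<open>R2\<close> that an
    element has two right inverses. Neither happens in \<open>G\<close>, hence neither happens in
    the intersection of suitable finitely many members of \<open>\<D>\<close>.\<close>
  define R1 where "R1 e \<longleftrightarrow> (blk n e 0 @ blk n e 1 @ blk n e 2 \<in> P \<and> blk n e 0 @ blk n e 1 @ blk n e 3 \<in> P) \<and>
    \<not> (blk n e 2 = blk n e 3)" for e
  define R2 where "R2 e \<longleftrightarrow> ((blk n e 0 @ blk n e 1 @ blk n e 3 \<in> P \<and> blk n e 0 @ blk n e 2 @ blk n e 3 \<in> P) \<and>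
    \<not> (blk n e 1 = blk n e 2)) \<and> blk n e 3 = \<one>" for e
  have d1: "dfn L M A R1" unfolding R1_def by (intro dfn_Conj dfn_Neg dfn_blk_eq dfn_blk_mem3 P)
  have d2: "dfn L M A R2" unfolding R2_def
    by (intro dfn_Conj dfn_Neg dfn_blk_eq dfn_blk_mem3 P dfn_blk_const one_A one_length)
  have no1: "\<not> R1 e" if "\<forall>v<4. blk n e v \<in> carrier G" for e
    using that mult[of "blk n e 0" "blk n e 1" "blk n e 2"] mult[of "blk n e 0" "blk n e 1" "blk n e 3"]
    unfolding R1_def by auto
  have no2: "\<not> R2 e" if "\<forall>v<4. blk n e v \<in> carrier G" for e
  proof
    assume R: "R2 e"
    have c: "blk n e 0 \<in> carrier G" "blk n e 1 \<in> carrier G" "blk n e 2 \<in> carrier G" "blk n e 3 \<in> carrier G"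
      using that by auto
    have "blk n e 0 \<otimes> blk n e 1 = blk n e 0 \<otimes> blk n e 2"
      using R mult[OF c(1,2,4)] mult[OF c(1,3,4)] unfolding R2_def by metis
    then show False using R c unfolding R2_def by simp
  qed
  obtain \<D>1 where D1: "finite \<D>1" "\<D>1 \<subseteq> \<D>" "\<And>e. e \<in> assign M \<Longrightarrow> \<forall>v<4. \<forall>D\<in>\<D>1. blk n e v \<in> D \<Longrightarrow> \<not> R1 e"
    using local_uniqueness[OF d1, of 4] no1 by metis
  obtain \<D>2 where D2: "finite \<D>2" "\<D>2 \<subseteq> \<D>" "\<And>e. e \<in> assign M \<Longrightarrow> \<forall>v<4. \<forall>D\<in>\<D>2. blk n e v \<in> D \<Longrightarrow> \<not> R2 e"
    using local_uniqueness[OF d2, of 4] no2 by metis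
  define X where "X = tuples M n \<inter> \<Inter>(\<D>1 \<union> \<D>2)"
  have fin: "finite (\<D>1 \<union> \<D>2)" "\<D>1 \<union> \<D>2 \<subseteq> \<D>" using D1 D2 by auto
  have inX: "(\<forall>D\<in>\<D>1. x \<in> D) \<and> (\<forall>D\<in>\<D>2. x \<in> D) \<and> x \<in> tuples M n" if "x \<in> X" for x using that unfolding X_def by auto
  have asg: "\<exists>e\<in>assign M. blk n e 0 = a \<and> blk n e 1 = b \<and> blk n e 2 = c \<and> blk n e 3 = d \<and> (\<forall>v<4. blk n e v \<in> {a, b, c, d})"
    if abcd: "a \<in> tuples M n" "b \<in> tuples M n" "c \<in> tuples M n" "d \<in> tuples M n" for a b c d
  proof -
    define val where "val v = (if v = 0 then a else if v = 1 then b else if v = (2::nat) then c else d)" for v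
    have "val v \<in> tuples M n" for v unfolding val_def using abcd by auto
    then obtain e where "e \<in> assign M" "\<forall>v. blk n e v = val v" using assign_of_blocks A(2) by metis
    then have e: "e \<in> assign M" "\<And>v. blk n e v = (if v = 0 then a else if v = 1 then b else if v = 2 then c else d)"
      unfolding val_def by auto
    then show ?thesis by (intro bexI[OF _ e(1)]) simp
  qed
  show thesis
  proof (rule that)
    show "X \<subseteq> tuples M n" unfolding X_def by auto
    show "carrier G \<subseteq> X" unfolding X_def carrier using fin by auto
    show "c = c'" if X: "a \<in> X" "b \<in> X" "c \<in> X" "c' \<in> X" "a @ b @ c \<in> P" "a @ b @ c' \<in> P" for a b c c'
    proof -
      obtain e where e: "e \<in> assign M" "blk n e 0 = a" "blk n e 1 = b" "blk n e 2 = c" "blk n e 3 = c'"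
        "\<forall>v<4. blk n e v \<in> {a, b, c, c'}" using asg[of a b c c'] inX X by blast
      have sub: "{a, b, c, c'} \<subseteq> X" using X(1-4) by blast
      have "\<forall>v<4. \<forall>D\<in>\<D>1. blk n e v \<in> D"
      proof (intro allI impI ballI)
        fix v :: nat and D assume "v < 4" "D \<in> \<D>1"
        then have "blk n e v \<in> X" using e(6) sub by blast
        then show "blk n e v \<in> D" using inX \<open>D \<in> \<D>1\<close> by blast
      qed
      then have "\<not> R1 e" using D1(3)[OF e(1)] by blast
      then show ?thesis using X(5,6) unfolding R1_def e(2-5) by blast
    qed
    have one: "\<one> \<in> X" using \<open>carrier G \<subseteq> X\<close> by auto
    show "b = b'" if X: "a \<in> X" "b \<in> X" "b' \<in> X" "a @ b @ \<one> \<in> P" "a @ b' @ \<one> \<in> P" for a b b'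
    proof -
      obtain e where e: "e \<in> assign M" "blk n e 0 = a" "blk n e 1 = b" "blk n e 2 = b'" "blk n e 3 = \<one>"
        "\<forall>v<4. blk n e v \<in> {a, b, b', \<one>}" using asg[of a b b' \<one>] inX X one by blast
      have sub: "{a, b, b', \<one>} \<subseteq> X" using X(1-3) one by blast
      have "\<forall>v<4. \<forall>D\<in>\<D>2. blk n e v \<in> D"
      proof (intro allI impI ballI)
        fix v :: nat and D assume "v < 4" "D \<in> \<D>2"
        then have "blk n e v \<in> X" using e(6) sub by blast
        then show "blk n e v \<in> D" using inX \<open>D \<in> \<D>2\<close> by blast
      qed
      then have "\<not> R2 e" using D2(3)[OF e(1)] by blast
      then show ?thesis using X(4,5) unfolding R2_def e(2-5) by blast
    qed
    have "dfn_set L M A n X"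
    proof -
      have "\<forall>D\<in>\<D>1 \<union> \<D>2. \<exists>\<phi>. \<phi> \<in> formulas_in (with_params L A) n \<and> D = {b \<in> tuples M n. holds (expand M) \<phi> b}"
        using D fin(2) unfolding dfn_set_def by blast
      from bchoice[OF this] obtain F where F: "\<And>D. D \<in> \<D>1 \<union> \<D>2 \<Longrightarrow> F D \<in> formulas_in (with_params L A) n \<and>
        D = {b \<in> tuples M n. holds (expand M) (F D) b}" by blast
      have "\<exists>\<phi>\<in>formulas_in (with_params L A) n. \<forall>b\<in>tuples M n. holds (expand M) \<phi> b \<longleftrightarrow> (\<forall>\<psi>\<in>F ` (\<D>1 \<union> \<D>2). holds (expand M) \<psi> b)"
      proof -
        have conj: "finite \<Psi> \<Longrightarrow> \<Psi> \<subseteq> formulas_in (with_params L A) n \<Longrightarrow>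
          \<exists>\<phi>\<in>formulas_in (with_params L A) n. \<forall>b\<in>tuples M n. holds (expand M) \<phi> b \<longleftrightarrow> (\<forall>\<psi>\<in>\<Psi>. holds (expand M) \<psi> b)" for \<Psi>
        proof (induction \<Psi> rule: finite_induct)
          case empty
          have "Ex 0 (Eq (Var 0) (Var 0)) \<in> formulas_in (with_params L A) n"
            unfolding formulas_in_def formulas_def by auto
          moreover have "holds (expand M) (Ex 0 (Eq (Var 0) (Var 0))) b" for b
            unfolding holds_def using A(2) by auto
          ultimately show ?case by blast
        next
          case (insert \<psi> \<Psi>)
          then obtain \<phi> where "\<phi> \<in> formulas_in (with_params L A) n"
            "\<forall>b\<in>tuples M n. holds (expand M) \<phi> b \<longleftrightarrow> (\<forall>\<psi>\<in>\<Psi>. holds (expand M) \<psi> b)" by auto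
          then show ?case using insert.prems
            by (intro bexI[of _ "Conj \<psi> \<phi>"]) (auto simp: holds_def formulas_in_def formulas_def)
        qed
        show ?thesis by (rule conj) (use fin(1) F in auto)
      qed
      then obtain \<phi> where \<phi>: "\<phi> \<in> formulas_in (with_params L A) n"
        "\<forall>b\<in>tuples M n. holds (expand M) \<phi> b \<longleftrightarrow> (\<forall>\<psi>\<in>F ` (\<D>1 \<union> \<D>2). holds (expand M) \<psi> b)" by auto
      have "b \<in> D \<longleftrightarrow> holds (expand M) (F D) b" if "b \<in> tuples M n" "D \<in> \<D>1 \<union> \<D>2" for b D
        using F[OF that(2)] that(1) by blast
      then have "X = {b \<in> tuples M n. holds (expand M) \<phi> b}" unfolding X_def using \<phi>(2) by blast
      then show ?thesis unfolding dfn_set_def using \<phi>(1) by blast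
    qed
    then show "dfn_set L M A n X" .
  qed
qed

fun evG :: "word \<Rightarrow> 'a list \<Rightarrow> 'a list list \<Rightarrow> 'a list" where
  "evG WX x ys = x"
| "evG (WVar i) x ys = (if i < length ys then ys ! i else \<one>)"
| "evG (WAdd v w) x ys = evG v x ys \<otimes> evG w x ys"
| "evG (WNeg w) x ys = inv (evG w x ys)"

lemma evG_closed: "x \<in> carrier G \<Longrightarrow> set ys \<subseteq> carrier G \<Longrightarrow> evG w x ys \<in> carrier G"
  by (induction w) auto

text \<open>A definable graph of the word map, with intermediate values kept inside
  \<open>X\<close>. It holds of the true values in \<open>G\<close>, and by
  \<open>wrel_unique\<close> it has at most one value in \<open>X\<close> when \<open>X\<close> is
  the neighbourhood above. For an inverse, the unit is quantified as b so that it occupies a block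
  of variables.\<close>

fun wrel :: "'a list set \<Rightarrow> word \<Rightarrow> 'a list \<Rightarrow> 'a list list \<Rightarrow> 'a list \<Rightarrow> bool" where
  "wrel X WX x ys z \<longleftrightarrow> z = x"
| "wrel X (WVar i) x ys z \<longleftrightarrow> (if i < length ys then z = ys ! i else z = \<one>)"
| "wrel X (WAdd v w) x ys z \<longleftrightarrow> (\<exists>a\<in>tuples M n. \<exists>b\<in>tuples M n. (a \<in> X \<and> b \<in> X) \<and> (wrel X v x ys a \<and> wrel X w x ys b) \<and> a @ b @ z \<in> P)"
| "wrel X (WNeg w) x ys z \<longleftrightarrow> (\<exists>a\<in>tuples M n. \<exists>b\<in>tuples M n. (a \<in> X \<and> b = \<one>) \<and> wrel X w x ys a \<and> a @ z @ b \<in> P)"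

lemma wrel_sound:
  assumes "carrier G \<subseteq> X" "x \<in> carrier G" "set ys \<subseteq> carrier G"
  shows "wrel X w x ys (evG w x ys)"
proof (induction w)
  case (WAdd v w)
  have c: "evG v x ys \<in> carrier G" "evG w x ys \<in> carrier G" using evG_closed assms by auto
  then have "evG v x ys @ evG w x ys @ (evG v x ys \<otimes> evG w x ys) \<in> P" using mult by blast
  then show ?case using WAdd c assms(1) carrier_tuples by auto
next
  case (WNeg w)
  have c: "evG w x ys \<in> carrier G" using evG_closed assms by auto
  then have "evG w x ys @ inv (evG w x ys) @ \<one> \<in> P" using mult[of "evG w x ys" "inv (evG w x ys)" \<one>] by auto
  then show ?case using WNeg c assms(1) carrier_tuples one_closed by auto
qed auto

lemma dfn_wrel:
  assumes X: "dfn_set L M A n X"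
  shows "dfn L M A (\<lambda>e. wrel X w (blk n e vx) (map (blk n e) vys) (blk n e vz))"
proof (induction w arbitrary: vz)
  case WX
  then show ?case by (simp add: dfn_blk_eq)
next
  case (WVar i)
  then show ?case by (cases "i < length vys") (simp_all add: dfn_blk_eq dfn_blk_const one_A one_length)
next
  case (WAdd v w)
  \<comment> \<open>The blocks a and a + 1 lie beyond all blocks in use and hold the two
    intermediate values.\<close>
  obtain a where "\<forall>y\<in>insert vx (insert vz (set vys)). y < a"
    using finite_nat_set_iff_bounded[of "insert vx (insert vz (set vys))"] by auto
  then have a: "vx < a" "vz < a" "\<And>y. y \<in> set vys \<Longrightarrow> y < a" by auto
  let ?Q = "\<lambda>e. (blk n e a \<in> X \<and> blk n e (Suc a) \<in> X) \<and>
    (wrel X v (blk n e vx) (map (blk n e) vys) (blk n e a) \<and> wrel X w (blk n e vx) (map (blk n e) vys) (blk n e (Suc a))) \<and>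
    blk n e a @ blk n e (Suc a) @ blk n e vz \<in> P"
  have "dfn L M A ?Q" by (intro dfn_Conj dfn_blk_mem X dfn_blk_mem3 P WAdd)
  then have "dfn L M A (\<lambda>e. \<exists>s\<in>tuples M n. \<exists>t\<in>tuples M n. ?Q (blk_upd n (Suc a) t (blk_upd n a s e)))"
    by (intro dfn_ex_blk[where Q = "\<lambda>e. \<exists>t\<in>tuples M n. ?Q (blk_upd n (Suc a) t e)"] dfn_ex_blk)
  then show ?case
  proof (rule dfn_cong)
    fix e
    have "?Q (blk_upd n (Suc a) t (blk_upd n a s e)) \<longleftrightarrow>
        (s \<in> X \<and> t \<in> X) \<and> (wrel X v (blk n e vx) (map (blk n e) vys) s \<and>
        wrel X w (blk n e vx) (map (blk n e) vys) t) \<and> s @ t @ blk n e vz \<in> P"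
      if st: "s \<in> tuples M n" "t \<in> tuples M n" for s t
    proof -
      define e' where "e' = blk_upd n (Suc a) t (blk_upd n a s e)"
      have 1: "blk n e' a = s" "blk n e' (Suc a) = t"
        unfolding e'_def using st by (simp_all add: blk_upd_same blk_upd_other tuples_def)
      have 2: "blk n e' y = blk n e y" if "y < a" for y
        unfolding e'_def using that by (simp add: blk_upd_other)
      have 3: "map (blk n e') vys = map (blk n e) vys" using a(3) 2 by simp
      show ?thesis unfolding e'_def[symmetric] 1 3 2[OF a(1)] 2[OF a(2)] ..
    qed
    then show "(\<exists>s\<in>tuples M n. \<exists>t\<in>tuples M n. ?Q (blk_upd n (Suc a) t (blk_upd n a s e))) =
      wrel X (WAdd v w) (blk n e vx) (map (blk n e) vys) (blk n e vz)"
      unfolding wrel.simps by (intro bex_cong refl)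
  qed
next
  case (WNeg w)
  obtain a where "\<forall>y\<in>insert vx (insert vz (set vys)). y < a"
    using finite_nat_set_iff_bounded[of "insert vx (insert vz (set vys))"] by auto
  then have a: "vx < a" "vz < a" "\<And>y. y \<in> set vys \<Longrightarrow> y < a" by auto
  let ?Q = "\<lambda>e. (blk n e a \<in> X \<and> blk n e (Suc a) = \<one>) \<and> wrel X w (blk n e vx) (map (blk n e) vys) (blk n e a) \<and>
    blk n e a @ blk n e vz @ blk n e (Suc a) \<in> P"
  have "dfn L M A ?Q" by (intro dfn_Conj dfn_blk_mem X dfn_blk_mem3 P WNeg dfn_blk_const one_A one_length)
  then have "dfn L M A (\<lambda>e. \<exists>s\<in>tuples M n. \<exists>t\<in>tuples M n. ?Q (blk_upd n (Suc a) t (blk_upd n a s e)))"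
    by (intro dfn_ex_blk[where Q = "\<lambda>e. \<exists>t\<in>tuples M n. ?Q (blk_upd n (Suc a) t e)"] dfn_ex_blk)
  then show ?case
  proof (rule dfn_cong)
    fix e
    have "?Q (blk_upd n (Suc a) t (blk_upd n a s e)) \<longleftrightarrow>
        (s \<in> X \<and> t = \<one>) \<and> wrel X w (blk n e vx) (map (blk n e) vys) s \<and> s @ blk n e vz @ t \<in> P"
      if st: "s \<in> tuples M n" "t \<in> tuples M n" for s t
    proof -
      define e' where "e' = blk_upd n (Suc a) t (blk_upd n a s e)"
      have 1: "blk n e' a = s" "blk n e' (Suc a) = t"
        unfolding e'_def using st by (simp_all add: blk_upd_same blk_upd_other tuples_def)
      have 2: "blk n e' y = blk n e y" if "y < a" for y
        unfolding e'_def using that by (simp add: blk_upd_other)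
      have 3: "map (blk n e') vys = map (blk n e) vys" using a(3) 2 by simp
      show ?thesis unfolding e'_def[symmetric] 1 3 2[OF a(1)] 2[OF a(2)] ..
    qed
    then show "(\<exists>s\<in>tuples M n. \<exists>t\<in>tuples M n. ?Q (blk_upd n (Suc a) t (blk_upd n a s e))) =
      wrel X (WNeg w) (blk n e vx) (map (blk n e) vys) (blk n e vz)"
      unfolding wrel.simps by (intro bex_cong refl)
  qed
qed

lemma wrel_unique:
  assumes "\<And>a b c c'. a \<in> X \<Longrightarrow> b \<in> X \<Longrightarrow> c \<in> X \<Longrightarrow> c' \<in> X \<Longrightarrow> a @ b @ c \<in> P \<Longrightarrow> a @ b @ c' \<in> P \<Longrightarrow> c = c'"
    "\<And>a b b'. a \<in> X \<Longrightarrow> b \<in> X \<Longrightarrow> b' \<in> X \<Longrightarrow> a @ b @ \<one> \<in> P \<Longrightarrow> a @ b' @ \<one> \<in> P \<Longrightarrow> b = b'"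
  shows "z \<in> X \<Longrightarrow> z' \<in> X \<Longrightarrow> wrel X w x ys z \<Longrightarrow> wrel X w x ys z' \<Longrightarrow> z = z'"
proof (induction w arbitrary: z z')
  case (WVar i)
  then show ?case by (cases "i < length ys") auto
next
  case (WAdd v w)
  then obtain a b where ab: "a \<in> X" "b \<in> X" "wrel X v x ys a" "wrel X w x ys b" "a @ b @ z \<in> P" by auto
  obtain a' b' where ab': "a' \<in> X" "b' \<in> X" "wrel X v x ys a'" "wrel X w x ys b'" "a' @ b' @ z' \<in> P" using WAdd by auto
  have "a = a'" using WAdd.IH(1) ab ab' by blast
  moreover have "b = b'" using WAdd.IH(2) ab ab' by blast
  ultimately show ?case using assms(1)[of a b z z'] ab ab' WAdd.prems by blast
next
  case (WNeg w)
  then obtain a where a: "a \<in> X" "wrel X w x ys a" "a @ z @ \<one> \<in> P" by auto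
  obtain a' where a': "a' \<in> X" "wrel X w x ys a'" "a' @ z' @ \<one> \<in> P" using WNeg by auto
  have "a = a'" using WNeg.IH a a' by blast
  then show ?case using assms(2)[of a z z'] a a' WNeg.prems by blast
qed auto

end

section \<open>From unbounded word trees to the tree property\<close>

context type_def_group
begin

interpretation group G by (rule grp)

definition evsG :: "word list \<Rightarrow> 'a list \<Rightarrow> 'a list list \<Rightarrow> 'a list list" where
  "evsG ws x ys = map (\<lambda>w. evG w x ys) ws"

text \<open>Three families of group variables are coded into the natural numbers: a point of the
  branch to s, the value of the l-th word at the node s, and the a-th parameter of level i.\<close>

definition var_x :: "nat list \<Rightarrow> nat" where
  "var_x s = to_nat (Inl s :: nat list + (nat list \<times> nat) + (nat \<times> nat))"
definition var_z :: "nat list \<Rightarrow> nat \<Rightarrow> nat" where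
  "var_z s l = to_nat (Inr (Inl (s, l)) :: nat list + (nat list \<times> nat) + (nat \<times> nat))"
definition var_y :: "nat \<Rightarrow> nat \<Rightarrow> nat" where
  "var_y i a = to_nat (Inr (Inr (i, a)) :: nat list + (nat list \<times> nat) + (nat \<times> nat))"

lemma exists_valuation:
  assumes "\<And>s. vx s \<in> S" "\<And>s l. vz s l \<in> S" "\<And>i a. vy i a \<in> S"
  obtains val where "\<And>s. val (var_x s) = vx s" "\<And>s l. val (var_z s l) = vz s l"
    "\<And>i a. val (var_y i a) = vy i a" "\<And>v. val v \<in> S"
proof
  define val where "val v = (case (from_nat v :: nat list + (nat list \<times> nat) + (nat \<times> nat)) of
    Inl s \<Rightarrow> vx s | Inr (Inl (s, l)) \<Rightarrow> vz s l | Inr (Inr (i, a)) \<Rightarrow> vy i a)" for v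
  show "val v \<in> S" for v unfolding val_def using assms by (auto split: sum.split)
  show "val (var_x s) = vx s" "val (var_z s l) = vz s l" "val (var_y i a) = vy i a" for s l i a
    by (simp_all add: val_def var_x_def var_z_def var_y_def)
qed

text \<open>Level i distinguishes the children of nodes of length i, so its value is attached to the
  prefix of length i + 1.\<close>

definition Wr :: "'a list set \<Rightarrow> word list \<Rightarrow> nat \<Rightarrow> nat list \<Rightarrow> nat \<Rightarrow> nat \<Rightarrow> (nat \<Rightarrow> 'a) \<Rightarrow> bool" where
  "Wr X ws p s i l e \<longleftrightarrow>
    wrel X (ws ! l) (blk n e (var_x s)) (map (blk n e) (map (var_y i) [0..<p])) (blk n e (var_z (take (Suc i) s) l))"

definition Ne :: "nat \<Rightarrow> nat list \<Rightarrow> nat \<Rightarrow> nat \<Rightarrow> (nat \<Rightarrow> 'a) \<Rightarrow> bool" where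
  "Ne r s i j e \<longleftrightarrow> \<not> (\<forall>l\<in>{..<r}. blk n e (var_z (s @ [i]) l) = blk n e (var_z (s @ [j]) l))"

text \<open>The requirements on sequences of length at most N with entries below N; any finite set
  of requirements on the infinite tree falls into one of these stages. Membership in the carrier is
  imposed on all variables at every stage.\<close>

definition tree_type :: "'a list set \<Rightarrow> word list \<Rightarrow> nat \<Rightarrow> nat \<Rightarrow> ((nat \<Rightarrow> 'a) \<Rightarrow> bool) set" where
  "tree_type X ws p N = {(\<lambda>e. blk n e v \<in> D) | v D. D \<in> \<D>}
    \<union> {Wr X ws p s i l | s i l. length s \<le> N \<and> set s \<subseteq> {..<N} \<and> i < length s \<and> l < length ws}
    \<union> {Ne (length ws) s i j | s i j. length s < N \<and> set s \<subseteq> {..<N} \<and> i < N \<and> j < N \<and> i \<noteq> j}"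

lemma tree_type_mono: "N \<le> N' \<Longrightarrow> tree_type X ws p N \<subseteq> tree_type X ws p N'"
  unfolding tree_type_def
  by (intro Un_mono order_refl) (blast intro: order_trans less_le_trans | fastforce)+

lemma dfn_tree_type:
  assumes "dfn_set L M A n X" "Q \<in> tree_type X ws p N"
  shows "dfn L M A Q"
proof -
  have "dfn L M A (Wr X ws p s i l)" for s i l unfolding Wr_def by (rule dfn_wrel[OF assms(1)])
  moreover have "dfn L M A (Ne r s i j)" for r s i j unfolding Ne_def by (intro dfn_Neg dfn_All dfn_blk_eq) simp
  moreover have "dfn L M A (\<lambda>e. blk n e v \<in> D)" if "D \<in> \<D>" for v D by (rule dfn_blk_mem[OF D[OF that]])
  ultimately show ?thesis using assms(2) unfolding tree_type_def by blast
qed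

lemma finite_tree_satisfies:
  assumes X: "carrier G \<subseteq> X"
    and yss: "length yss = N" "set yss \<subseteq> tuples_in (carrier G) p" and tr: "tree (evsG ws) (Suc N) yss (carrier G)"
  shows "\<exists>e\<in>assign M. \<forall>Q\<in>tree_type X ws p N. Q e"
proof -
  let ?k = "Suc N"
  obtain xs cs where xs: "\<And>s. length s = N \<Longrightarrow> set s \<subseteq> {..<?k} \<Longrightarrow>
      xs s \<in> carrier G \<and> (\<forall>i<N. evsG ws (xs s) (yss ! i) = cs (take (Suc i) s))"
    and cs: "\<And>s i j. length s < N \<Longrightarrow> set s \<subseteq> {..<?k} \<Longrightarrow> i < ?k \<Longrightarrow> j < ?k \<Longrightarrow> i \<noteq> j \<Longrightarrow> cs (s @ [i]) \<noteq> cs (s @ [j])"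
    using tree_labels[OF tr] yss(1) by metis
  \<comment> \<open>An inner node is realised by continuing it with zeros to a full branch; 0 is an
    admissible entry because the branching is N + 1.\<close>
  define pad where "pad s = s @ replicate (N - length s) (0::nat)" for s
  define ok where "ok s \<longleftrightarrow> length s \<le> N \<and> set s \<subseteq> {..<?k}" for s
  have pad: "length (pad s) = N" "set (pad s) \<subseteq> {..<?k}" if "ok s" for s
    using that unfolding pad_def ok_def by auto
  have pad_take: "take i (pad s) = take i s" if "i \<le> length s" for i s
    using that unfolding pad_def by simp
  have yF: "yss ! i ! a \<in> carrier G" if "i < N" "a < p" for i a
  proof -
    have "yss ! i \<in> tuples_in (carrier G) p" using yss that(1) by auto
    then show ?thesis using that(2) unfolding tuples_in_def by auto
  qed
  have csF: "cs s = evsG ws (xs (pad s)) (yss ! (length s - 1))" if s: "ok s" "s \<noteq> []" for s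
  proof -
    have "length s - 1 < N" using s unfolding ok_def by (cases s) auto
    then have "evsG ws (xs (pad s)) (yss ! (length s - 1)) = cs (take (Suc (length s - 1)) (pad s))"
      using xs[OF pad[OF s(1)]] by blast
    also have "take (Suc (length s - 1)) (pad s) = s" using s(2) pad_take[of "Suc (length s - 1)" s] by (cases s) auto
    finally show ?thesis ..
  qed
  have cs_in: "cs s ! l \<in> carrier G" "length (cs s) = length ws" if s: "ok s" "s \<noteq> []" and l: "l < length ws" for s l
  proof -
    have "length s - 1 < N" using s unfolding ok_def by (cases s) auto
    then have "set (yss ! (length s - 1)) \<subseteq> carrier G" using yss unfolding tuples_in_def by (metis (mono_tags, lifting) mem_Collect_eq nth_mem subsetD)
    then show "cs s ! l \<in> carrier G" "length (cs s) = length ws"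
      using csF[OF s] evG_closed xs[OF pad[OF s(1)]] l unfolding evsG_def by auto
  qed
  \<comment> \<open>Variables outside the finite tree take the unit, so that all blocks lie in the
    carrier.\<close>
  define vx where "vx s = (if ok s then xs (pad s) else \<one>)" for s
  define vz where "vz s l = (if ok s \<and> s \<noteq> [] \<and> l < length ws then cs s ! l else \<one>)" for s l
  define vy where "vy i a = (if i < N \<and> a < p then yss ! i ! a else \<one>)" for i a
  have "vx s \<in> carrier G" for s unfolding vx_def using xs[OF pad] by auto
  moreover have "vz s l \<in> carrier G" for s l unfolding vz_def using cs_in by auto
  moreover have "vy i a \<in> carrier G" for i a unfolding vy_def using yF by auto
  ultimately obtain val where val: "\<And>s. val (var_x s) = vx s" "\<And>s l. val (var_z s l) = vz s l"
    "\<And>i a. val (var_y i a) = vy i a" and val_in: "\<And>v. val v \<in> carrier G"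
    using exists_valuation[of vx "carrier G" vz vy] by blast
  then have "val v \<in> tuples M n" for v using carrier_tuples by blast
  then obtain e where e: "e \<in> assign M" "\<And>v. blk n e v = val v" using assign_of_blocks A(2) by metis
  have "blk n e v \<in> D" if "D \<in> \<D>" for v D using val_in[of v] that unfolding e(2) carrier by auto
  moreover have "Wr X ws p s i l e" if s: "length s \<le> N" "set s \<subseteq> {..<N}" "i < length s" "l < length ws" for s i l
  proof -
    have ok: "ok s" "ok (take (Suc i) s)" using s set_take_subset[of "Suc i" s] unfolding ok_def by auto
    have ne: "take (Suc i) s \<noteq> []" using s(3) by auto
    have iN: "i < N" using s by auto
    have yi: "map (vy i) [0..<p] = yss ! i"
      using iN yss unfolding vy_def tuples_in_def by (intro nth_equalityI) (auto simp: subset_iff)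
    have "yss ! i \<in> tuples_in (carrier G) p" using yss iN by auto
    then have yG: "set (yss ! i) \<subseteq> carrier G" unfolding tuples_in_def by auto
    have "evsG ws (xs (pad s)) (yss ! i) = cs (take (Suc i) s)"
      using xs[OF pad[OF ok(1)]] iN pad_take[of "Suc i" s] s(3) by auto
    then have "cs (take (Suc i) s) ! l = evG (ws ! l) (xs (pad s)) (yss ! i)"
      using s(4) unfolding evsG_def by (metis nth_map)
    moreover have "wrel X (ws ! l) (xs (pad s)) (yss ! i) (evG (ws ! l) (xs (pad s)) (yss ! i))"
      by (rule wrel_sound[OF X _ yG]) (use xs[OF pad[OF ok(1)]] in auto)
    moreover have "map (blk n e) (map (var_y i) [0..<p]) = yss ! i" using yi by (simp add: e(2) val(3) comp_def)
    ultimately show ?thesis unfolding Wr_def e(2) val vx_def vz_def using ok ne s(4) by simp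
  qed
  moreover have "Ne (length ws) s i j e" if s: "length s < N" "set s \<subseteq> {..<N}" "i < N" "j < N" "i \<noteq> j" for s i j
    unfolding Ne_def
  proof
    assume *: "\<forall>l\<in>{..<length ws}. blk n e (var_z (s @ [i]) l) = blk n e (var_z (s @ [j]) l)"
    have ok: "ok (s @ [i])" "ok (s @ [j])" using s unfolding ok_def by auto
    have "cs (s @ [i]) = cs (s @ [j])"
    proof (rule nth_equalityI)
      show len: "length (cs (s @ [i])) = length (cs (s @ [j]))"
        using csF[OF ok(1)] csF[OF ok(2)] unfolding evsG_def by simp
      fix l assume "l < length (cs (s @ [i]))"
      then have "l < length ws" using csF[OF ok(1)] unfolding evsG_def by simp
      then show "cs (s @ [i]) ! l = cs (s @ [j]) ! l" using * ok unfolding e(2) val vz_def by auto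
    qed
    moreover have "set s \<subseteq> {..<?k}" using s(2) by auto
    ultimately show False using cs[of s i j] s by auto
  qed
  ultimately have "\<forall>Q\<in>tree_type X ws p N. Q e" unfolding tree_type_def by blast
  then show ?thesis using e(1) by blast
qed

lemma infinite_tree:
  assumes X: "dfn_set L M A n X" "carrier G \<subseteq> X"
    and trees: "\<And>N. \<exists>yss. length yss = N \<and> set yss \<subseteq> tuples_in (carrier G) p \<and> tree (evsG ws) (Suc N) yss (carrier G)"
  shows "\<exists>e\<in>assign M. (\<forall>v. blk n e v \<in> carrier G) \<and>
    (\<forall>s i l. i < length s \<and> l < length ws \<longrightarrow> Wr X ws p s i l e) \<and> (\<forall>s i j. i \<noteq> j \<longrightarrow> Ne (length ws) s i j e)"
proof -
  have "\<exists>e\<in>assign M. \<forall>Q\<in>(\<Union>N. tree_type X ws p N). Q e"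
  proof (rule sat_omega)
    show "dfn L M A Q" if "Q \<in> (\<Union>N. tree_type X ws p N)" for Q using that dfn_tree_type[OF X(1)] by blast
    fix q assume q: "finite q" "q \<subseteq> (\<Union>N. tree_type X ws p N)"
    have "\<exists>N. q \<subseteq> tree_type X ws p N"
      using q
    proof (induction q rule: finite_induct)
      case (insert Q q)
      then obtain N N' where "q \<subseteq> tree_type X ws p N" "Q \<in> tree_type X ws p N'" by auto
      then have "insert Q q \<subseteq> tree_type X ws p (max N N')"
        using tree_type_mono[of N "max N N'" X ws p] tree_type_mono[of N' "max N N'" X ws p] by auto
      then show ?case by blast
    qed auto
    then obtain N where "q \<subseteq> tree_type X ws p N" by auto
    moreover obtain yss where yss: "length yss = N" "set yss \<subseteq> tuples_in (carrier G) p" "tree (evsG ws) (Suc N) yss (carrier G)"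
      using trees by metis
    ultimately show "\<exists>e\<in>assign M. \<forall>Q\<in>q. Q e" using finite_tree_satisfies[OF X(2) yss] by blast
  qed
  then obtain e where e: "e \<in> assign M" "\<And>N Q. Q \<in> tree_type X ws p N \<Longrightarrow> Q e" by auto
  have "blk n e v \<in> D" if "D \<in> \<D>" for v D
    using e(2)[of "\<lambda>e. blk n e v \<in> D" 0] that unfolding tree_type_def by blast
  then have "blk n e v \<in> carrier G" for v unfolding carrier using blk_in_tuples[OF e(1)] by auto
  moreover have "Wr X ws p s i l e" if "i < length s" "l < length ws" for s i l
  proof -
    obtain m where "\<forall>y\<in>set s. y < m" using finite_nat_set_iff_bounded[of "set s"] by auto
    then have "length s \<le> max m (length s)" "set s \<subseteq> {..<max m (length s)}" by auto
    then have "Wr X ws p s i l \<in> tree_type X ws p (max m (length s))"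
      unfolding tree_type_def using that by blast
    then show ?thesis by (rule e(2))
  qed
  moreover have "Ne (length ws) s i j e" if "i \<noteq> j" for s i j
  proof -
    obtain m where m: "\<forall>y\<in>insert (length s) (insert i (insert j (set s))). y < m"
      using finite_nat_set_iff_bounded[of "insert (length s) (insert i (insert j (set s)))"] by auto
    then have "length s < m" "set s \<subseteq> {..<m}" "i < m" "j < m" by auto
    then have "Ne (length ws) s i j \<in> tree_type X ws p m" unfolding tree_type_def using that by blast
    then show ?thesis by (rule e(2))
  qed
  ultimately show ?thesis using e(1) by blast
qed

text \<open>The formula says that x lies in \<open>X\<close> and that the words have the values z at
  x and y. A node carries the y of its level and its own labels z. Siblings share y but differ in z,
  so \<open>wrel_unique\<close> makes them inconsistent over the whole model; the branch points
  satisfy everything along their branch.\<close>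

lemma tree_property_of_infinite_tree:
  assumes X: "dfn_set L M A n X" "carrier G \<subseteq> X" "X \<subseteq> tuples M n"
    "\<And>a b c c'. a \<in> X \<Longrightarrow> b \<in> X \<Longrightarrow> c \<in> X \<Longrightarrow> c' \<in> X \<Longrightarrow> a @ b @ c \<in> P \<Longrightarrow> a @ b @ c' \<in> P \<Longrightarrow> c = c'"
    "\<And>a b b'. a \<in> X \<Longrightarrow> b \<in> X \<Longrightarrow> b' \<in> X \<Longrightarrow> a @ b @ \<one> \<in> P \<Longrightarrow> a @ b' @ \<one> \<in> P \<Longrightarrow> b = b'"
    and e: "e \<in> assign M" "\<And>v. blk n e v \<in> carrier G"
    "\<And>s i l. i < length s \<Longrightarrow> l < length ws \<Longrightarrow> Wr X ws p s i l e" "\<And>s i j. i \<noteq> j \<Longrightarrow> Ne (length ws) s i j e"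
  shows "\<exists>m'. \<exists>\<phi>\<in>formulas_in L (n + m'). has_tree_property M \<phi> n m' 2"
proof -
  define r where "r = length ws"
  \<comment> \<open>One block for x, p blocks for the y, r blocks for the z.\<close>
  define q where "q = Suc (p + r)"
  define Q where "Q e' \<longleftrightarrow> blk n e' 0 \<in> X \<and> (\<forall>l\<in>{..<r}. wrel X (ws ! l) (blk n e' 0) (map (blk n e') (map Suc [0..<p])) (blk n e' (Suc (p + l))))" for e'
  have dQ: "dfn L M A Q" unfolding Q_def by (intro dfn_Conj dfn_blk_mem dfn_All dfn_wrel X(1)) simp
  have dep: "Q e1 = Q e2" if "\<And>i. i < q * n \<Longrightarrow> e1 i = e2 i" for e1 e2
  proof -
    have b: "blk n e1 v = blk n e2 v" if "v < q" for v
    proof -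
      have "v * n + j < q * n" if "j < n" for j
      proof -
        have "v * n + j < Suc v * n" using that by simp
        also have "\<dots> \<le> q * n" using \<open>v < q\<close> by (intro mult_le_mono1) simp
        finally show ?thesis .
      qed
      then show ?thesis by (intro blk_eqI) (auto simp: nth_blk \<open>\<And>i. i < q * n \<Longrightarrow> e1 i = e2 i\<close>)
    qed
    have ys_eq: "map (blk n e1) (map Suc [0..<p]) = map (blk n e2) (map Suc [0..<p])" using b unfolding q_def by auto
    have "blk n e1 0 = blk n e2 0" "\<And>l. l < r \<Longrightarrow> blk n e1 (Suc (p + l)) = blk n e2 (Suc (p + l))"
      using b unfolding q_def by auto
    then show ?thesis unfolding Q_def ys_eq by simp
  qed
  obtain \<phi> ps where \<phi>: "set ps \<subseteq> universe M" "\<phi> \<in> formulas_in L (q * n + length ps)"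
    "\<And>e. e \<in> assign M \<Longrightarrow> holds M \<phi> (map e [0..<q * n] @ ps) = Q e"
    using dfn_without_params[OF dQ A] dep by metis
  have holds: "holds M \<phi> (b @ concat ys @ concat zs @ ps) \<longleftrightarrow>
      b \<in> X \<and> (\<forall>l<r. wrel X (ws ! l) b ys (zs ! l))"
    if bt: "b \<in> tuples M n" "set ys \<subseteq> tuples M n" "length ys = p" "set zs \<subseteq> tuples M n" "length zs = r" for b ys zs
  proof -
    define val where "val v = (if v < q then (b # ys @ zs) ! v else b)" for v
    have len: "length (b # ys @ zs) = q" using bt unfolding q_def by simp
    have "val v \<in> tuples M n" for v
    proof (cases "v < q")
      case True
      then have "(b # ys @ zs) ! v \<in> set (b # ys @ zs)" using len by (metis nth_mem)
      then show ?thesis using True bt unfolding val_def by auto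
    qed (use bt val_def in auto)
    then obtain e' where e': "e' \<in> assign M" "\<And>v. blk n e' v = val v" using assign_of_blocks A(2) by metis
    have "map (blk n e') [0..<q] = b # ys @ zs"
      by (rule nth_equalityI) (use len e'(2) in \<open>auto simp: val_def\<close>)
    then have "map e' [0..<q * n] = b @ concat ys @ concat zs" unfolding map_blocks by simp
    then have "holds M \<phi> (b @ concat ys @ concat zs @ ps) = Q e'" using \<phi>(3)[OF e'(1)] by simp
    moreover have "map (blk n e') (map Suc [0..<p]) = ys"
      by (rule nth_equalityI) (use bt in \<open>auto simp: e'(2) val_def q_def nth_append\<close>)
    moreover have "blk n e' 0 = b" by (simp add: e'(2) val_def q_def)
    moreover have "blk n e' (Suc (p + l)) = zs ! l" if "l < r" for l
      using that bt by (simp add: e'(2) val_def q_def nth_append)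
    ultimately show ?thesis unfolding Q_def by auto
  qed
  define yt where "yt i = map (blk n e) (map (var_y i) [0..<p])" for i
  define zt where "zt s = map (\<lambda>l. blk n e (var_z s l)) [0..<r]" for s
  \<comment> \<open>The root gets the y of level 0 by truncated subtraction; no instance of the
    formula uses its tuple.\<close>
  define a where "a s = concat (yt (length s - 1)) @ concat (zt s) @ ps" for s
  define m' where "m' = (p + r) * n + length ps"
  have bt: "set (yt i) \<subseteq> tuples M n" "length (yt i) = p" "set (zt s) \<subseteq> tuples M n" "length (zt s) = r" for i s
    unfolding yt_def zt_def using blk_in_tuples[OF e(1)] by auto
  have len_concat: "length (concat xs) = length xs * n \<and> set (concat xs) \<subseteq> universe M" if "set xs \<subseteq> tuples M n" for xs
    using that by (induction xs) (auto simp: tuples_def)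
  have a_tuples: "a s \<in> tuples M m'" for s
    using len_concat[OF bt(1), of "length s - 1"] len_concat[OF bt(3), of s] bt \<phi>(1)
    unfolding a_def m'_def tuples_def by (auto simp: algebra_simps)
  have holds_a: "holds M \<phi> (b @ a s) \<longleftrightarrow> b \<in> X \<and> (\<forall>l<r. wrel X (ws ! l) b (yt (length s - 1)) (blk n e (var_z s l)))"
    if "b \<in> tuples M n" for b s
    unfolding a_def holds[OF that bt(1,2,3,4)] by (simp add: zt_def)
  have blkX: "blk n e v \<in> X" for v using e(2) X(2) by auto
  have "has_tree_property M \<phi> n m' 2"
    unfolding has_tree_property_def
  proof (intro exI[of _ a] conjI allI impI)
    show "a s \<in> tuples M m'" for s by (rule a_tuples)
  next
    fix s :: "nat list" and K :: "nat set"
    assume "finite K \<and> card K = 2"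
    then obtain i j where ij: "i \<noteq> j" "i \<in> K" "j \<in> K" by (metis card_2_iff insertCI)
    show "\<not> (\<exists>b\<in>tuples M n. \<forall>i\<in>K. holds M \<phi> (b @ a (s @ [i])))"
    proof
      assume "\<exists>b\<in>tuples M n. \<forall>i\<in>K. holds M \<phi> (b @ a (s @ [i]))"
      then obtain b where b: "b \<in> tuples M n" "holds M \<phi> (b @ a (s @ [i]))" "holds M \<phi> (b @ a (s @ [j]))" using ij by auto
      have "blk n e (var_z (s @ [i]) l) = blk n e (var_z (s @ [j]) l)" if "l < r" for l
        by (rule wrel_unique[where X = X and w = "ws ! l" and x = b and ys = "yt (length s)", OF X(4,5) blkX blkX])
          (use b(2,3) holds_a[OF b(1)] that in auto)
      then show False using e(4)[OF ij(1), of s] unfolding Ne_def r_def by auto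
    qed
  next
    fix \<sigma> :: "nat \<Rightarrow> nat" and J :: "nat set"
    assume J: "finite J \<and> J \<subseteq> {0<..}"
    \<comment> \<open>Only finitely many levels are tested, so the point of a long enough initial
      segment of the branch will do.\<close>
    then obtain m where m: "\<forall>j\<in>J. j < m" using finite_nat_set_iff_bounded by metis
    define s where "s = map \<sigma> [0..<m]"
    have "holds M \<phi> (blk n e (var_x s) @ a (map \<sigma> [0..<j]))" if j: "j \<in> J" for j
    proof -
      have j': "0 < j" "j < m" using j J m by auto
      have t: "take (Suc (j - 1)) s = map \<sigma> [0..<j]" unfolding s_def using j' by (simp add: take_map)
      have "wrel X (ws ! l) (blk n e (var_x s)) (yt (j - 1)) (blk n e (var_z (map \<sigma> [0..<j]) l))" if "l < r" for l
      proof -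
        have "j - 1 < length s" using j' unfolding s_def by simp
        then have "Wr X ws p s (j - 1) l e" using e(3) that unfolding r_def by blast
        then show ?thesis unfolding Wr_def t yt_def .
      qed
      then show ?thesis unfolding holds_a[OF blk_in_tuples[OF e(1)]] using blkX by simp
    qed
    then show "\<exists>b\<in>tuples M n. \<forall>j\<in>J. holds M \<phi> (b @ a (map \<sigma> [0..<j]))"
      using blk_in_tuples[OF e(1)] by blast
  qed
  moreover have "\<phi> \<in> formulas_in L (n + m')" using \<phi>(2) unfolding m'_def q_def by (simp add: algebra_simps)
  ultimately show ?thesis by blast
qed

text \<open>Without a bound, the choices k = N + 1 and d = N give trees of unlimited branching and
  depth, hence an infinite one.\<close>

lemma word_trees_bounded:
  assumes "\<And>m' \<phi>. \<phi> \<in> formulas_in L (n + m') \<Longrightarrow> \<not> has_tree_property M \<phi> n m' 2"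
  shows "\<exists>k d. k > 0 \<and> (\<forall>yss. length yss = d \<and> set yss \<subseteq> tuples_in (carrier G) p \<longrightarrow> \<not> tree (evsG ws) k yss (carrier G))"
proof (rule ccontr)
  assume "\<not> ?thesis"
  then have trees: "\<exists>yss. length yss = N \<and> set yss \<subseteq> tuples_in (carrier G) p \<and> tree (evsG ws) (Suc N) yss (carrier G)" for N
    by (metis zero_less_Suc)
  obtain X where X: "dfn_set L M A n X" "carrier G \<subseteq> X" "X \<subseteq> tuples M n"
    "\<And>a b c c'. a \<in> X \<Longrightarrow> b \<in> X \<Longrightarrow> c \<in> X \<Longrightarrow> c' \<in> X \<Longrightarrow> a @ b @ c \<in> P \<Longrightarrow> a @ b @ c' \<in> P \<Longrightarrow> c = c'"
    "\<And>a b b'. a \<in> X \<Longrightarrow> b \<in> X \<Longrightarrow> b' \<in> X \<Longrightarrow> a @ b @ \<one> \<in> P \<Longrightarrow> a @ b' @ \<one> \<in> P \<Longrightarrow> b = b'"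
    by (rule definable_neighbourhood) (rule that)
  obtain e where e: "e \<in> assign M" "\<And>v. blk n e v \<in> carrier G"
    "\<And>s i l. i < length s \<Longrightarrow> l < length ws \<Longrightarrow> Wr X ws p s i l e" "\<And>s i j. i \<noteq> j \<Longrightarrow> Ne (length ws) s i j e"
    using infinite_tree[OF X(1,2) trees] by blast
  have "\<exists>m'. \<exists>\<phi>\<in>formulas_in L (n + m'). has_tree_property M \<phi> n m' 2"
    by (rule tree_property_of_infinite_tree[where ws = ws and p = p, OF X(1-3) _ _ e(1)]) (fact X(4,5) e(2-4))+
  then show False using assms by blast
qed

end

text \<open>Each definable set uses finitely many parameters, so fewer than \<open>\<kappa>\<close>
  are used in all; \<open>\<kappa>\<close> is infinite because there are infinitely many
  formulas.\<close>

lemma type_def_groupI: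
  fixes L :: "('f, 'r) fo_language" and M :: "('f, 'r, 'a) fo_structure" and \<kappa> :: "'k rel"
    and G :: "('a list, 'b) monoid_scheme"
  assumes M: "is_structure L M" and \<kappa>: "Card_order \<kappa>" "|formulas L| <o \<kappa>"
    and sat: "saturated \<kappa> L M" and G: "type_definable_group \<kappa> L M n G"
  shows "\<exists>A \<D> P. type_def_group L M A n G \<D> P"
proof -
  have grp: "group G" using G unfolding type_definable_group_def by auto
  interpret group G by (rule grp)
  obtain \<D> where D: "|\<D>| <o \<kappa>" "\<And>D. D \<in> \<D> \<Longrightarrow> definable L M n D" "carrier G = tuples M n \<inter> \<Inter>\<D>"
    using G unfolding type_definable_group_def type_definable_def by auto
  obtain P where P: "definable L M (3 * n) P" "\<And>a b c. a \<in> carrier G \<Longrightarrow> b \<in> carrier G \<Longrightarrow> c \<in> carrier G \<Longrightarrow>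
      a \<otimes>\<^bsub>G\<^esub> b = c \<longleftrightarrow> a @ b @ c \<in> P"
    using G unfolding type_definable_group_def by blast
  have "infinite (formulas L)"
  proof
    assume "finite (formulas L)"
    moreover have "range (\<lambda>i. Eq (Var i) (Var i)) \<subseteq> formulas L" unfolding formulas_def by auto
    moreover have "inj (\<lambda>i. Eq (Var i) (Var i) :: ('f, 'r) fm)" by (rule injI) simp
    ultimately show False using finite_subset finite_imageD infinite_UNIV_nat by blast
  qed
  then have "natLeq \<le>o |formulas L|" using infinite_iff_natLeq_ordLeq by blast
  then have nat\<kappa>: "natLeq \<le>o \<kappa>" using \<kappa>(2) ordLeq_ordLess_trans ordLess_imp_ordLeq by blast
  have "natLeq \<le>o |Field \<kappa>|"
    by (rule ordLeq_ordIso_trans[OF nat\<kappa> ordIso_symmetric[OF card_of_Field_ordIso[OF \<kappa>(1)]]])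
  then have infk: "infinite (Field \<kappa>)" using infinite_iff_natLeq_ordLeq[of "Field \<kappa>"] by blast
  have fin\<kappa>: "|B| <o \<kappa>" if "finite B" for B :: "'a set"
    by (rule finite_ordLess_infinite[OF card_of_Well_order _ _ infk])
      (use \<kappa>(1) that in \<open>auto simp: card_order_on_def Field_card_of\<close>)
  have "\<forall>D\<in>\<D>. \<exists>A. finite A \<and> A \<subseteq> universe M \<and> dfn_set L M A n D" using definable_finite[OF D(2)] by blast
  from bchoice[OF this] obtain par where par: "\<And>D. D \<in> \<D> \<Longrightarrow> finite (par D) \<and> par D \<subseteq> universe M \<and> dfn_set L M (par D) n D"
    by blast
  obtain AP where AP: "finite AP" "AP \<subseteq> universe M" "dfn_set L M AP (3 * n) P" using definable_finite[OF P(1)] by auto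
  define A where "A = (\<Union>D\<in>\<D>. par D) \<union> (AP \<union> set \<one>\<^bsub>G\<^esub>)"
  have one: "\<one>\<^bsub>G\<^esub> \<in> tuples M n" using D(3) one_closed by blast
  have A_sub: "A \<subseteq> universe M" unfolding A_def using par AP(2) one unfolding tuples_def by blast
  have "|\<Union>D\<in>\<D>. par D| <o \<kappa>"
  proof (cases "finite \<D>")
    case True
    then show ?thesis using par by (intro fin\<kappa>) auto
  next
    case False
    have "|par D| \<le>o |\<D>|" if "D \<in> \<D>" for D
      by (rule ordLess_imp_ordLeq, rule finite_ordLess_infinite[OF card_of_Well_order card_of_Well_order])
        (use par[OF that] False in \<open>auto simp: Field_card_of\<close>)
    then have "|\<Union>D\<in>\<D>. par D| \<le>o |\<D>|" by (intro card_of_UNION_ordLeq_infinite[OF False] card_of_mono1 subset_refl ballI)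
    then show ?thesis using D(1) ordLeq_ordLess_trans by blast
  qed
  then have A_card: "|A| <o \<kappa>"
    unfolding A_def by (rule card_of_Un_ordLess_infinite_Field[OF infk \<kappa>(1)]) (use AP(1) in \<open>auto intro: fin\<kappa>\<close>)
  have "type_def_group L M A n G \<D> P"
  proof (rule type_def_group.intro, goal_cases)
    case 3
    then show ?case using M by (simp add: is_structure_def)
  next
    case (4 \<Q>)
    then show ?case using saturated_omega[OF sat \<kappa>(1) nat\<kappa> A_sub A_card] by blast
  next
    case (5 D)
    then show ?case using par[OF 5] dfn_set_mono[of L M "par D" n D A] unfolding A_def by blast
  next
    case 6
    then show ?case using AP(3) dfn_set_mono[of L M AP "3 * n" P A] unfolding A_def by blast
  next
    case 7
    then show ?case unfolding A_def by blast
  qed (fact grp A_sub D(3) P(2))+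
  then show ?thesis by blast
qed

section \<open>Transfer between \<open>G\<close> and groups of bijections\<close>

lemma lower_central_subset:
  assumes "group H"
  shows "lower_central H i \<subseteq> carrier H"
proof (induction i)
  case (Suc i)
  interpret group H by fact
  have "(\<Union>h\<in>lower_central H i. \<Union>k\<in>carrier H. {h \<otimes>\<^bsub>H\<^esub> k \<otimes>\<^bsub>H\<^esub> inv\<^bsub>H\<^esub> h \<otimes>\<^bsub>H\<^esub> inv\<^bsub>H\<^esub> k}) \<subseteq> carrier H"
    using Suc by auto
  then show ?case using generate_incl unfolding lower_central.simps commutator_subgroup_def by blast
qed auto

lemma one_lower_central: "group H \<Longrightarrow> \<one>\<^bsub>H\<^esub> \<in> lower_central H i"
  by (cases i) (auto simp: commutator_subgroup_def intro: generate.one group.is_monoid monoid.one_closed)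

context type_def_group
begin

interpretation group G by (rule grp)

lemma subgroup_fitting: "subgroup (fitting_subgroup G) G"
  unfolding fitting_subgroup_def
  by (rule generate_is_subgroup) (auto dest: normal_imp_subgroup subgroup.mem_carrier)

text \<open>The regular representation carries the Fitting subgroup to a group \<open>F\<close> of
  bijections that is shown to be tame. Nilpotency, defined by lower central series, is translated
  into upper ones for the normal subgroups and back for \<open>F\<close>.\<close>

lemma nilpotent_fitting:
  assumes bounded: "\<And>ws p. \<exists>k d. k > 0 \<and>
    (\<forall>yss. length yss = d \<and> set yss \<subseteq> tuples_in (carrier G) p \<longrightarrow> \<not> tree (evsG ws) k yss (carrier G))"
  shows "nilpotent_group (G\<lparr>carrier := fitting_subgroup G\<rparr>)"
proof -
  define K where "K = fitting_subgroup G"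
  have sK: "subgroup K G" unfolding K_def by (rule subgroup_fitting)
  have KG: "K \<subseteq> carrier G" using sK by (rule subgroup.subset)
  obtain \<pi> :: "'a list \<Rightarrow> 'a list bijection" where
    \<pi>: "\<And>x y. x \<in> carrier G \<Longrightarrow> y \<in> carrier G \<Longrightarrow> \<pi> (x \<otimes> y) = \<pi> x + \<pi> y"
    and eq: "\<And>x y. x \<in> carrier G \<Longrightarrow> y \<in> carrier G \<Longrightarrow> \<pi> x = \<pi> y \<longleftrightarrow> (\<forall>z\<in>carrier G. x \<otimes> z = y \<otimes> z)"
    by (rule regular_embedding[OF grp, where c = "\<lambda>x. x"]) (simp, rule that)
  have inj: "inj_on \<pi> (carrier G)"
  proof (rule inj_onI)
    fix x y assume "x \<in> carrier G" "y \<in> carrier G" "\<pi> x = \<pi> y"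
    then have "x \<otimes> \<one> = y \<otimes> \<one>" using eq one_closed by blast
    then show "x = y" using \<open>x \<in> carrier G\<close> \<open>y \<in> carrier G\<close> by simp
  qed
  have \<pi>1: "\<pi> \<one> = 0" using \<pi>[OF one_closed one_closed] by (metis add.right_neutral add_left_imp_eq l_one one_closed)
  have \<pi>i: "\<pi> (inv x) = - \<pi> x" if "x \<in> carrier G" for x
    using \<pi>[OF that inv_closed[OF that]] that \<pi>1 by (metis minus_unique r_inv)
  have \<pi>c: "\<pi> (h \<otimes> k \<otimes> inv h \<otimes> inv k) = comm (\<pi> h) (\<pi> k)" if "h \<in> carrier G" "k \<in> carrier G" for h k
    using that by (simp add: \<pi> \<pi>i comm_def)
  have \<pi>conj: "\<pi> (h \<otimes> k \<otimes> inv h) = conjg (\<pi> h) (\<pi> k)" if "h \<in> carrier G" "k \<in> carrier G" for h k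
    using that by (simp add: \<pi> \<pi>i conjg_def)
  have sub: "sub_grp (\<pi> ` H)" if "subgroup H G" for H
  proof -
    note H = subgroup.subset[OF that]
    have "\<pi> x + \<pi> y \<in> \<pi> ` H" if "x \<in> H" "y \<in> H" for x y
      using \<pi>[of x y] H that subgroup.m_closed[OF \<open>subgroup H G\<close>] by (metis imageI subsetD)
    moreover have "- \<pi> x \<in> \<pi> ` H" if "x \<in> H" for x
      using \<pi>i[of x] H that subgroup.m_inv_closed[OF \<open>subgroup H G\<close>] by (metis imageI subsetD)
    moreover have "0 \<in> \<pi> ` H" using \<pi>1 subgroup.one_closed[OF that] by (metis imageI)
    ultimately show ?thesis unfolding sub_grp_def by blast
  qed
  define F where "F = \<pi> ` K"
  have sF: "sub_grp F" unfolding F_def by (rule sub[OF sK])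
  have nil: "nil_act F (\<pi> ` N)" if N: "N \<lhd> G" "nilpotent_group (G\<lparr>carrier := N\<rparr>)" for N
  proof -
    define H where "H = G\<lparr>carrier := N\<rparr>"
    have H: "carrier H = N" "\<And>x y. x \<otimes>\<^bsub>H\<^esub> y = x \<otimes> y" "\<one>\<^bsub>H\<^esub> = \<one>" unfolding H_def by auto
    have sN: "subgroup N G" using normal_imp_subgroup[OF N(1)] .
    have NG: "N \<subseteq> carrier G" using subgroup.subset[OF sN] .
    have Hinv: "inv\<^bsub>H\<^esub> x = inv x" if "x \<in> N" for x unfolding H_def by (rule m_inv_consistent[OF sN that])
    have NK: "N \<subseteq> K" unfolding K_def fitting_subgroup_def using N by (auto intro: generate.incl)
    have gH: "group H" using N(2) unfolding nilpotent_group_def H_def by blast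
    have nN: "normal_in F (\<pi> ` N)"
    proof -
      have "conjg f x \<in> \<pi> ` N" if fx: "f \<in> F" "x \<in> \<pi> ` N" for f x
      proof -
        obtain k y where ky: "k \<in> K" "f = \<pi> k" "y \<in> N" "x = \<pi> y" using fx unfolding F_def by auto
        have "k \<otimes> y \<otimes> inv k \<in> N" by (rule normal.inv_op_closed2[OF N(1)]) (use ky KG in auto)
        moreover have "\<pi> (k \<otimes> y \<otimes> inv k) = conjg f x"
          unfolding ky(2,4) by (rule \<pi>conj) (use ky KG NG in auto)
        ultimately show ?thesis by (metis imageI)
      qed
      then show ?thesis unfolding normal_in_def using sF sub[OF sN] NK unfolding F_def by blast
    qed
    obtain c where c: "lower_central H c = {\<one>}" using N(2) H(3) unfolding nilpotent_group_def H_def by auto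
    have lc: "lower_central H i \<subseteq> N" for i using lower_central_subset[OF gH] H(1) by simp
    have "\<pi> ` lower_central H (c - i) \<subseteq> ucs F (\<pi> ` N) {0} i" if "i \<le> c" for i
      using that
    proof (induction i)
      case (Suc i)
      show ?case
      proof
        fix z assume "z \<in> \<pi> ` lower_central H (c - Suc i)"
        then obtain x where x: "x \<in> lower_central H (c - Suc i)" "z = \<pi> x" by auto
        have xN: "x \<in> N" using lc x by blast
        have "comm (\<pi> x) (\<pi> k) \<in> ucs F (\<pi> ` N) {0} i" if k: "k \<in> N" for k
        proof -
          have "x \<otimes> k \<otimes> inv x \<otimes> inv k \<in> lower_central H (Suc (c - Suc i))"
            unfolding lower_central.simps commutator_subgroup_def
          proof (rule generate.incl)
            have "x \<otimes> k \<otimes> inv x \<otimes> inv k = x \<otimes>\<^bsub>H\<^esub> k \<otimes>\<^bsub>H\<^esub> inv\<^bsub>H\<^esub> x \<otimes>\<^bsub>H\<^esub> inv\<^bsub>H\<^esub> k"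
              unfolding H(2) Hinv[OF xN] Hinv[OF k] ..
            then show "x \<otimes> k \<otimes> inv x \<otimes> inv k \<in> (\<Union>h\<in>lower_central H (c - Suc i). \<Union>k\<in>carrier H.
                {h \<otimes>\<^bsub>H\<^esub> k \<otimes>\<^bsub>H\<^esub> inv\<^bsub>H\<^esub> h \<otimes>\<^bsub>H\<^esub> inv\<^bsub>H\<^esub> k})"
              using x(1) k unfolding H(1) by blast
          qed
          moreover have "Suc (c - Suc i) = c - i" using Suc.prems by simp
          ultimately have "\<pi> (x \<otimes> k \<otimes> inv x \<otimes> inv k) \<in> ucs F (\<pi> ` N) {0} i" using Suc by auto
          moreover have "x \<in> carrier G" "k \<in> carrier G" using xN k NG by auto
          ultimately show ?thesis using \<pi>c[of x k] by simp
        qed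
        then show "z \<in> ucs F (\<pi> ` N) {0} (Suc i)"
          unfolding ucs_Suc cent_mod_def x(2) F_def using xN NK by auto
      qed
    qed (use c \<pi>1 in auto)
    from this[of c] have "\<pi> ` N \<subseteq> ucs F (\<pi> ` N) {0} c" using H(1) by simp
    \<comment> \<open>One step beyond c, because commutators of \<open>F\<close> with the image of
      \<open>N\<close> lie in that image.\<close>
    then have "F \<subseteq> ucs F (\<pi> ` N) {0} (Suc c)"
      unfolding ucs_Suc cent_mod_def using normal_in_comm(2)[OF nN] by blast
    then show ?thesis unfolding nil_act_def using nN by blast
  qed
  have zero: "nil_act F {0}"
  proof -
    have "comm x 0 = 0" for x :: "'a list bijection" by (simp only: free_group_simps)
    then have "F \<subseteq> ucs F {0} {0} 1" by (auto simp: ucs_Suc cent_mod_def)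
    then show ?thesis unfolding nil_act_def using normal_in_zero[OF sF] by blast
  qed
  \<comment> \<open>Nilpotent actions are closed under sums, so a product of generators still lies
    in a single subgroup of this kind.\<close>
  have "\<exists>N. nil_act F N \<and> \<pi> x \<in> N" if "x \<in> K" for x
    using that unfolding K_def fitting_subgroup_def
  proof (induction rule: generate.induct)
    case one
    then show ?case using zero \<pi>1 by auto
  next
    case (incl h)
    then show ?case using nil by blast
  next
    case (inv h)
    then obtain N where N: "N \<lhd> G" "nilpotent_group (G\<lparr>carrier := N\<rparr>)" "h \<in> N" by blast
    then have "inv h \<in> N" by (intro subgroup.m_inv_closed[OF normal_imp_subgroup])
    then show ?case using nil N by blast
  next
    case (eng x y)
    then obtain N N' where N: "nil_act F N" "\<pi> x \<in> N" "nil_act F N'" "\<pi> y \<in> N'" by blast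
    have "x \<in> carrier G" "y \<in> carrier G" using eng(1,2) KG unfolding K_def fitting_subgroup_def by blast+
    then have "\<pi> (x \<otimes> y) \<in> set_sum N N'" using \<pi> set_sumI[OF N(2,4)] by simp
    then show ?case using nil_act_set_sum[OF N(1,3)] by blast
  qed
  then have fit: "fitting_group F" unfolding fitting_group_def using sF unfolding F_def by blast
  have ev: "ev w (\<pi> x) (map \<pi> ys) = \<pi> (evG w x ys)" if "x \<in> carrier G" "set ys \<subseteq> carrier G" for w x ys
    using evG_closed[OF that] that by (induction w) (auto simp: \<pi> \<pi>i \<pi>1)
  have wb: "word_bounded F"
    unfolding word_bounded_def
  proof (intro allI)
    fix ws p
    obtain k d where kd: "k > 0" "\<And>yss. length yss = d \<Longrightarrow> set yss \<subseteq> tuples_in (carrier G) p \<Longrightarrow> \<not> tree (evsG ws) k yss (carrier G)"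
      using bounded by metis
    have "\<not> tree (evs ws) k yss F" if yss: "length yss = d" "set yss \<subseteq> tuples_in F p" for yss
    proof
      assume tr: "tree (evs ws) k yss F"
      define yss' where "yss' = map (map (inv_into K \<pi>)) yss"
      have inv: "map \<pi> (map (inv_into K \<pi>) ys) = ys" "map (inv_into K \<pi>) ys \<in> tuples_in (carrier G) p" if "ys \<in> tuples_in F p" for ys
        using that KG inv_into_into[of _ \<pi> K] unfolding tuples_in_def F_def
        by (auto simp: subset_iff f_inv_into_f intro!: map_idI)
      have yss'G: "set yss' \<subseteq> tuples_in (carrier G) p" unfolding yss'_def using inv(2) yss(2) by auto
      have "map (map \<pi>) yss' = yss" unfolding yss'_def map_map comp_def
        by (rule map_idI) (use inv(1) yss(2) in \<open>auto simp: comp_def\<close>)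
      then have "tree (evs ws) k (map (map \<pi>) yss') (\<pi> ` K)" using tr F_def by simp
      then have tr': "tree (\<lambda>x ys. evs ws (\<pi> x) (map \<pi> ys)) k yss' K" by (simp only: tree_map tree_image)
      \<comment> \<open>\<open>\<pi>\<close> changes the type of the values but, being injective,
        not the fibres.\<close>
      have "tree (evsG ws) k yss' K"
      proof (rule tree_same_fibres[OF _ tr' kd(1)])
        fix x x' ys assume x: "x \<in> K" "x' \<in> K" "ys \<in> set yss'"
        then have G: "x \<in> carrier G" "x' \<in> carrier G" "set ys \<subseteq> carrier G" using KG yss'G unfolding tuples_in_def by auto
        have "evs ws (\<pi> x) (map \<pi> ys) = evs ws (\<pi> x') (map \<pi> ys) \<longleftrightarrow> (\<forall>w\<in>set ws. \<pi> (evG w x ys) = \<pi> (evG w x' ys))"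
          unfolding evs_def using ev G by simp
        also have "\<dots> \<longleftrightarrow> (\<forall>w\<in>set ws. evG w x ys = evG w x' ys)"
          using inj_on_eq_iff[OF inj] evG_closed G by blast
        also have "\<dots> \<longleftrightarrow> evsG ws x ys = evsG ws x' ys" unfolding evsG_def by simp
        finally show "evs ws (\<pi> x) (map \<pi> ys) = evs ws (\<pi> x') (map \<pi> ys) \<longleftrightarrow> evsG ws x ys = evsG ws x' ys" .
      qed
      then have "tree (evsG ws) k yss' (carrier G)" using tree_mono KG by blast
      then show False using kd(2)[OF _ yss'G] yss(1) unfolding yss'_def by simp
    qed
    then show "\<exists>k d. 0 < k \<and> (\<forall>yss. length yss = d \<and> set yss \<subseteq> tuples_in F p \<longrightarrow> \<not> tree (evs ws) k yss F)"
      using kd(1) by blast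
  qed
  \<comment> \<open>\<open>F\<close> consists of bijections of the very type in which
    \<open>G\<close> lives, so an inverse of \<open>\<pi>\<close> is the injection demanded by
    tameness.\<close>
  have "inj_on (inv_into K \<pi>) F" unfolding F_def by (rule inj_on_inv_into) simp
  then have "tame F" using fit wb unfolding tame_def by blast
  then obtain c where c: "F \<subseteq> ucs F F {0} c" using tame_nilpotent by blast
  define Z where "Z = ucs F F {0}"
  have nZ: "normal_in F (Z i)" for i
    unfolding Z_def by (rule normal_in_ucs[OF normal_in_zero[OF sF] normal_in_self[OF sF]])
  define H where "H = G\<lparr>carrier := K\<rparr>"
  have H: "carrier H = K" "\<And>x y. x \<otimes>\<^bsub>H\<^esub> y = x \<otimes> y" "\<one>\<^bsub>H\<^esub> = \<one>" unfolding H_def by auto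
  have gH: "group H" unfolding H_def by (rule subgroup.subgroup_is_group[OF sK grp])
  have Hinv: "inv\<^bsub>H\<^esub> x = inv x" if "x \<in> K" for x unfolding H_def by (rule m_inv_consistent[OF sK that])
  have lcK: "lower_central H i \<subseteq> K" for i using lower_central_subset[OF gH] H(1) by simp
  \<comment> \<open>The lower central series descends at least as fast as the upper one read
    backwards from c.\<close>
  have "\<pi> ` lower_central H i \<subseteq> Z (c - i)" for i
  proof (induction i)
    case 0
    then show ?case using c H(1) unfolding F_def Z_def by simp
  next
    case (Suc i)
    note Z' = normal_inD[OF nZ[of "c - Suc i"]]
    have gen: "\<pi> (h \<otimes>\<^bsub>H\<^esub> k \<otimes>\<^bsub>H\<^esub> inv\<^bsub>H\<^esub> h \<otimes>\<^bsub>H\<^esub> inv\<^bsub>H\<^esub> k) \<in> Z (c - Suc i)" if hk: "h \<in> lower_central H i" "k \<in> K" for h k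
    proof -
      have hK: "h \<in> K" using lcK hk(1) by blast
      have "\<pi> (h \<otimes>\<^bsub>H\<^esub> k \<otimes>\<^bsub>H\<^esub> inv\<^bsub>H\<^esub> h \<otimes>\<^bsub>H\<^esub> inv\<^bsub>H\<^esub> k) = comm (\<pi> h) (\<pi> k)"
        unfolding H Hinv[OF hK] Hinv[OF hk(2)] using \<pi>c hK hk(2) KG by blast
      moreover have hZ: "\<pi> h \<in> Z (c - i)" using Suc hk(1) by blast
      have "comm (\<pi> h) (\<pi> k) \<in> Z (c - Suc i)"
      proof (cases "c - i")
        case 0
        then have "\<pi> h = 0" using hZ unfolding Z_def by simp
        then have "comm (\<pi> h) (\<pi> k) = 0" by (simp only: free_group_simps)
        then show ?thesis using sub_grp_0[OF Z'(2)] by simp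
      next
        case (Suc j)
        then have "c - Suc i = j" by simp
        then show ?thesis using hZ Suc hk(2) unfolding Z_def F_def by (auto simp: ucs_Suc cent_mod_def)
      qed
      ultimately show ?thesis by simp
    qed
    have "x \<in> K \<and> \<pi> x \<in> Z (c - Suc i)" if "x \<in> lower_central H (Suc i)" for x
      using that unfolding lower_central.simps commutator_subgroup_def
    proof (induction rule: generate.induct)
      case one
      then show ?case using H(3) \<pi>1 sub_grp_0[OF Z'(2)] subgroup.one_closed[OF sK] by simp
    next
      case (incl x)
      then obtain h k where hk: "h \<in> lower_central H i" "k \<in> K"
        "x = h \<otimes>\<^bsub>H\<^esub> k \<otimes>\<^bsub>H\<^esub> inv\<^bsub>H\<^esub> h \<otimes>\<^bsub>H\<^esub> inv\<^bsub>H\<^esub> k" unfolding H(1) by blast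
      have "x \<in> lower_central H (Suc i)"
        unfolding lower_central.simps commutator_subgroup_def by (rule generate.incl[OF incl])
      then show ?case using gen[OF hk(1,2)] hk(3) lcK by blast
    next
      case (inv x)
      then obtain h k where hk: "h \<in> lower_central H i" "k \<in> K"
        "x = h \<otimes>\<^bsub>H\<^esub> k \<otimes>\<^bsub>H\<^esub> inv\<^bsub>H\<^esub> h \<otimes>\<^bsub>H\<^esub> inv\<^bsub>H\<^esub> k" unfolding H(1) by blast
      have "x \<in> lower_central H (Suc i)"
        unfolding lower_central.simps commutator_subgroup_def by (rule generate.incl[OF inv])
      then have xK: "x \<in> K" using lcK by blast
      then show ?case
        using gen[OF hk(1,2)] hk(3) sub_grp_minus[OF Z'(2)] \<pi>i[of x] Hinv[OF xK] KG subgroup.m_inv_closed[OF sK xK]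
        by (metis subsetD)
    next
      case (eng x y)
      then show ?case
        using H(2) \<pi>[of x y] KG sub_grp_add[OF Z'(2)] subgroup.m_closed[OF sK] by (metis subsetD)
    qed
    then show ?case by blast
  qed
  from this[of c] have triv: "\<pi> ` lower_central H c \<subseteq> {0}" unfolding Z_def by simp
  have "lower_central H c \<subseteq> {\<one>}"
  proof
    fix x assume x: "x \<in> lower_central H c"
    then have "\<pi> x = \<pi> \<one>" using triv \<pi>1 by auto
    moreover have "x \<in> carrier G" using x lcK KG by blast
    ultimately show "x \<in> {\<one>}" using inj_onD[OF inj _ _ one_closed] by simp
  qed
  then have "lower_central H c = {\<one>\<^bsub>H\<^esub>}" using one_lower_central[OF gH, of c] H(3) by auto
  then show ?thesis using gH unfolding nilpotent_group_def H_def K_def by blast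
qed

end

theorem theorem3p9:
  fixes L :: "('f, 'r) fo_language"
    and T :: "('f, 'r) fm set"
    and M :: "('f, 'r, 'a) fo_structure"
    and \<kappa> :: "'k rel"
    and n :: nat
    and G :: "('a list, 'b) monoid_scheme"
  assumes "complete_theory L T"
    and "simple_theory TYPE('a) L T"
    and "is_model L M T"
    and "Card_order \<kappa>"
    and "|formulas L| <o \<kappa>"
    and "saturated \<kappa> L M"
    and "type_definable_group \<kappa> L M n G"
  shows "nilpotent_group (G\<lparr>carrier := fitting_subgroup G\<rparr>)"
proof -
  have "is_structure L M" using assms(3) unfolding is_model_def by blast
  then obtain A \<D> P where "type_def_group L M A n G \<D> P"
    using type_def_groupI assms(4-7) by metis
  then interpret type_def_group L M A n G \<D> P .
  \<comment> \<open>Simplicity is applied to the given model, with k = 2.\<close>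
  have "\<not> has_tree_property M \<phi> n m' 2" if "\<phi> \<in> formulas_in L (n + m')" for m' \<phi>
    using assms(2,3) that unfolding simple_theory_def by blast
  then show ?thesis using nilpotent_fitting[OF word_trees_bounded] by blast
qed

end
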